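(* Let $U$ be a $3$-manifold, and let $t$ denote the coordinate on the $\mathbb{R}$-factor of $U\times\mathbb{R}$. (1) A contact sphere $(\alpha_1,\alpha_2,\alpha_3)$ on $U$ determines an oriented conformal structure on $U\times\mathbb{R}$, namely the unique one for which the $2$-forms $\Omega_i=d(e^t\alpha_i)$, $i=1,2,3$, are self-dual. (2) A naturally ordered taut contact sphere $(\alpha_1,\alpha_2,\alpha_3)$ on $U$ determines a hyperkähler structure $(g,J_1,J_2,J_3)$ on $U\times\mathbb{R}$, given by the equations $-g(\cdot,J_i\,\cdot)=d(e^t\alpha_i)=\Omega_i$, $i=1,2,3$. (3) Conformally equivalent contact spheres (resp. naturally ordered taut contact spheres) on $U$ determine isomorphic oriented conformal structures (resp. isomorphic hyperkähler structures) on $U\times\mathbb{R}$, where isomorphic means related by a diffeomorphism of $U\times\mathbb{R}$.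
   Context: Manifolds are smooth, connected and without boundary; $U$ need not be compact. A contact form on a $3$-manifold is a $1$-form $\alpha$ with $\alpha\wedge d\alpha$ nowhere zero. A contact sphere is a triple of $1$-forms $(\alpha_1,\alpha_2,\alpha_3)$ such that every linear combination $\lambda_1\alpha_1+\lambda_2\alpha_2+\lambda_3\alpha_3$ with constant $(\lambda_1,\lambda_2,\lambda_3)\in\mathbb{R}^3\setminus\{0\}$ is a contact form. It is taut if these contact forms define the same volume form $\alpha\wedge d\alpha$ for all $(\lambda_1,\lambda_2,\lambda_3)\in S^2$; equivalently, $\alpha_i\wedge d\alpha_i=\alpha_j\wedge d\alpha_j\neq 0$ and $\alpha_i\wedge d\alpha_j=-\alpha_j\wedge d\alpha_i$ for $i\neq j$. It is naturally ordered if each $\alpha_i\wedge d\alpha_i$ is a positive multiple of $\alpha_1\wedge\alpha_2\wedge\alpha_3$; throughout, contact spheres are assumed naturally ordered. Two (taut) contact spheres on $U$ are conformally equivalent if one is obtained from the other by multiplying all three forms by the same positive smooth function $U\to\mathbb{R}^+$. A hyperkähler structure consists of a Riemannian metric $g$ and three parallel $g$-orthogonal complex structures $J_1,J_2,J_3$ satisfying the quaternionic identities ($J_1J_2=J_3=-J_2J_1$). An oriented conformal structure is an orientation together with a conformal class of Riemannian metrics. *)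

theory Defs
  imports "HOL-Analysis.Analysis"
begin

section \<open>Smooth maps between open subsets of Euclidean spaces\<close>

primrec higher_differentiable_on ::
  "'e::real_normed_vector set \<Rightarrow> ('e \<Rightarrow> 'f::real_normed_vector) \<Rightarrow> nat \<Rightarrow> bool" where
  "higher_differentiable_on S f 0 \<longleftrightarrow> continuous_on S f"
| "higher_differentiable_on S f (Suc n) \<longleftrightarrow>
     (\<forall>x\<in>S. f differentiable (at x)) \<and>
     (\<forall>v. higher_differentiable_on S (\<lambda>x. frechet_derivative f (at x) v) n)"

text \<open>Only used for open sets \<open>S\<close>.\<close>

definition smooth_on ::
  "'e::real_normed_vector set \<Rightarrow> ('e \<Rightarrow> 'f::real_normed_vector) \<Rightarrow> bool" where
  "smooth_on S f \<longleftrightarrow> (\<forall>n. higher_differentiable_on S f n)"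


section \<open>Smooth manifolds\<close>

text \<open>
  A manifold is given by an indexed atlas; its underlying space is the union of the chart
  domains. Hausdorff and second countable are imposed through the sort of the point type.
\<close>

record ('i, 'a, 'e) atlas =
  charts :: "'i set"
  chart_dom :: "'i \<Rightarrow> 'a set"
  chart_map :: "'i \<Rightarrow> 'a \<Rightarrow> 'e"

definition carrier_of :: "('i, 'a, 'e) atlas \<Rightarrow> 'a set" where
  "carrier_of M = (\<Union>i\<in>charts M. chart_dom M i)"

definition chart_image :: "('i, 'a, 'e) atlas \<Rightarrow> 'i \<Rightarrow> 'e set" where
  "chart_image M i = chart_map M i ` chart_dom M i"

definition chart_inv :: "('i, 'a, 'e) atlas \<Rightarrow> 'i \<Rightarrow> 'e \<Rightarrow> 'a" where
  "chart_inv M i = inv_into (chart_dom M i) (chart_map M i)"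

definition in_chart :: "('i, 'a, 'e) atlas \<Rightarrow> 'i \<Rightarrow> 'e \<Rightarrow> bool" where
  "in_chart M i x \<longleftrightarrow> i \<in> charts M \<and> x \<in> chart_image M i"

text \<open>The expression of a map \<open>F\<close> from \<open>M\<close> to \<open>N\<close> in the charts \<open>i\<close> and \<open>j\<close>, and its domain.
  For \<open>M = N\<close> and \<open>F = id\<close> this is the transition map from chart \<open>i\<close> to chart \<open>j\<close>.\<close>

definition local_rep ::
  "('i, 'a, 'e) atlas \<Rightarrow> ('j, 'b, 'f) atlas \<Rightarrow> ('a \<Rightarrow> 'b) \<Rightarrow> 'i \<Rightarrow> 'j \<Rightarrow> 'e \<Rightarrow> 'f" where
  "local_rep M N F i j = (\<lambda>x. chart_map N j (F (chart_inv M i x)))"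

definition local_dom ::
  "('i, 'a, 'e) atlas \<Rightarrow> ('j, 'b, 'f) atlas \<Rightarrow> ('a \<Rightarrow> 'b) \<Rightarrow> 'i \<Rightarrow> 'j \<Rightarrow> 'e set" where
  "local_dom M N F i j = {x \<in> chart_image M i. F (chart_inv M i x) \<in> chart_dom N j}"

definition smooth_manifold ::
  "('i, 'a::{t2_space, second_countable_topology}, 'e::euclidean_space) atlas \<Rightarrow> bool" where
  "smooth_manifold M \<longleftrightarrow>
     (\<forall>i\<in>charts M. open (chart_dom M i) \<and> open (chart_image M i) \<and>
        homeomorphism (chart_dom M i) (chart_image M i) (chart_map M i) (chart_inv M i)) \<and>
     (\<forall>i\<in>charts M. \<forall>j\<in>charts M. smooth_on (local_dom M M id i j) (local_rep M M id i j)) \<and>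
     connected (carrier_of M)"

definition smooth_map ::
  "('i, 'a::topological_space, 'e::euclidean_space) atlas \<Rightarrow>
   ('j, 'b::topological_space, 'f::euclidean_space) atlas \<Rightarrow> ('a \<Rightarrow> 'b) \<Rightarrow> bool" where
  "smooth_map M N F \<longleftrightarrow>
     F ` carrier_of M \<subseteq> carrier_of N \<and> continuous_on (carrier_of M) F \<and>
     (\<forall>i\<in>charts M. \<forall>j\<in>charts N. smooth_on (local_dom M N F i j) (local_rep M N F i j))"

definition diffeomorphism ::
  "('i, 'a::topological_space, 'e::euclidean_space) atlas \<Rightarrow>
   ('j, 'b::topological_space, 'f::euclidean_space) atlas \<Rightarrow> ('a \<Rightarrow> 'b) \<Rightarrow> bool" where
  "diffeomorphism M N F \<longleftrightarrow>
     bij_betw F (carrier_of M) (carrier_of N) \<and>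
     smooth_map M N F \<and> smooth_map N M (inv_into (carrier_of M) F)"

definition smooth_function ::
  "('i, 'a, 'e::euclidean_space) atlas \<Rightarrow> ('a \<Rightarrow> real) \<Rightarrow> bool" where
  "smooth_function M f \<longleftrightarrow> (\<forall>i\<in>charts M. smooth_on (chart_image M i) (\<lambda>x. f (chart_inv M i x)))"

definition positive_function :: "('i, 'a, 'e::euclidean_space) atlas \<Rightarrow> ('a \<Rightarrow> real) \<Rightarrow> bool" where
  "positive_function M f \<longleftrightarrow> smooth_function M f \<and> (\<forall>p\<in>carrier_of M. 0 < f p)"

definition times_real :: "('i, 'a, 'e) atlas \<Rightarrow> ('i, 'a \<times> real, 'e \<times> real) atlas" where
  "times_real M =
     \<lparr>charts = charts M,
      chart_dom = (\<lambda>i. chart_dom M i \<times> UNIV),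
      chart_map = (\<lambda>i (p, t). (chart_map M i p, t))\<rparr>"


section \<open>Tensor fields\<close>

text \<open>
  A tensor field is the family of its coordinate expressions: \<open>T i x\<close> is the tensor at the
  point with coordinates \<open>x\<close> in chart \<open>i\<close>, as a tensor on the model space \<open>'e\<close>. These
  expressions transform into each other under the transition maps. They are normalised to be
  zero outside the chart images, so that equality of tensor fields is equality in HOL.
\<close>

type_synonym ('i, 'e) tensor1 = "'i \<Rightarrow> 'e \<Rightarrow> 'e \<Rightarrow> real"
type_synonym ('i, 'e) tensor2 = "'i \<Rightarrow> 'e \<Rightarrow> 'e \<Rightarrow> 'e \<Rightarrow> real"
type_synonym ('i, 'e) tensor4 = "'i \<Rightarrow> 'e \<Rightarrow> (4 \<Rightarrow> 'e) \<Rightarrow> real"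
type_synonym ('i, 'e) endo = "'i \<Rightarrow> 'e \<Rightarrow> 'e \<Rightarrow> 'e"

text \<open>\<open>pullbackN M N F T S\<close> says that \<open>S\<close> is the pullback of \<open>T\<close> along \<open>F\<close>; with \<open>F = id\<close> and
  \<open>S = T\<close> it is the transformation law under changes of charts.\<close>

definition pullback1 ::
  "('i, 'a, 'e::euclidean_space) atlas \<Rightarrow> ('j, 'b, 'f::euclidean_space) atlas \<Rightarrow> ('a \<Rightarrow> 'b) \<Rightarrow>
   ('j, 'f) tensor1 \<Rightarrow> ('i, 'e) tensor1 \<Rightarrow> bool" where
  "pullback1 M N F T S \<longleftrightarrow>
     (\<forall>i\<in>charts M. \<forall>j\<in>charts N. \<forall>x\<in>local_dom M N F i j. \<forall>u.
        let DF = frechet_derivative (local_rep M N F i j) (at x)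
        in S i x u = T j (local_rep M N F i j x) (DF u))"

definition pullback2 ::
  "('i, 'a, 'e::euclidean_space) atlas \<Rightarrow> ('j, 'b, 'f::euclidean_space) atlas \<Rightarrow> ('a \<Rightarrow> 'b) \<Rightarrow>
   ('j, 'f) tensor2 \<Rightarrow> ('i, 'e) tensor2 \<Rightarrow> bool" where
  "pullback2 M N F T S \<longleftrightarrow>
     (\<forall>i\<in>charts M. \<forall>j\<in>charts N. \<forall>x\<in>local_dom M N F i j. \<forall>u v.
        let DF = frechet_derivative (local_rep M N F i j) (at x)
        in S i x u v = T j (local_rep M N F i j x) (DF u) (DF v))"

definition pullback4 ::
  "('i, 'a, 'e::euclidean_space) atlas \<Rightarrow> ('j, 'b, 'f::euclidean_space) atlas \<Rightarrow> ('a \<Rightarrow> 'b) \<Rightarrow>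
   ('j, 'f) tensor4 \<Rightarrow> ('i, 'e) tensor4 \<Rightarrow> bool" where
  "pullback4 M N F T S \<longleftrightarrow>
     (\<forall>i\<in>charts M. \<forall>j\<in>charts N. \<forall>x\<in>local_dom M N F i j. \<forall>e.
        let DF = frechet_derivative (local_rep M N F i j) (at x)
        in S i x e = T j (local_rep M N F i j x) (\<lambda>a. DF (e a)))"

definition pullback_endo ::
  "('i, 'a, 'e::euclidean_space) atlas \<Rightarrow> ('j, 'b, 'f::euclidean_space) atlas \<Rightarrow> ('a \<Rightarrow> 'b) \<Rightarrow>
   ('j, 'f) endo \<Rightarrow> ('i, 'e) endo \<Rightarrow> bool" where
  "pullback_endo M N F T S \<longleftrightarrow>
     (\<forall>i\<in>charts M. \<forall>j\<in>charts N. \<forall>x\<in>local_dom M N F i j. \<forall>u.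
        let DF = frechet_derivative (local_rep M N F i j) (at x)
        in DF (S i x u) = T j (local_rep M N F i j x) (DF u))"

definition one_form :: "('i, 'a, 'e::euclidean_space) atlas \<Rightarrow> ('i, 'e) tensor1 \<Rightarrow> bool" where
  "one_form M T \<longleftrightarrow>
     (\<forall>i x. \<not> in_chart M i x \<longrightarrow> T i x = (\<lambda>_. 0)) \<and>
     (\<forall>i x. in_chart M i x \<longrightarrow> linear (T i x)) \<and>
     (\<forall>i\<in>charts M. \<forall>v. smooth_on (chart_image M i) (\<lambda>x. T i x v)) \<and>
     pullback1 M M id T T"

definition tensor_field2 :: "('i, 'a, 'e::euclidean_space) atlas \<Rightarrow> ('i, 'e) tensor2 \<Rightarrow> bool" where
  "tensor_field2 M T \<longleftrightarrow>
     (\<forall>i x. \<not> in_chart M i x \<longrightarrow> T i x = (\<lambda>_ _. 0)) \<and>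
     (\<forall>i x. in_chart M i x \<longrightarrow> bilinear (T i x)) \<and>
     (\<forall>i\<in>charts M. \<forall>u v. smooth_on (chart_image M i) (\<lambda>x. T i x u v)) \<and>
     pullback2 M M id T T"

definition four_form :: "('i, 'a, 'e::euclidean_space) atlas \<Rightarrow> ('i, 'e) tensor4 \<Rightarrow> bool" where
  "four_form M T \<longleftrightarrow>
     (\<forall>i x. \<not> in_chart M i x \<longrightarrow> T i x = (\<lambda>_. 0)) \<and>
     (\<forall>i x. in_chart M i x \<longrightarrow>
        (\<forall>e a. linear (\<lambda>v. T i x (e(a := v)))) \<and>
        (\<forall>e a b. a \<noteq> b \<and> e a = e b \<longrightarrow> T i x e = 0)) \<and>
     (\<forall>i\<in>charts M. \<forall>e. smooth_on (chart_image M i) (\<lambda>x. T i x e)) \<and>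
     pullback4 M M id T T"

definition endo_field :: "('i, 'a, 'e::euclidean_space) atlas \<Rightarrow> ('i, 'e) endo \<Rightarrow> bool" where
  "endo_field M T \<longleftrightarrow>
     (\<forall>i x. \<not> in_chart M i x \<longrightarrow> T i x = (\<lambda>_. 0)) \<and>
     (\<forall>i x. in_chart M i x \<longrightarrow> linear (T i x)) \<and>
     (\<forall>i\<in>charts M. \<forall>v. smooth_on (chart_image M i) (\<lambda>x. T i x v)) \<and>
     pullback_endo M M id T T"


section \<open>Exterior algebra and exterior derivative\<close>

text \<open>Wedge products use the normalisation \<open>(a \<and> b)(u,v) = a(u) b(v) - a(v) b(u)\<close>.\<close>

definition wedge11 :: "('e \<Rightarrow> real) \<Rightarrow> ('e \<Rightarrow> real) \<Rightarrow> 'e \<Rightarrow> 'e \<Rightarrow> real" where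
  "wedge11 a b u v = a u * b v - a v * b u"

definition wedge12 :: "('e \<Rightarrow> real) \<Rightarrow> ('e \<Rightarrow> 'e \<Rightarrow> real) \<Rightarrow> 'e \<Rightarrow> 'e \<Rightarrow> 'e \<Rightarrow> real" where
  "wedge12 a b u v w = a u * b v w - a v * b u w + a w * b u v"

definition wedge22 :: "('e \<Rightarrow> 'e \<Rightarrow> real) \<Rightarrow> ('e \<Rightarrow> 'e \<Rightarrow> real) \<Rightarrow> (4 \<Rightarrow> 'e) \<Rightarrow> real" where
  "wedge22 a b e =
       a (e 1) (e 2) * b (e 3) (e 4) - a (e 1) (e 3) * b (e 2) (e 4) + a (e 1) (e 4) * b (e 2) (e 3)
     + a (e 2) (e 3) * b (e 1) (e 4) - a (e 2) (e 4) * b (e 1) (e 3) + a (e 3) (e 4) * b (e 1) (e 2)"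

text \<open>\<open>d\<alpha>(u,v) = u(\<alpha>(v)) - v(\<alpha>(u))\<close> for constant coordinate vector fields \<open>u\<close>, \<open>v\<close>.\<close>

definition ext_deriv ::
  "('i, 'a, 'e::euclidean_space) atlas \<Rightarrow> ('i, 'e) tensor1 \<Rightarrow> ('i, 'e) tensor2" where
  "ext_deriv M T i x u v =
     (if in_chart M i x
      then frechet_derivative (\<lambda>y. T i y v) (at x) u - frechet_derivative (\<lambda>y. T i y u) (at x) v
      else 0)"


section \<open>Contact spheres\<close>

definition contact_volume ::
  "('i, 'a, 'e::euclidean_space) atlas \<Rightarrow> ('i, 'e) tensor1 \<Rightarrow>
   'i \<Rightarrow> 'e \<Rightarrow> 'e \<Rightarrow> 'e \<Rightarrow> 'e \<Rightarrow> real" where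
  "contact_volume M T i x = wedge12 (T i x) (ext_deriv M T i x)"

definition contact_form ::
  "('i, 'a, real^3) atlas \<Rightarrow> ('i, real^3) tensor1 \<Rightarrow> bool" where
  "contact_form M T \<longleftrightarrow>
     one_form M T \<and> (\<forall>i x. in_chart M i x \<longrightarrow> (\<exists>u v w. contact_volume M T i x u v w \<noteq> 0))"

definition lin_comb :: "real^3 \<Rightarrow> (3 \<Rightarrow> ('i, 'e) tensor1) \<Rightarrow> ('i, 'e) tensor1" where
  "lin_comb c \<alpha> = (\<lambda>i x v. \<Sum>k\<in>UNIV. c $ k * \<alpha> k i x v)"

definition contact_sphere ::
  "('i, 'a, real^3) atlas \<Rightarrow> (3 \<Rightarrow> ('i, real^3) tensor1) \<Rightarrow> bool" where
  "contact_sphere M \<alpha> \<longleftrightarrow>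
     (\<forall>k. one_form M (\<alpha> k)) \<and> (\<forall>c. c \<noteq> 0 \<longrightarrow> contact_form M (lin_comb c \<alpha>))"

definition taut ::
  "('i, 'a, real^3) atlas \<Rightarrow> (3 \<Rightarrow> ('i, real^3) tensor1) \<Rightarrow> bool" where
  "taut M \<alpha> \<longleftrightarrow>
     (\<forall>b\<in>sphere 0 1. \<forall>c\<in>sphere 0 1. \<forall>i x. in_chart M i x \<longrightarrow>
        contact_volume M (lin_comb b \<alpha>) i x = contact_volume M (lin_comb c \<alpha>) i x)"

definition naturally_ordered ::
  "('i, 'a, real^3) atlas \<Rightarrow> (3 \<Rightarrow> ('i, real^3) tensor1) \<Rightarrow> bool" where
  "naturally_ordered M \<alpha> \<longleftrightarrow>
     (\<forall>k i x. in_chart M i x \<longrightarrow>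
        (\<exists>r>0. \<forall>u v w. contact_volume M (\<alpha> k) i x u v w =
           r * wedge12 (\<alpha> 1 i x) (wedge11 (\<alpha> 2 i x) (\<alpha> 3 i x)) u v w))"

definition conformally_equivalent ::
  "('i, 'a, real^3) atlas \<Rightarrow> (3 \<Rightarrow> ('i, real^3) tensor1) \<Rightarrow> (3 \<Rightarrow> ('i, real^3) tensor1) \<Rightarrow> bool" where
  "conformally_equivalent M \<alpha> \<beta> \<longleftrightarrow>
     (\<exists>f. positive_function M f \<and>
        (\<forall>k i x v. in_chart M i x \<longrightarrow> \<beta> k i x v = f (chart_inv M i x) * \<alpha> k i x v))"

text \<open>The 1-form \<open>e\<^sup>t \<alpha>\<close> on the product with the real line, with \<open>\<alpha>\<close> pulled back along the
  projection, and the 2-form \<open>\<Omega>\<^sub>k = d(e\<^sup>t \<alpha>\<^sub>k)\<close>.\<close>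

definition exp_form :: "('i, 'e) tensor1 \<Rightarrow> ('i, 'e \<times> real) tensor1" where
  "exp_form T = (\<lambda>i (x, t) (v, s). exp t * T i x v)"

definition Omega ::
  "('i, 'a, 'e::euclidean_space) atlas \<Rightarrow> (3 \<Rightarrow> ('i, 'e) tensor1) \<Rightarrow>
   3 \<Rightarrow> ('i, 'e \<times> real) tensor2" where
  "Omega M \<alpha> k = ext_deriv (times_real M) (exp_form (\<alpha> k))"


section \<open>Oriented conformal structures and self-duality\<close>

definition riemannian_metric ::
  "('i, 'a, 'e::euclidean_space) atlas \<Rightarrow> ('i, 'e) tensor2 \<Rightarrow> bool" where
  "riemannian_metric M g \<longleftrightarrow>
     tensor_field2 M g \<and>
     (\<forall>i x. in_chart M i x \<longrightarrow>
        (\<forall>u v. g i x u v = g i x v u) \<and> (\<forall>v. v \<noteq> 0 \<longrightarrow> 0 < g i x v v))"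

definition conformal_rel ::
  "('i, 'a, 'e::euclidean_space) atlas \<Rightarrow> (('i, 'e) tensor2 \<times> ('i, 'e) tensor2) set" where
  "conformal_rel M =
     {(g, h). riemannian_metric M g \<and> riemannian_metric M h \<and>
        (\<exists>f. positive_function M f \<and>
           (\<forall>i x u v. in_chart M i x \<longrightarrow> h i x u v = f (chart_inv M i x) * g i x u v))}"

definition conformal_classes ::
  "('i, 'a, 'e::euclidean_space) atlas \<Rightarrow> ('i, 'e) tensor2 set set" where
  "conformal_classes M = {g. riemannian_metric M g} // conformal_rel M"

definition volume_form ::
  "('i, 'a, 'e::euclidean_space) atlas \<Rightarrow> ('i, 'e) tensor4 \<Rightarrow> bool" where
  "volume_form M m \<longleftrightarrow> four_form M m \<and> (\<forall>i x. in_chart M i x \<longrightarrow> (\<exists>e. m i x e \<noteq> 0))"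

definition orientation_rel ::
  "('i, 'a, 'e::euclidean_space) atlas \<Rightarrow> (('i, 'e) tensor4 \<times> ('i, 'e) tensor4) set" where
  "orientation_rel M =
     {(m, n). volume_form M m \<and> volume_form M n \<and>
        (\<exists>f. positive_function M f \<and>
           (\<forall>i x e. in_chart M i x \<longrightarrow> n i x e = f (chart_inv M i x) * m i x e))}"

text \<open>An orientation of a 4-manifold is a class of nowhere vanishing 4-forms up to positive
  factors.\<close>

definition orientations ::
  "('i, 'a, 'e::euclidean_space) atlas \<Rightarrow> ('i, 'e) tensor4 set set" where
  "orientations M = {m. volume_form M m} // orientation_rel M"

definition oriented_conformal_structures ::
  "('i, 'a, 'e::euclidean_space) atlas \<Rightarrow> (('i, 'e) tensor4 set \<times> ('i, 'e) tensor2 set) set" where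
  "oriented_conformal_structures M = orientations M \<times> conformal_classes M"

definition alternating2 :: "('e::real_vector \<Rightarrow> 'e \<Rightarrow> real) \<Rightarrow> bool" where
  "alternating2 w \<longleftrightarrow> bilinear w \<and> (\<forall>v. w v v = 0)"

definition oriented_orthonormal ::
  "('e \<Rightarrow> 'e \<Rightarrow> real) \<Rightarrow> ((4 \<Rightarrow> 'e) \<Rightarrow> real) \<Rightarrow> (4 \<Rightarrow> 'e) \<Rightarrow> bool" where
  "oriented_orthonormal g m e \<longleftrightarrow>
     (\<forall>a b. g (e a) (e b) = (if a = b then 1 else 0)) \<and> 0 < m e"

text \<open>\<open>s\<close> is the Hodge dual of the 2-form \<open>w\<close> on a 4-dimensional space with scalar product \<open>g\<close>
  and orientation given by \<open>m\<close>: \<open>q \<and> s = \<langle>q, w\<rangle> vol\<close> for all 2-forms \<open>q\<close>. This identity of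
  4-forms is evaluated on oriented orthonormal bases, where \<open>vol\<close> is 1; the factor 1/2
  compensates for summing over all pairs instead of the pairs with \<open>a < b\<close>.\<close>

definition is_hodge_dual ::
  "('e::real_vector \<Rightarrow> 'e \<Rightarrow> real) \<Rightarrow> ((4 \<Rightarrow> 'e) \<Rightarrow> real) \<Rightarrow>
   ('e \<Rightarrow> 'e \<Rightarrow> real) \<Rightarrow> ('e \<Rightarrow> 'e \<Rightarrow> real) \<Rightarrow> bool" where
  "is_hodge_dual g m w s \<longleftrightarrow>
     alternating2 s \<and>
     (\<forall>q e. alternating2 q \<and> oriented_orthonormal g m e \<longrightarrow>
        wedge22 q s e = (1/2) * (\<Sum>a\<in>UNIV. \<Sum>b\<in>UNIV. q (e a) (e b) * w (e a) (e b)))"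

definition self_dual ::
  "('i, 'a, 'e::euclidean_space) atlas \<Rightarrow> ('i, 'e) tensor2 \<Rightarrow> ('i, 'e) tensor4 \<Rightarrow>
   ('i, 'e) tensor2 \<Rightarrow> bool" where
  "self_dual M g m w \<longleftrightarrow>
     (\<forall>i x. in_chart M i x \<longrightarrow> is_hodge_dual (g i x) (m i x) (w i x) (w i x))"

definition determines_conformal ::
  "('i, 'a, real^3) atlas \<Rightarrow> (3 \<Rightarrow> ('i, real^3) tensor1) \<Rightarrow>
   ('i, (real^3) \<times> real) tensor4 set \<times> ('i, (real^3) \<times> real) tensor2 set \<Rightarrow> bool" where
  "determines_conformal U \<alpha> C \<longleftrightarrow>
     C \<in> oriented_conformal_structures (times_real U) \<and>
     (\<forall>m\<in>fst C. \<forall>g\<in>snd C. \<forall>k. self_dual (times_real U) g m (Omega U \<alpha> k))"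

definition isomorphic_conformal ::
  "('i, 'a::topological_space, 'e::euclidean_space) atlas \<Rightarrow>
   ('i, 'e) tensor4 set \<times> ('i, 'e) tensor2 set \<Rightarrow>
   ('i, 'e) tensor4 set \<times> ('i, 'e) tensor2 set \<Rightarrow> bool" where
  "isomorphic_conformal M C C' \<longleftrightarrow>
     (\<exists>F. diffeomorphism M M F \<and>
        (\<forall>m'\<in>fst C'. \<exists>m\<in>fst C. pullback4 M M F m' m) \<and>
        (\<forall>g'\<in>snd C'. \<exists>g\<in>snd C. pullback2 M M F g' g))"


section \<open>Hyperkaehler structures\<close>

text \<open>The Levi-Civita covariant derivative of the constant coordinate field \<open>v\<close> in direction \<open>u\<close>,
  given by the Koszul formula.\<close>

definition christoffel ::
  "('i, 'e::euclidean_space) tensor2 \<Rightarrow> 'i \<Rightarrow> 'e \<Rightarrow> 'e \<Rightarrow> 'e \<Rightarrow> 'e" where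
  "christoffel g i x u v =
     (THE z. \<forall>w. g i x z w =
        (1/2) * (frechet_derivative (\<lambda>y. g i y v w) (at x) u
               + frechet_derivative (\<lambda>y. g i y u w) (at x) v
               - frechet_derivative (\<lambda>y. g i y u v) (at x) w))"

text \<open>\<open>(\<nabla>\<^sub>u J) v = \<nabla>\<^sub>u (J v) - J (\<nabla>\<^sub>u v)\<close> for constant coordinate fields \<open>u\<close>, \<open>v\<close>.\<close>

definition parallel_endo ::
  "('i, 'a, 'e::euclidean_space) atlas \<Rightarrow> ('i, 'e) tensor2 \<Rightarrow> ('i, 'e) endo \<Rightarrow> bool" where
  "parallel_endo M g J \<longleftrightarrow>
     (\<forall>i x u v. in_chart M i x \<longrightarrow>
        frechet_derivative (\<lambda>y. J i y v) (at x) u + christoffel g i x u (J i x v)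
          - J i x (christoffel g i x u v) = 0)"

text \<open>The Nijenhuis tensor \<open>[J u, J v] - J [J u, v] - J [u, J v] - [u, v]\<close> on constant coordinate
  fields \<open>u\<close>, \<open>v\<close>.\<close>

definition nijenhuis :: "('i, 'e::euclidean_space) endo \<Rightarrow> 'i \<Rightarrow> 'e \<Rightarrow> 'e \<Rightarrow> 'e \<Rightarrow> 'e" where
  "nijenhuis J i x u v =
     (let DJ = (\<lambda>a b. frechet_derivative (\<lambda>y. J i y b) (at x) a)
      in DJ (J i x u) v - DJ (J i x v) u + J i x (DJ v u) - J i x (DJ u v))"

definition complex_structure ::
  "('i, 'a, 'e::euclidean_space) atlas \<Rightarrow> ('i, 'e) endo \<Rightarrow> bool" where
  "complex_structure M J \<longleftrightarrow>
     endo_field M J \<and>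
     (\<forall>i x u. in_chart M i x \<longrightarrow> J i x (J i x u) = - u) \<and>
     (\<forall>i x u v. in_chart M i x \<longrightarrow> nijenhuis J i x u v = 0)"

definition hyperkaehler ::
  "('i, 'a, 'e::euclidean_space) atlas \<Rightarrow> ('i, 'e) tensor2 \<Rightarrow> (3 \<Rightarrow> ('i, 'e) endo) \<Rightarrow> bool" where
  "hyperkaehler M g J \<longleftrightarrow>
     riemannian_metric M g \<and>
     (\<forall>k. complex_structure M (J k) \<and> parallel_endo M g (J k) \<and>
        (\<forall>i x u v. in_chart M i x \<longrightarrow> g i x (J k i x u) (J k i x v) = g i x u v)) \<and>
     (\<forall>i x u. in_chart M i x \<longrightarrow>
        J 1 i x (J 2 i x u) = J 3 i x u \<and> J 2 i x (J 1 i x u) = - J 3 i x u)"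

definition determines_hyperkaehler ::
  "('i, 'a, real^3) atlas \<Rightarrow> (3 \<Rightarrow> ('i, real^3) tensor1) \<Rightarrow>
   ('i, (real^3) \<times> real) tensor2 \<times> (3 \<Rightarrow> ('i, (real^3) \<times> real) endo) \<Rightarrow> bool" where
  "determines_hyperkaehler U \<alpha> H \<longleftrightarrow>
     (case H of (g, J) \<Rightarrow>
        hyperkaehler (times_real U) g J \<and>
        (\<forall>k i x u v. in_chart (times_real U) i x \<longrightarrow> - g i x u (J k i x v) = Omega U \<alpha> k i x u v))"

definition isomorphic_hyperkaehler ::
  "('i, 'a::topological_space, 'e::euclidean_space) atlas \<Rightarrow>
   ('i, 'e) tensor2 \<times> (3 \<Rightarrow> ('i, 'e) endo) \<Rightarrow>
   ('i, 'e) tensor2 \<times> (3 \<Rightarrow> ('i, 'e) endo) \<Rightarrow> bool" where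
  "isomorphic_hyperkaehler M H H' \<longleftrightarrow>
     (\<exists>F. diffeomorphism M M F \<and>
        pullback2 M M F (fst H') (fst H) \<and>
        (\<forall>k. pullback_endo M M F (snd H' k) (snd H k)))"

end

theory Submission
  imports Defs
begin

text \<open>
  Write \<open>A\<close> for the matrix of the functions \<open>\<alpha>\<^sub>j \<and> d\<alpha>\<^sub>k\<close> relative to \<open>\<alpha>\<^sub>1 \<and> \<alpha>\<^sub>2 \<and> \<alpha>\<^sub>3\<close>. For a naturally
  ordered contact sphere its symmetric part is positive definite, and its Cholesky factorisation
  yields a frame in which every \<open>\<Omega>\<^sub>k\<close> is a combination of the three standard self-dual 2-forms,
  that is \<open>\<Omega>\<^sub>k = - h(\<cdot>, q\<^sub>k \<cdot>)\<close> for a scalar product \<open>h\<close> and linearly independent imaginary quaternions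
  \<open>q\<^sub>k\<close>; for a taut sphere the \<open>q\<^sub>k\<close> can be taken to be \<open>i\<close>, \<open>j\<close>, \<open>k\<close>. Put \<open>J = \<Omega>\<^sub>1\<^sup>-\<^sup>1 \<Omega>\<^sub>3\<close>. The
  symmetrisation of \<open>\<Omega>\<^sub>2(\<cdot>, J \<cdot>)\<close> is then a positive multiple of \<open>h\<close>; it is smooth and natural
  because it is built from the \<open>\<Omega>\<^sub>k\<close> alone, and any metric making the \<open>\<Omega>\<^sub>k\<close> self-dual is a
  multiple of it, which gives (1). In the taut case it equals \<open>h\<close>, and closedness of the \<open>\<Omega>\<^sub>k\<close>
  together with the quaternion relations forces \<open>\<nabla>J\<^sub>k = 0\<close> (Hitchin's lemma), which gives (2).
  If \<open>\<beta> = f \<alpha>\<close>, the translation \<open>(p, t) \<mapsto> (p, t - ln (f p))\<close> pulls the forms of \<open>\<beta>\<close> back to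
  those of \<open>\<alpha>\<close>, which gives (3).
\<close>

section \<open>Calculus of smooth maps\<close>

text \<open>Write \<open>M_k\<close> for the imaginary quaternion with
  \<open>\<Omega>\<^sub>k = - h(., M_k .)\<close>, and \<open>c\<close> for the squared length of
  \<open>M_1\<close>. Then \<open>J = \<Omega>\<^sub>1\<^sup>-\<^sup>1 \<Omega>\<^sub>3\<close> is
  \<open>- M_1 M_3 / c\<close>, so \<open>\<Omega>\<^sub>2(., J .)\<close> is
  \<open>h(., M_2 M_1 M_3 .) / c\<close>. The real part of a product of three imaginary quaternions
  is, up to sign, the determinant of their coefficients, and its imaginary part is skew for
  \<open>h\<close>. Symmetrising therefore leaves a multiple of \<open>h\<close>. In the Cholesky
  frame the coefficient matrix is triangular with positive diagonal, which makes the factor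
  positive. That frame depends on choices made point by point, so it serves only for pointwise
  identities. Smoothness and behaviour under maps come from explicit formulas in the forms. The
  orientation is handled in the same way through
  \<open>\<Omega>\<^sub>1 \<and> \<Omega>\<^sub>1\<close>. Tensor fields are coordinate expressions
  whose smoothness is tested on constant vectors only; basis expansions therefore recur wherever an
  argument varies with the point.\<close>

lemma linear_euclidean_sum:
  fixes A :: "'f::euclidean_space \<Rightarrow> 'g::real_vector"
  assumes "linear A"
  shows "(\<Sum>b\<in>Basis. (v \<bullet> b) *\<^sub>R A b) = A v"
proof -
  have "(\<Sum>b\<in>Basis. (v \<bullet> b) *\<^sub>R A b) = A (\<Sum>b\<in>Basis. (v \<bullet> b) *\<^sub>R b)"
    by (simp only: linear_sum[OF assms] linear_scale[OF assms])
  then show ?thesis by (simp only: euclidean_representation)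
qed

lemma higher_differentiable_on_cong:
  assumes "open S" "\<And>x. x \<in> S \<Longrightarrow> f x = g x" "higher_differentiable_on S f n"
  shows "higher_differentiable_on S g n"
  using assms(2,3)
proof (induction n arbitrary: f g)
  case 0
  then show ?case using continuous_on_cong by force
next
  case (Suc n)
  have der: "(g has_derivative frechet_derivative f (at x)) (at x)" if "x \<in> S" for x
    using has_derivative_transform_within_open[of f _ x UNIV S g] Suc.prems that \<open>open S\<close>
      frechet_derivative_works by (metis UNIV_I higher_differentiable_on.simps(2))
  have "frechet_derivative g (at x) = frechet_derivative f (at x)" if "x \<in> S" for x
    using der[OF that] frechet_derivative_at by metis
  then show ?case
    using Suc.prems Suc.IH[of "\<lambda>x. frechet_derivative f (at x) _" "\<lambda>x. frechet_derivative g (at x) _"]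
      der differentiable_def by (simp, metis)
qed

lemma smooth_on_cong:
  "open S \<Longrightarrow> (\<And>x. x \<in> S \<Longrightarrow> f x = g x) \<Longrightarrow> smooth_on S f \<Longrightarrow> smooth_on S g"
  unfolding smooth_on_def using higher_differentiable_on_cong by blast

text \<open>\<open>frechet_derivative\<close> is a choice operator. This rule lets an explicit
  derivative take its place, so that inductions on the order can be run on formulas.\<close>

lemma higher_differentiable_on_SucI:
  assumes "open S" "\<And>x. x \<in> S \<Longrightarrow> (f has_derivative D x) (at x)"
    "\<And>v. higher_differentiable_on S (\<lambda>x. D x v) n"
  shows "higher_differentiable_on S f (Suc n)"
proof -
  have "D x = frechet_derivative f (at x)" if "x \<in> S" for x
    using assms(2)[OF that] frechet_derivative_at by metis
  then show ?thesis
    using assms higher_differentiable_on_cong[OF assms(1), of "\<lambda>x. D x _" "\<lambda>x. frechet_derivative f (at x) _"]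
    by (auto simp: differentiable_def)
qed

lemma higher_differentiable_on_SucD:
  assumes "higher_differentiable_on S f (Suc n)"
  shows "\<And>x. x \<in> S \<Longrightarrow> (f has_derivative frechet_derivative f (at x)) (at x)"
    "\<And>v. higher_differentiable_on S (\<lambda>x. frechet_derivative f (at x) v) n"
  using assms frechet_derivative_works by auto

lemma higher_differentiable_on_imp_continuous_on:
  assumes "higher_differentiable_on S f n" shows "continuous_on S f"
proof (cases n)
  case (Suc m)
  then show ?thesis
    using assms differentiable_imp_continuous_within continuous_at_imp_continuous_on
    by (metis higher_differentiable_on.simps(2))
qed (use assms in simp)

lemma higher_differentiable_on_Suc_imp:
  "higher_differentiable_on S f (Suc n) \<Longrightarrow> higher_differentiable_on S f n"
proof (induction n arbitrary: f)
  case 0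
  then show ?case using higher_differentiable_on_imp_continuous_on[OF 0] by simp
next
  case (Suc n)
  then show ?case by (metis higher_differentiable_on.simps(2))
qed

lemma higher_differentiable_on_const: "higher_differentiable_on S (\<lambda>x. c) n"
  by (induction n arbitrary: c) auto

lemma higher_differentiable_on_bounded_linear:
  assumes "open S" "bounded_linear L" "higher_differentiable_on S f n"
  shows "higher_differentiable_on S (\<lambda>x. L (f x)) n"
  using assms(3)
proof (induction n arbitrary: f)
  case 0
  then show ?case using assms(2) by (auto intro: bounded_linear.continuous_on)
next
  case (Suc n)
  note f = higher_differentiable_on_SucD[OF Suc.prems]
  show ?case
    by (rule higher_differentiable_on_SucI[OF assms(1) bounded_linear.has_derivative[OF assms(2) f(1)]])
      (simp_all add: Suc.IH f(2))
qed

lemma higher_differentiable_on_id: "open S \<Longrightarrow> higher_differentiable_on S (\<lambda>x. x) n"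
  by (cases n) (auto simp: higher_differentiable_on_const)

lemma higher_differentiable_on_add:
  assumes "open S" "higher_differentiable_on S f n" "higher_differentiable_on S g n"
  shows "higher_differentiable_on S (\<lambda>x. f x + g x) n"
  using assms(2,3)
proof (induction n arbitrary: f g)
  case 0
  then show ?case by (auto intro: continuous_intros)
next
  case (Suc n)
  note f = higher_differentiable_on_SucD[OF Suc.prems(1)]
  note g = higher_differentiable_on_SucD[OF Suc.prems(2)]
  show ?case
    by (rule higher_differentiable_on_SucI[OF assms(1) has_derivative_add[OF f(1) g(1)]])
      (simp_all add: Suc.IH f(2) g(2))
qed

lemma higher_differentiable_on_sum:
  assumes "open S" "\<And>i. i \<in> I \<Longrightarrow> higher_differentiable_on S (f i) n"
  shows "higher_differentiable_on S (\<lambda>x. \<Sum>i\<in>I. f i x) n"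
  using assms
  by (induction I rule: infinite_finite_induct)
    (auto simp: higher_differentiable_on_const intro: higher_differentiable_on_add)

lemma higher_differentiable_on_scaleR:
  fixes f :: "'e::real_normed_vector \<Rightarrow> real"
  assumes "open S" "higher_differentiable_on S f n" "higher_differentiable_on S g n"
  shows "higher_differentiable_on S (\<lambda>x. f x *\<^sub>R g x) n"
  using assms(2,3)
proof (induction n arbitrary: f g)
  case 0
  then show ?case by (auto intro: continuous_intros)
next
  case (Suc n)
  note f = higher_differentiable_on_SucD[OF Suc.prems(1)]
  note g = higher_differentiable_on_SucD[OF Suc.prems(2)]
  show ?case
    by (rule higher_differentiable_on_SucI[OF assms(1) has_derivative_scaleR[OF f(1) g(1)]])
      (auto intro!: higher_differentiable_on_add[OF assms(1)] Suc.IH f(2) g(2)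
        higher_differentiable_on_Suc_imp[OF Suc.prems(1)] higher_differentiable_on_Suc_imp[OF Suc.prems(2)])
qed

lemma higher_differentiable_on_compose:
  fixes f :: "'e::real_normed_vector \<Rightarrow> 'f::euclidean_space"
  assumes "open S" "f ` S \<subseteq> T" "higher_differentiable_on S f n" "higher_differentiable_on T g n"
  shows "higher_differentiable_on S (\<lambda>x. g (f x)) n"
  using assms(3,4)
proof (induction n arbitrary: g)
  case 0
  then show ?case using assms(2) continuous_on_compose2[of T g S f] by simp
next
  case (Suc n)
  note f = higher_differentiable_on_SucD[OF Suc.prems(1)]
  note g = higher_differentiable_on_SucD[OF Suc.prems(2)]
  \<comment> \<open>The induction hypothesis covers the derivative of \<open>g\<close> in a fixed
    direction, composed with \<open>f\<close>. Expanding the moving direction \<open>Df v\<close> in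
    the basis leaves exactly such terms.\<close>
  define D where "D x v = (\<Sum>b\<in>Basis. (frechet_derivative f (at x) v \<bullet> b) *\<^sub>R
    frechet_derivative g (at (f x)) b)" for x v
  have "((\<lambda>x. g (f x)) has_derivative D x) (at x)" if x: "x \<in> S" for x
  proof -
    have gx: "(g has_derivative frechet_derivative g (at (f x))) (at (f x))"
      using g(1) assms(2) x by blast
    have lin: "linear (frechet_derivative g (at (f x)))" using gx has_derivative_linear by blast
    have "D x v = frechet_derivative g (at (f x)) (frechet_derivative f (at x) v)" for v
      unfolding D_def by (rule linear_euclidean_sum[OF lin])
    then show ?thesis using has_derivative_compose[OF f(1)[OF x] gx] by presburger
  qed
  moreover have "higher_differentiable_on S (\<lambda>x. D x v) n" for v
    unfolding D_def
    by (intro higher_differentiable_on_sum[OF assms(1)] higher_differentiable_on_scaleR[OF assms(1)]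
      higher_differentiable_on_bounded_linear[OF assms(1) bounded_linear_inner_left] f(2) Suc.IH g(2)
      higher_differentiable_on_Suc_imp[OF Suc.prems(1)])
  ultimately show ?case using higher_differentiable_on_SucI[OF assms(1)] by blast
qed

lemma higher_differentiable_on_inverse:
  "open S \<Longrightarrow> (0::real) \<notin> S \<Longrightarrow> higher_differentiable_on S inverse n"
proof (induction n)
  case 0
  then show ?case by (auto intro!: continuous_on_inverse continuous_on_id)
next
  case (Suc n)
  show ?case
  proof (rule higher_differentiable_on_SucI[OF Suc.prems(1)])
    \<comment> \<open>The derivative is written through constants and \<open>inverse\<close> itself,
      so the induction hypothesis covers it.\<close>
    show "(inverse has_derivative (\<lambda>h. (- h) *\<^sub>R (inverse x *\<^sub>R inverse x))) (at x)" if "x \<in> S" for x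
    proof -
      have "x \<noteq> 0" using that Suc.prems(2) by blast
      moreover have "(\<lambda>h. - (inverse x * h * inverse x)) = (\<lambda>h. (- h) *\<^sub>R (inverse x *\<^sub>R inverse x))"
        by (simp add: fun_eq_iff)
      ultimately show ?thesis using has_derivative_inverse'[of x UNIV] by metis
    qed
    show "higher_differentiable_on S (\<lambda>x. (- v) *\<^sub>R (inverse x *\<^sub>R inverse x)) n" for v
      using Suc by (intro higher_differentiable_on_scaleR higher_differentiable_on_const) auto
  qed
qed

section \<open>Closure properties of smooth maps, and the exponential and logarithm\<close>

lemma smooth_on_const: "smooth_on S (\<lambda>x. c)"
  and smooth_on_id: "open S \<Longrightarrow> smooth_on S (\<lambda>x. x)"
  and smooth_on_bounded_linear: "open S \<Longrightarrow> bounded_linear L \<Longrightarrow> smooth_on S f \<Longrightarrow> smooth_on S (\<lambda>x. L (f x))"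
  and smooth_on_add: "open S \<Longrightarrow> smooth_on S f \<Longrightarrow> smooth_on S g \<Longrightarrow> smooth_on S (\<lambda>x. f x + g x)"
  and smooth_on_sum: "open S \<Longrightarrow> (\<And>i. i \<in> I \<Longrightarrow> smooth_on S (F i)) \<Longrightarrow> smooth_on S (\<lambda>x. \<Sum>i\<in>I. F i x)"
  and smooth_on_scaleR: "open S \<Longrightarrow> smooth_on S r \<Longrightarrow> smooth_on S g \<Longrightarrow> smooth_on S (\<lambda>x. r x *\<^sub>R g x)"
  unfolding smooth_on_def
  by (auto intro: higher_differentiable_on_const higher_differentiable_on_id
      higher_differentiable_on_bounded_linear higher_differentiable_on_add
      higher_differentiable_on_sum higher_differentiable_on_scaleR)

lemma smooth_on_mult:
  fixes f g :: "'e::real_normed_vector \<Rightarrow> real"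
  shows "open S \<Longrightarrow> smooth_on S f \<Longrightarrow> smooth_on S g \<Longrightarrow> smooth_on S (\<lambda>x. f x * g x)"
  using smooth_on_scaleR[of S f g] by simp

lemma smooth_on_minus: "open S \<Longrightarrow> smooth_on S f \<Longrightarrow> smooth_on S (\<lambda>x. - f x)"
  by (rule smooth_on_bounded_linear) (auto intro: bounded_linear_minus bounded_linear_ident)

lemma smooth_on_diff:
  "open S \<Longrightarrow> smooth_on S f \<Longrightarrow> smooth_on S g \<Longrightarrow> smooth_on S (\<lambda>x. f x - g x)"
  using smooth_on_add[of S f "\<lambda>x. - g x"] smooth_on_minus[of S g] by simp

lemma smooth_on_compose:
  fixes f :: "'e::real_normed_vector \<Rightarrow> 'f::euclidean_space"
  shows "open S \<Longrightarrow> f ` S \<subseteq> T \<Longrightarrow> smooth_on S f \<Longrightarrow> smooth_on T g \<Longrightarrow> smooth_on S (\<lambda>x. g (f x))"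
  unfolding smooth_on_def using higher_differentiable_on_compose by blast

lemma smooth_on_inverse:
  fixes f :: "'e::real_normed_vector \<Rightarrow> real"
  assumes "open S" "smooth_on S f" "\<And>x. x \<in> S \<Longrightarrow> f x \<noteq> 0"
  shows "smooth_on S (\<lambda>x. inverse (f x))"
  by (rule smooth_on_compose[of _ f "- {0}" inverse])
    (use assms in \<open>auto simp: smooth_on_def intro: higher_differentiable_on_inverse\<close>)

lemma smooth_on_divide:
  fixes f g :: "'e::real_normed_vector \<Rightarrow> real"
  assumes "open S" "smooth_on S f" "smooth_on S g" "\<And>x. x \<in> S \<Longrightarrow> g x \<noteq> 0"
  shows "smooth_on S (\<lambda>x. f x / g x)"
  unfolding divide_inverse using assms by (intro smooth_on_mult smooth_on_inverse)

lemma smooth_on_exp: "smooth_on UNIV (exp :: real \<Rightarrow> real)"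
  unfolding smooth_on_def
proof
  fix n show "higher_differentiable_on UNIV (exp :: real \<Rightarrow> real) n"
  proof (induction n)
    case 0 then show ?case by (simp add: continuous_on_exp)
  next
    case (Suc n)
    have "((exp :: real \<Rightarrow> real) has_derivative (\<lambda>v. v *\<^sub>R exp x)) (at x)" for x
      using DERIV_exp[of x] by (simp add: has_field_derivative_def mult_commute_abs)
    then show ?case
      using Suc by (intro higher_differentiable_on_SucI[of _ _ "\<lambda>x v. v *\<^sub>R exp x"]
          higher_differentiable_on_scaleR higher_differentiable_on_const) auto
  qed
qed

lemma smooth_on_ln: "smooth_on {0<..} (ln :: real \<Rightarrow> real)"
  unfolding smooth_on_def
proof
  fix n show "higher_differentiable_on {0<..} (ln :: real \<Rightarrow> real) n"
  proof (cases n)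
    case 0 then show ?thesis by (auto intro!: continuous_on_ln)
  next
    case (Suc m)
    have "((ln :: real \<Rightarrow> real) has_derivative (\<lambda>v. v *\<^sub>R inverse x)) (at x)" if "x > 0" for x
      using DERIV_ln[OF that] by (simp add: has_field_derivative_def mult_commute_abs)
    then show ?thesis unfolding Suc
      by (intro higher_differentiable_on_SucI[of _ _ "\<lambda>x v. v *\<^sub>R inverse x"]
          higher_differentiable_on_scaleR higher_differentiable_on_const
          higher_differentiable_on_inverse) auto
  qed
qed

lemma smooth_on_Pair:
  fixes f :: "'e::real_normed_vector \<Rightarrow> 'f::euclidean_space" and g :: "'e \<Rightarrow> 'g::euclidean_space"
  assumes "open S" "smooth_on S f" "smooth_on S g"
  shows "smooth_on S (\<lambda>x. (f x, g x))"
proof -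
  have "smooth_on S (\<lambda>x. (f x, 0 :: 'g))"
    by (rule smooth_on_bounded_linear[OF assms(1) _ assms(2), where L = "\<lambda>y. (y, 0)"])
      (intro bounded_linear_Pair bounded_linear_ident bounded_linear_zero)
  moreover have "smooth_on S (\<lambda>x. (0 :: 'f, g x))"
    by (rule smooth_on_bounded_linear[OF assms(1) _ assms(3), where L = "\<lambda>y. (0, y)"])
      (intro bounded_linear_Pair bounded_linear_ident bounded_linear_zero)
  ultimately show ?thesis using smooth_on_add[OF assms(1)] by fastforce
qed

lemma smooth_on_has_derivative:
  "smooth_on S f \<Longrightarrow> x \<in> S \<Longrightarrow> (f has_derivative frechet_derivative f (at x)) (at x)"
  unfolding smooth_on_def using higher_differentiable_on_SucD(1) by blast

lemma smooth_on_differentiable: "smooth_on S f \<Longrightarrow> x \<in> S \<Longrightarrow> f differentiable (at x)"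
  using smooth_on_has_derivative differentiable_def by blast

lemma smooth_on_frechet_derivative:
  "smooth_on S f \<Longrightarrow> smooth_on S (\<lambda>x. frechet_derivative f (at x) v)"
  unfolding smooth_on_def using higher_differentiable_on_SucD(2) by blast

lemma smooth_on_continuous_on: "smooth_on S f \<Longrightarrow> continuous_on S f"
  unfolding smooth_on_def using higher_differentiable_on_imp_continuous_on by blast

lemma smooth_on_subset:
  assumes "T \<subseteq> S" "smooth_on S f" shows "smooth_on T f"
proof -
  have "higher_differentiable_on S f n \<Longrightarrow> higher_differentiable_on T f n" for n
    using assms(1) by (induction n arbitrary: f) (auto intro: continuous_on_subset)
  then show ?thesis using assms(2) by (simp add: smooth_on_def)
qed

text \<open>A field of linear maps is only known to be smooth on constant vectors; expanding
  \<open>f x\<close> in the basis extends this to a varying argument.\<close>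

lemma smooth_on_linear_family:
  fixes A :: "'e::real_normed_vector \<Rightarrow> 'f::euclidean_space \<Rightarrow> 'g::real_normed_vector"
  assumes "open S" "\<And>x. x \<in> S \<Longrightarrow> linear (A x)" "\<And>v. smooth_on S (\<lambda>x. A x v)" "smooth_on S f"
  shows "smooth_on S (\<lambda>x. A x (f x))"
proof -
  have "smooth_on S (\<lambda>x. \<Sum>b\<in>Basis. (f x \<bullet> b) *\<^sub>R A x b)"
    using smooth_on_bounded_linear[OF assms(1) bounded_linear_inner_left assms(4)]
    by (intro smooth_on_sum smooth_on_scaleR assms(1,3))
  moreover have "(\<Sum>b\<in>Basis. (f x \<bullet> b) *\<^sub>R A x b) = A x (f x)" if "x \<in> S" for x
    using linear_euclidean_sum[OF assms(2)[OF that], of "f x"] .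
  ultimately show ?thesis by (rule smooth_on_cong[OF assms(1), rotated])
qed

lemma has_derivative_linear_family:
  fixes A :: "'e::real_normed_vector \<Rightarrow> 'f::euclidean_space \<Rightarrow> 'g::real_normed_vector"
  assumes "open S" "x \<in> S" "\<And>y. y \<in> S \<Longrightarrow> linear (A y)"
    and A: "\<And>v. ((\<lambda>y. A y v) has_derivative D v) (at x)"
    and f: "(f has_derivative f') (at x)"
  shows "((\<lambda>y. A y (f y)) has_derivative (\<lambda>u. D (f x) u + A x (f' u))) (at x)"
    and "linear (\<lambda>v. D v u)"
proof -
  have rep: "(\<Sum>b\<in>Basis. (v \<bullet> b) *\<^sub>R A y b) = A y v" if "y \<in> S" for y v
    by (rule linear_euclidean_sum[OF assms(3)[OF that]])
  have D: "D v u = (\<Sum>b\<in>Basis. (v \<bullet> b) *\<^sub>R D b u)" for u v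
  proof -
    have "((\<lambda>y. \<Sum>b\<in>Basis. (v \<bullet> b) *\<^sub>R A y b) has_derivative (\<lambda>u. \<Sum>b\<in>Basis. (v \<bullet> b) *\<^sub>R D b u)) (at x)"
      by (intro has_derivative_sum has_derivative_scaleR_right A)
    then have "((\<lambda>y. A y v) has_derivative (\<lambda>u. \<Sum>b\<in>Basis. (v \<bullet> b) *\<^sub>R D b u)) (at x)"
      by (rule has_derivative_transform_within_open[OF _ assms(1,2)]) (simp add: rep)
    then show ?thesis using A[of v] has_derivative_unique by metis
  qed
  have "(\<lambda>v. D v u) = (\<lambda>v. \<Sum>b\<in>Basis. (v \<bullet> b) *\<^sub>R D b u)" using D by blast
  then show "linear (\<lambda>v. D v u)"
    by (simp only:, intro linearI)
      (simp_all add: inner_add_left scaleR_add_left sum.distrib scaleR_sum_right)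
  have "((\<lambda>y. \<Sum>b\<in>Basis. (f y \<bullet> b) *\<^sub>R A y b) has_derivative
      (\<lambda>u. \<Sum>b\<in>Basis. (f x \<bullet> b) *\<^sub>R D b u + (f' u \<bullet> b) *\<^sub>R A x b)) (at x)"
    by (intro has_derivative_sum has_derivative_scaleR A has_derivative_inner_left f)
  then show "((\<lambda>y. A y (f y)) has_derivative (\<lambda>u. D (f x) u + A x (f' u))) (at x)"
    by (rule has_derivative_transform_within_open[OF has_derivative_eq_rhs _ _ , OF _ _ assms(1,2)])
      (simp_all add: rep sum.distrib D[symmetric] assms(2))
qed

text \<open>Both mixed derivatives are limits of the second difference quotient
  \<open>(f(x + su + sv) - f(x + su) - f(x + sv) + f x) / s\<^sup>2\<close>.\<close>

lemma has_derivative_along_line: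
  fixes f :: "'e::real_normed_vector \<Rightarrow> real"
  assumes "(f has_derivative D) (at (p a))" "(p has_derivative (\<lambda>r. r *\<^sub>R u)) (at a)"
  shows "((\<lambda>a. f (p a)) has_derivative (\<lambda>r. r * D u)) (at a)"
  using has_derivative_compose[OF assms(2,1)]
  by (simp add: linear_scale[OF has_derivative_linear[OF assms(1)]])

lemma second_difference_mean_value:
  fixes f :: "'e::real_normed_vector \<Rightarrow> real"
  assumes "0 < s" "\<And>a b. 0 \<le> a \<Longrightarrow> a \<le> s \<Longrightarrow> 0 \<le> b \<Longrightarrow> b \<le> s \<Longrightarrow> x + a *\<^sub>R u + b *\<^sub>R v \<in> S"
    and f: "higher_differentiable_on S f 2"
  obtains a b where "0 \<le> a" "a \<le> s" "0 \<le> b" "b \<le> s"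
    "f (x + s *\<^sub>R u + s *\<^sub>R v) - f (x + s *\<^sub>R u) - f (x + s *\<^sub>R v) + f x
      = s\<^sup>2 * frechet_derivative (\<lambda>y. frechet_derivative f (at y) u) (at (x + a *\<^sub>R u + b *\<^sub>R v)) v"
proof -
  let ?D = "\<lambda>y. frechet_derivative f (at y)"
  have f2: "higher_differentiable_on S f (Suc (Suc 0))" using f by (simp add: numeral_2_eq_2)
  note f1 = higher_differentiable_on_SucD(1)[OF f2]
  note f2 = higher_differentiable_on_SucD(1)[OF higher_differentiable_on_SucD(2)[OF f2]]
  \<comment> \<open>\<open>k\<close> is the increment of \<open>f\<close> along \<open>s v\<close>,
    and the second difference is \<open>k s - k 0\<close>. The mean value theorem in
    \<open>a\<close>, followed by the one in \<open>b\<close> for the resulting derivative, turns it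
    into a mixed derivative at an intermediate point.\<close>
  define k where "k a = f (x + a *\<^sub>R u + s *\<^sub>R v) - f (x + a *\<^sub>R u)" for a
  have k: "(k has_derivative (\<lambda>r. r * (?D (x + a *\<^sub>R u + s *\<^sub>R v) u - ?D (x + a *\<^sub>R u) u))) (at a)"
    if "0 \<le> a" "a \<le> s" for a
  proof -
    have *: "x + a *\<^sub>R u + s *\<^sub>R v \<in> S" "x + a *\<^sub>R u \<in> S"
      using assms(1) assms(2)[of a s] assms(2)[of a 0] that by auto
    have "((\<lambda>a. f (x + a *\<^sub>R u + s *\<^sub>R v)) has_derivative (\<lambda>r. r * ?D (x + a *\<^sub>R u + s *\<^sub>R v) u)) (at a)"
      by (rule has_derivative_along_line[where p = "\<lambda>a. x + a *\<^sub>R u + s *\<^sub>R v", OF f1[OF *(1)]])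
        (auto intro!: derivative_eq_intros)
    moreover have "((\<lambda>a. f (x + a *\<^sub>R u)) has_derivative (\<lambda>r. r * ?D (x + a *\<^sub>R u) u)) (at a)"
      by (rule has_derivative_along_line[where p = "\<lambda>a. x + a *\<^sub>R u", OF f1[OF *(2)]])
        (auto intro!: derivative_eq_intros)
    ultimately show ?thesis unfolding k_def right_diff_distrib by (rule has_derivative_diff)
  qed
  obtain a where a: "0 < a" "a < s"
    "k s - k 0 = (s - 0) * (?D (x + a *\<^sub>R u + s *\<^sub>R v) u - ?D (x + a *\<^sub>R u) u)"
    using mvt_simple[OF \<open>0 < s\<close> has_derivative_at_withinI[OF k]] by (auto simp: algebra_simps)
  define l where "l b = ?D (x + a *\<^sub>R u + b *\<^sub>R v) u" for b
  have l: "(l has_derivative (\<lambda>r. r * frechet_derivative (\<lambda>y. ?D y u) (at (x + a *\<^sub>R u + b *\<^sub>R v)) v)) (at b)"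
    if "0 \<le> b" "b \<le> s" for b
  proof -
    have *: "x + a *\<^sub>R u + b *\<^sub>R v \<in> S"
      using assms(2)[of a b] a that by auto
    show ?thesis unfolding l_def
      by (rule has_derivative_along_line[where p = "\<lambda>b. x + a *\<^sub>R u + b *\<^sub>R v", OF f2[OF *]])
        (auto intro!: derivative_eq_intros)
  qed
  obtain b where b: "0 < b" "b < s"
    "l s - l 0 = (s - 0) * frechet_derivative (\<lambda>y. ?D y u) (at (x + a *\<^sub>R u + b *\<^sub>R v)) v"
    using mvt_simple[OF \<open>0 < s\<close> has_derivative_at_withinI[OF l]] by (auto simp: algebra_simps)
  show ?thesis
    by (rule that[of a b]) (use a b in \<open>auto simp: k_def l_def power2_eq_square algebra_simps\<close>)
qed

lemma frechet_derivative_commute_real: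
  fixes f :: "'e::real_normed_vector \<Rightarrow> real"
  assumes "open S" "x \<in> S" and f: "higher_differentiable_on S f 2"
  shows "frechet_derivative (\<lambda>y. frechet_derivative f (at y) v) (at x) u
       = frechet_derivative (\<lambda>y. frechet_derivative f (at y) u) (at x) v"
proof (rule ccontr)
  define P where "P = (\<lambda>u v y. frechet_derivative (\<lambda>y. frechet_derivative f (at y) u) (at y) v)"
  assume "\<not> ?thesis"
  then have ne: "P v u x \<noteq> P u v x" by (simp add: P_def)
  have cont: "continuous_on S (P u v)" for u v
    using f by (simp add: numeral_2_eq_2 P_def)
  \<comment> \<open>Values of the two mixed derivatives at nearby, in general different, points will
    coincide. With \<open>e\<close> half the gap at \<open>x\<close>, this contradicts the triangle
    inequality.\<close>
  define e where "e = dist (P v u x) (P u v x) / 2"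
  have "e > 0" using ne by (simp add: e_def)
  have "\<exists>d>0. \<forall>y. dist y x < d \<longrightarrow> dist (P u v y) (P u v x) < e" for u v
    using cont[of u v] assms(1,2) \<open>e > 0\<close> continuous_on_eq_continuous_at[OF assms(1)]
      continuous_at[of x] unfolding continuous_at_eps_delta by (metis dist_real_def dist_norm continuous_at_eps_delta)
  then obtain d1 d2 where d: "d1 > 0" "d2 > 0"
    "\<And>y. dist y x < d1 \<Longrightarrow> dist (P u v y) (P u v x) < e"
    "\<And>y. dist y x < d2 \<Longrightarrow> dist (P v u y) (P v u x) < e" by meson
  obtain d3 where d3: "d3 > 0" "ball x d3 \<subseteq> S" using assms openE by blast
  define d where "d = Min {d1, d2, d3}"
  have dd: "d > 0" "d \<le> d1" "d \<le> d2" "d \<le> d3" using d d3 by (auto simp: d_def)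
  \<comment> \<open>This size keeps the parallelogram spanned by \<open>s u\<close> and
    \<open>s v\<close> within distance \<open>d\<close> of \<open>x\<close>; the summand 1 covers
    \<open>u = v = 0\<close>.\<close>
  define s where "s = d / (norm u + norm v + 1)"
  have "s > 0" using dd(1) by (simp add: s_def add_nonneg_pos)
  have near: "dist (x + a *\<^sub>R u + b *\<^sub>R v) x < d" if "0 \<le> a" "a \<le> s" "0 \<le> b" "b \<le> s" for a b
  proof -
    have "dist (x + a *\<^sub>R u + b *\<^sub>R v) x \<le> a * norm u + b * norm v"
      using that norm_triangle_ineq[of "a *\<^sub>R u" "b *\<^sub>R v"] by (simp add: dist_norm add.assoc)
    also have "\<dots> \<le> s * norm u + s * norm v" using that by (intro add_mono mult_right_mono) auto
    also have "\<dots> < s * (norm u + norm v + 1)" using \<open>s > 0\<close> by (simp add: algebra_simps)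
    also have "\<dots> = d" unfolding s_def
      using add_nonneg_pos[of "norm u + norm v" 1] by (simp add: field_simps)
    finally show ?thesis .
  qed
  have in_S: "x + a *\<^sub>R u + b *\<^sub>R v \<in> S" if "0 \<le> a" "a \<le> s" "0 \<le> b" "b \<le> s" for a b
    using near[OF that] d3 dd by (auto simp: dist_commute)
  have in_S': "x + a *\<^sub>R v + b *\<^sub>R u \<in> S" if "0 \<le> a" "a \<le> s" "0 \<le> b" "b \<le> s" for a b
    using in_S[of b a] that by (simp add: algebra_simps)
  obtain a b where ab: "0 \<le> a" "a \<le> s" "0 \<le> b" "b \<le> s"
    "f (x + s *\<^sub>R u + s *\<^sub>R v) - f (x + s *\<^sub>R u) - f (x + s *\<^sub>R v) + f x = s\<^sup>2 * P u v (x + a *\<^sub>R u + b *\<^sub>R v)"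
    unfolding P_def using second_difference_mean_value[OF \<open>s > 0\<close> in_S f] by blast
  obtain a' b' where ab': "0 \<le> a'" "a' \<le> s" "0 \<le> b'" "b' \<le> s"
    "f (x + s *\<^sub>R v + s *\<^sub>R u) - f (x + s *\<^sub>R v) - f (x + s *\<^sub>R u) + f x = s\<^sup>2 * P v u (x + a' *\<^sub>R v + b' *\<^sub>R u)"
    unfolding P_def using second_difference_mean_value[OF \<open>s > 0\<close> in_S' f] by blast
  have "P u v (x + a *\<^sub>R u + b *\<^sub>R v) = P v u (x + b' *\<^sub>R u + a' *\<^sub>R v)"
    using ab(5) ab'(5) \<open>s > 0\<close> by (simp add: algebra_simps)
  moreover have "dist (P u v (x + a *\<^sub>R u + b *\<^sub>R v)) (P u v x) < e"
    using d(3) near[OF ab(1-4)] dd by force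
  moreover have "dist (P v u (x + b' *\<^sub>R u + a' *\<^sub>R v)) (P v u x) < e"
    using d(4) near[OF ab'(3,4,1,2)] dd by force
  ultimately show False
    using dist_triangle3[of "P v u x" "P u v x" "P u v (x + a *\<^sub>R u + b *\<^sub>R v)"] unfolding e_def by simp
qed

lemma frechet_derivative_commute:
  fixes f :: "'e::real_normed_vector \<Rightarrow> 'f::euclidean_space"
  assumes "open S" "x \<in> S" "smooth_on S f"
  shows "frechet_derivative (\<lambda>y. frechet_derivative f (at y) v) (at x) u
       = frechet_derivative (\<lambda>y. frechet_derivative f (at y) u) (at x) v"
proof (rule euclidean_eqI)
  fix b :: 'f assume "b \<in> Basis"
  have 1: "frechet_derivative (\<lambda>y. g y \<bullet> b) (at y) w = frechet_derivative g (at y) w \<bullet> b"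
    if "smooth_on S g" "y \<in> S" for g :: "'e \<Rightarrow> 'f" and y w
    using has_derivative_inner_left[OF smooth_on_has_derivative[OF that], of b]
      frechet_derivative_at by metis
  have 2: "frechet_derivative (\<lambda>y. frechet_derivative f (at y) v) (at x) u \<bullet> b
     = frechet_derivative (\<lambda>y. frechet_derivative (\<lambda>y. f y \<bullet> b) (at y) v) (at x) u" for u v
  proof -
    note s = smooth_on_frechet_derivative[OF assms(3), of v]
    have "((\<lambda>y. frechet_derivative f (at y) v \<bullet> b) has_derivative
        (\<lambda>u. frechet_derivative (\<lambda>y. frechet_derivative f (at y) v) (at x) u \<bullet> b)) (at x)"
      by (rule has_derivative_inner_left[OF smooth_on_has_derivative[OF s assms(2)]])
    then have "((\<lambda>y. frechet_derivative (\<lambda>y. f y \<bullet> b) (at y) v) has_derivative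
        (\<lambda>u. frechet_derivative (\<lambda>y. frechet_derivative f (at y) v) (at x) u \<bullet> b)) (at x)"
      by (rule has_derivative_transform_within_open[OF _ assms(1,2)]) (simp add: 1[OF assms(3)])
    then show ?thesis using frechet_derivative_at by metis
  qed
  have "smooth_on S (\<lambda>y. f y \<bullet> b)"
    by (rule smooth_on_bounded_linear[OF assms(1) bounded_linear_inner_left assms(3)])
  then show "frechet_derivative (\<lambda>y. frechet_derivative f (at y) v) (at x) u \<bullet> b
      = frechet_derivative (\<lambda>y. frechet_derivative f (at y) u) (at x) v \<bullet> b"
    unfolding 2 smooth_on_def using frechet_derivative_commute_real[OF assms(1,2)] by blast
qed

section \<open>Inner products in dimension four\<close>

definition inner_form :: "('e::real_vector \<Rightarrow> 'e \<Rightarrow> real) \<Rightarrow> bool" where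
  "inner_form h \<longleftrightarrow> bilinear h \<and> (\<forall>u v. h u v = h v u) \<and> (\<forall>v. v \<noteq> 0 \<longrightarrow> 0 < h v v)"

definition orthonormal_frame :: "('e \<Rightarrow> 'e \<Rightarrow> real) \<Rightarrow> ('n \<Rightarrow> 'e) \<Rightarrow> bool" where
  "orthonormal_frame h e \<longleftrightarrow> (\<forall>a b. h (e a) (e b) = (if a = b then 1 else 0))"

lemmas bilinear_simps = bilinear_ladd bilinear_radd bilinear_lsub bilinear_rsub
  bilinear_lneg bilinear_rneg bilinear_lmul bilinear_rmul bilinear_lzero bilinear_rzero

lemma inner_formD:
  assumes "inner_form h"
  shows "bilinear h" "h u v = h v u" "v \<noteq> 0 \<Longrightarrow> 0 < h v v"
  using assms unfolding inner_form_def by blast+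

lemma inner_form_eqI:
  assumes "inner_form h" "\<And>u. h u x = h u y" shows "x = y"
proof -
  have "h (x - y) (x - y) = 0"
    using assms(2) by (simp add: bilinear_rsub[OF inner_formD(1)[OF assms(1)]])
  then show ?thesis using inner_formD(3)[OF assms(1), of "x - y"] by auto
qed

lemma inner_form_inner: "inner_form (inner :: 'e::real_inner \<Rightarrow> 'e \<Rightarrow> real)"
  unfolding inner_form_def bilinear_def
  by (auto simp: inner_commute linear_iff inner_add_left inner_add_right)

lemma inner_form_subspace: "inner_form h \<Longrightarrow> subspace {x. h w x = 0}"
  by (rule subspaceI) (simp_all add: bilinear_simps[OF inner_formD(1)])

text \<open>Gram-Schmidt, by induction on the set of indices already filled: while fewer than
  \<open>DIM('e)\<close> vectors are used there is a vector outside their span, and its residual is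
  normalised.\<close>

lemma ex_orthonormal_frame:
  fixes h :: "'e::euclidean_space \<Rightarrow> 'e \<Rightarrow> real"
  assumes h: "inner_form h" and card: "CARD('n::finite) \<le> DIM('e)"
  shows "\<exists>e::'n \<Rightarrow> 'e. orthonormal_frame h e"
proof -
  note bl = bilinear_simps[OF inner_formD(1)[OF h]]
  have "\<exists>e::'n \<Rightarrow> 'e. \<forall>a\<in>A. \<forall>b\<in>A. h (e a) (e b) = (if a = b then 1 else 0)" for A
    using finite[of A]
  proof (induction A rule: finite_induct)
    case empty
    show ?case by simp
  next
    case (insert c A)
    then obtain e :: "'n \<Rightarrow> 'e"
      where e: "\<And>a b. a \<in> A \<Longrightarrow> b \<in> A \<Longrightarrow> h (e a) (e b) = (if a = b then 1 else 0)" by blast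
    have "A \<subset> UNIV" using insert.hyps(2) by blast
    then have "card A < CARD('n)" by (rule psubset_card_mono[OF finite])
    then have "dim (e ` A) < DIM('e)"
      using card dim_le_card'[of "e ` A"] card_image_le[OF insert.hyps(1), of e] insert.hyps(1) by simp
    then have "span (e ` A) \<noteq> UNIV" by (metis dim_UNIV dim_span less_irrefl)
    then obtain v where v: "v \<notin> span (e ` A)" by blast
    define r where "r = v - (\<Sum>a\<in>A. h v (e a) *\<^sub>R e a)"
    have "(\<Sum>a\<in>A. h v (e a) *\<^sub>R e a) \<in> span (e ` A)"
      by (intro span_sum span_scale span_base) blast
    then have "r \<noteq> 0" using v by (auto simp: r_def)
    then have pos: "0 < h r r" by (rule inner_formD(3)[OF h])
    have "h (\<Sum>a\<in>B. k a *\<^sub>R e a) w = (\<Sum>a\<in>B. k a * h (e a) w)" for B k w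
      by (induction B rule: infinite_finite_induct) (simp_all add: bl)
    then have 1: "h r (e b) = 0" if "b \<in> A" for b
      using that insert.hyps(1) by (simp add: r_def bl e sum.delta if_distrib cong: if_cong)
    then have 2: "h (e b) r = 0" if "b \<in> A" for b using that inner_formD(2)[OF h] by metis
    define s where "s = 1 / sqrt (h r r)"
    have s: "s * (s * h r r) = 1"
      using pos by (simp add: s_def field_simps)
    have "h ((e(c := s *\<^sub>R r)) a) ((e(c := s *\<^sub>R r)) b) = (if a = b then 1 else 0)"
      if "a \<in> insert c A" "b \<in> insert c A" for a b
      using that insert.hyps(2) 1 2 s e by (cases "a = c"; cases "b = c") (auto simp: bl)
    then show ?case by blast
  qed
  from this[of UNIV] show ?thesis by (simp add: orthonormal_frame_def)
qed

text \<open>Orthonormal vectors are independent, so by counting they span. The residual of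
  \<open>v\<close> is orthogonal to the frame, hence to itself.\<close>

lemma orthonormal_frame_expand:
  fixes h :: "'e::euclidean_space \<Rightarrow> 'e \<Rightarrow> real" and e :: "'n::finite \<Rightarrow> 'e"
  assumes h: "inner_form h" and e: "orthonormal_frame h e" and card: "CARD('n) = DIM('e)"
  shows "(\<Sum>a\<in>UNIV. h v (e a) *\<^sub>R e a) = v"
proof -
  note bl = bilinear_simps[OF inner_formD(1)[OF h]]
  have inj: "inj e"
    by (rule injI) (metis e orthonormal_frame_def zero_neq_one)
  have "independent (range e)"
  proof (rule ccontr)
    assume "\<not> independent (range e)"
    then obtain a where "e a \<in> span (range e - {e a})" unfolding dependent_def by blast
    moreover have "range e - {e a} \<subseteq> {x. h (e a) x = 0}"
      using e by (auto simp: orthonormal_frame_def)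
    ultimately have "h (e a) (e a) = 0"
      using span_minimal[OF _ inner_form_subspace[OF h]] by blast
    then show False using e by (simp add: orthonormal_frame_def)
  qed
  then have span: "span (range e) = UNIV"
    using card_ge_dim_independent[of "range e" UNIV] card card_image[OF inj] by auto
  let ?r = "v - (\<Sum>a\<in>UNIV. h v (e a) *\<^sub>R e a)"
  have "h (\<Sum>a\<in>B. k a *\<^sub>R e a) w = (\<Sum>a\<in>B. k a * h (e a) w)" for B k w
    by (induction B rule: infinite_finite_induct) (simp_all add: bl)
  moreover have ee: "h (e a) (e b) = (if a = b then 1 else 0)" for a b
    using e by (simp add: orthonormal_frame_def)
  ultimately have "range e \<subseteq> {x. h ?r x = 0}"
    by (auto simp: bl ee if_distrib cong: if_cong)
  then have "span (range e) \<subseteq> {x. h ?r x = 0}"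
    using inner_form_subspace[OF h] by (rule span_minimal)
  then have "h ?r ?r = 0" using span by blast
  then show ?thesis using inner_formD(3)[OF h, of ?r] by force
qed

lemma inner_form_coordinates:
  fixes h :: "'e::euclidean_space \<Rightarrow> 'e \<Rightarrow> real" and e :: "4 \<Rightarrow> 'e"
  assumes h: "inner_form h" and e: "orthonormal_frame h e" and dim: "DIM('e) = 4"
  shows "h u v = h u (e 1) * h v (e 1) + h u (e 2) * h v (e 2) + h u (e 3) * h v (e 3) + h u (e 4) * h v (e 4)"
proof -
  have "CARD(4) = DIM('e)" using dim by simp
  note ex = orthonormal_frame_expand[OF h e this]
  have "h u (h v (e 1) *\<^sub>R e 1 + h v (e 2) *\<^sub>R e 2 + h v (e 3) *\<^sub>R e 3 + h v (e 4) *\<^sub>R e 4) = h u v"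
    using ex[of v] by (simp add: sum_4)
  then show ?thesis by (simp add: bilinear_simps[OF inner_formD(1)[OF h]] algebra_simps)
qed

lemma inner_form_Riesz:
  fixes h :: "'e::euclidean_space \<Rightarrow> 'e \<Rightarrow> real"
  assumes h: "inner_form h" and dim: "DIM('e) = 4" and "linear \<rho>"
  shows "\<exists>!z. \<forall>w. h z w = \<rho> w"
proof -
  obtain e :: "4 \<Rightarrow> 'e" where e: "orthonormal_frame h e"
    using ex_orthonormal_frame[OF h, where 'n = 4] dim by auto
  have c: "CARD(4) = DIM('e)" using dim by simp
  note ex = orthonormal_frame_expand[OF h e c]
  have "h (\<Sum>a\<in>UNIV. \<rho> (e a) *\<^sub>R e a) w = \<rho> w" for w
    using arg_cong[OF ex[of w], of \<rho>]
    by (simp add: sum_4 bilinear_simps[OF inner_formD(1)[OF h]] linear_add[OF assms(3)]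
      linear_scale[OF assms(3)] inner_formD(2)[OF h, of w] algebra_simps)
  moreover have "z = z'" if "\<forall>w. h z w = \<rho> w" "\<forall>w. h z' w = \<rho> w" for z z'
    by (rule inner_form_eqI[OF h]) (metis that inner_formD(2)[OF h])
  ultimately show ?thesis by blast
qed

text \<open>The Euclidean inner product is transported along the isomorphism \<open>T\<close> that
  takes an orthonormal frame to \<open>f\<close>; independence of \<open>f\<close> makes
  \<open>T\<close> injective.\<close>

lemma ex_inner_form_orthonormal_frame:
  fixes f :: "4 \<Rightarrow> 'e::euclidean_space"
  assumes dim: "DIM('e) = 4" and indep: "\<And>c. (\<Sum>a\<in>UNIV. c a *\<^sub>R f a) = 0 \<Longrightarrow> c = (\<lambda>_. 0)"
  shows "\<exists>h. inner_form h \<and> orthonormal_frame h f"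
proof -
  note inn = inner_form_inner[where 'e = 'e]
  obtain b :: "4 \<Rightarrow> 'e" where b: "orthonormal_frame inner b"
    using ex_orthonormal_frame[OF inn, where 'n = 4] dim by auto
  have c: "CARD(4) = DIM('e)" using dim by simp
  note ex = orthonormal_frame_expand[OF inn b c]
  define T where "T v = (\<Sum>a\<in>UNIV. (v \<bullet> b a) *\<^sub>R f a)" for v
  have lin: "linear T"
    by (rule linearI) (simp_all add: T_def inner_add_left scaleR_add_left sum.distrib scaleR_sum_right)
  have inj: "inj T"
    unfolding linear_injective_0[OF lin]
  proof (intro allI impI)
    fix v assume "T v = 0"
    then have "(\<lambda>a. v \<bullet> b a) = (\<lambda>_. 0)" unfolding T_def by (rule indep)
    then show "v = 0" using ex[of v] by (metis (no_types, lifting) scale_zero_left sum.neutral)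
  qed
  obtain R where R: "linear R" "\<And>x. T (R x) = x" "\<And>x. R (T x) = x"
    using linear_injective_isomorphism[OF lin inj] by auto
  have "T (b a) = f a" for a
    using b by (simp add: T_def orthonormal_frame_def if_distrib[of "\<lambda>x. x *\<^sub>R _"] sum.delta cong: if_cong)
  then have Rf: "R (f a) = b a" for a by (metis R(3))
  have "R v \<noteq> 0" if "v \<noteq> 0" for v using that R(2) linear_0[OF lin] by metis
  then have "inner_form (\<lambda>u v. R u \<bullet> R v)"
    unfolding inner_form_def bilinear_def
    by (auto simp: inner_commute linear_iff inner_add_left inner_add_right
      linear_add[OF R(1)] linear_scale[OF R(1)])
  moreover have "orthonormal_frame (\<lambda>u v. R u \<bullet> R v) f"
    using b by (simp add: orthonormal_frame_def Rf)
  ultimately show ?thesis by blast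
qed

lemma alternating2D:
  assumes "alternating2 w" shows "bilinear w" "w v v = 0" "w u v = - w v u"
proof -
  show b: "bilinear w" "\<And>v. w v v = 0" using assms by (auto simp: alternating2_def)
  show "w u v = - w v u"
    using b(2)[of "u + v"] b(2)[of u] b(2)[of v]
    unfolding bilinear_ladd[OF b(1)] bilinear_radd[OF b(1)] by linarith
qed

section \<open>Quaternionic structures on a four-dimensional Euclidean space\<close>

text \<open>Orthogonality is encoded as skew-symmetry, which is equivalent for operators of square
  -1 and says directly that \<open>- h(., I .)\<close> and its analogues are alternating.\<close>

definition quaternionic ::
  "('e::real_vector \<Rightarrow> 'e \<Rightarrow> real) \<Rightarrow> ('e \<Rightarrow> 'e) \<Rightarrow> ('e \<Rightarrow> 'e) \<Rightarrow> ('e \<Rightarrow> 'e) \<Rightarrow> bool" where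
  "quaternionic h I J K \<longleftrightarrow> inner_form h \<and> linear I \<and> linear J \<and> linear K \<and>
     (\<forall>u v. h u (I v) = - h v (I u) \<and> h u (J v) = - h v (J u) \<and> h u (K v) = - h v (K u)) \<and>
     (\<forall>u. I (I u) = - u \<and> J (J u) = - u \<and> K (K u) = - u \<and> I (J u) = K u \<and> J (I u) = - K u)"

lemma quaternionicD:
  assumes "quaternionic h I J K"
  shows "inner_form h" "linear I" "linear J" "linear K"
    "h u (I v) = - h v (I u)" "h u (J v) = - h v (J u)" "h u (K v) = - h v (K u)"
    "I (I u) = - u" "J (J u) = - u" "K (K u) = - u"
    "I (J u) = K u" "J (I u) = - K u" "J (K u) = I u" "K (J u) = - I u" "K (I u) = J u" "I (K u) = - J u"
    "h u (I u) = 0" "h u (J u) = 0" "h u (K u) = 0"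
proof -
  note q = assms[unfolded quaternionic_def]
  show lin: "inner_form h" "linear I" "linear J" "linear K" using q by blast+
  show sk: "h u (I v) = - h v (I u)" "h u (J v) = - h v (J u)" "h u (K v) = - h v (K u)" for u v
    using q by blast+
  show m: "I (I u) = - u" "J (J u) = - u" "K (K u) = - u" "I (J u) = K u" "J (I u) = - K u" for u
    using q by blast+
  show kj: "K (J u) = - I u" for u by (metis m(2,4) linear_neg[OF lin(2)])
  show "J (K u) = I u" by (metis m(4,5) kj add.inverse_inverse)
  show ik: "I (K u) = - J u" for u by (metis m(1,4))
  show "K (I u) = J u" by (metis m(4,5) ik add.inverse_inverse linear_neg[OF lin(2)])
  show "h u (I u) = 0" "h u (J u) = 0" "h u (K u) = 0" using sk[of u u] by linarith+
qed

lemma quaternionic_isometry: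
  assumes Q: "quaternionic h I J K"
  shows "h (I u) (I v) = h u v" "h (J u) (J v) = h u v" "h (K u) (K v) = h u v"
    "h (I u) (J v) = - h u (K v)" "h (I u) (K v) = h u (J v)" "h (J u) (K v) = - h u (I v)"
    "h (J u) (I v) = h u (K v)" "h (K u) (I v) = - h u (J v)" "h (K u) (J v) = h u (I v)"
    "h (I u) u = 0" "h (J u) u = 0" "h (K u) u = 0"
proof -
  note q = quaternionicD[OF Q]
  note bl = bilinear_simps[OF inner_formD(1)[OF q(1)]]
  have m: "h (I u) v = - h u (I v)" "h (J u) v = - h u (J v)" "h (K u) v = - h u (K v)" for u v
    using q(5-7)[of u v] inner_formD(2)[OF q(1), of v] by simp_all
  show "h (I u) (I v) = h u v" "h (J u) (J v) = h u v" "h (K u) (K v) = h u v"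
    "h (I u) (J v) = - h u (K v)" "h (I u) (K v) = h u (J v)" "h (J u) (K v) = - h u (I v)"
    "h (J u) (I v) = h u (K v)" "h (K u) (I v) = - h u (J v)" "h (K u) (J v) = h u (I v)"
    "h (I u) u = 0" "h (J u) u = 0" "h (K u) u = 0"
    by (simp_all add: m q(8-19) bl)
qed

text \<open>Identify \<open>e\<close> with the basis 1, i, j, k of the quaternions; the operators
  are left multiplications by i, j, k. The six equations on \<open>w\<close> state self-duality
  relative to \<open>e\<close>, and the three forms \<open>- h(., I .)\<close>,
  \<open>- h(., J .)\<close>, \<open>- h(., K .)\<close> span the self-dual forms.\<close>

lemma ex_quaternionic:
  fixes h :: "'e::euclidean_space \<Rightarrow> 'e \<Rightarrow> real" and e :: "4 \<Rightarrow> 'e"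
  assumes h: "inner_form h" and e: "orthonormal_frame h e" and dim: "DIM('e) = 4"
  shows "\<exists>I J K. quaternionic h I J K \<and>
    (\<forall>w p q r. alternating2 w \<longrightarrow> w (e 1) (e 2) = p \<longrightarrow> w (e 3) (e 4) = p \<longrightarrow>
       w (e 1) (e 3) = q \<longrightarrow> w (e 2) (e 4) = - q \<longrightarrow> w (e 1) (e 4) = r \<longrightarrow> w (e 2) (e 3) = r \<longrightarrow>
       (\<forall>u v. w u v = - h u (p *\<^sub>R I v + q *\<^sub>R J v + r *\<^sub>R K v)))"
proof -
  note bl = bilinear_simps[OF inner_formD(1)[OF h]]
  define c where "c a v = h v (e a)" for a v
  have c_lin: "c a (u + v) = c a u + c a v" "c a (s *\<^sub>R v) = s * c a v" "c a (- u) = - c a u"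
    "c a (u - v) = c a u - c a v" for a u v s
    by (simp_all add: c_def bl)
  have c_e: "c a (e b) = (if b = a then 1 else 0)" for a b
    using e by (simp add: c_def orthonormal_frame_def)
  have hc: "h u v = c 1 u * c 1 v + c 2 u * c 2 v + c 3 u * c 3 v + c 4 u * c 4 v" for u v
    unfolding c_def by (rule inner_form_coordinates[OF h e dim])
  have "CARD(4) = DIM('e)" using dim by simp
  from orthonormal_frame_expand[OF h e this]
  have ex: "v = c 1 v *\<^sub>R e 1 + c 2 v *\<^sub>R e 2 + c 3 v *\<^sub>R e 3 + c 4 v *\<^sub>R e 4" for v
    by (simp add: c_def sum_4)
  have eqI: "u = v" if "c 1 u = c 1 v" "c 2 u = c 2 v" "c 3 u = c 3 v" "c 4 u = c 4 v" for u v
    using that ex[of u] ex[of v] by simp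
  define I where "I v = c 1 v *\<^sub>R e 2 - c 2 v *\<^sub>R e 1 + c 3 v *\<^sub>R e 4 - c 4 v *\<^sub>R e 3" for v
  define J where "J v = c 1 v *\<^sub>R e 3 - c 3 v *\<^sub>R e 1 + c 4 v *\<^sub>R e 2 - c 2 v *\<^sub>R e 4" for v
  define K where "K v = c 1 v *\<^sub>R e 4 - c 4 v *\<^sub>R e 1 + c 2 v *\<^sub>R e 3 - c 3 v *\<^sub>R e 2" for v
  have cI: "c 1 (I v) = - c 2 v" "c 2 (I v) = c 1 v" "c 3 (I v) = - c 4 v" "c 4 (I v) = c 3 v"
    and cJ: "c 1 (J v) = - c 3 v" "c 2 (J v) = c 4 v" "c 3 (J v) = c 1 v" "c 4 (J v) = - c 2 v"
    and cK: "c 1 (K v) = - c 4 v" "c 2 (K v) = - c 3 v" "c 3 (K v) = c 2 v" "c 4 (K v) = c 1 v" for v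
    by (simp_all add: I_def J_def K_def c_lin c_e)
  have "quaternionic h I J K"
    unfolding quaternionic_def
  proof (intro conjI allI h)
    show "linear I" "linear J" "linear K"
      by (auto intro!: linearI simp: I_def J_def K_def c_lin algebra_simps)
    show "h u (I v) = - h v (I u)" "h u (J v) = - h v (J u)" "h u (K v) = - h v (K u)" for u v
      by (simp_all add: hc cI cJ cK algebra_simps)
    show "I (I u) = - u" "J (J u) = - u" "K (K u) = - u" "I (J u) = K u" "J (I u) = - K u" for u
      by (rule eqI; simp add: cI cJ cK c_lin)+
  qed
  moreover have "w u v = - h u (p *\<^sub>R I v + q *\<^sub>R J v + r *\<^sub>R K v)"
    if w: "alternating2 w" and v: "w (e 1) (e 2) = p" "w (e 3) (e 4) = p" "w (e 1) (e 3) = q"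
      "w (e 2) (e 4) = - q" "w (e 1) (e 4) = r" "w (e 2) (e 3) = r" for w p q r u v
  proof -
    have v': "w (e 2) (e 1) = - p" "w (e 4) (e 3) = - p" "w (e 3) (e 1) = - q"
      "w (e 4) (e 2) = q" "w (e 4) (e 1) = - r" "w (e 3) (e 2) = - r"
      using v alternating2D(3)[OF w] by (metis, metis, metis, metis add.inverse_inverse, metis, metis)
    show ?thesis
      by (subst ex[of u], subst ex[of v])
        (simp add: bilinear_simps[OF alternating2D(1)[OF w]] v v' alternating2D(2)[OF w]
          hc cI cJ cK c_lin c_e algebra_simps)
  qed
  ultimately show ?thesis by blast
qed

text \<open>Let \<open>M\<close> be the skew 4x4 matrix with upper entries \<open>A\<close> to
  \<open>F\<close> and \<open>M'\<close> its Hodge dual. Then \<open>M M'\<close> is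
  \<open>-P\<close> times the identity and \<open>M M\<close> is \<open>-c\<close> times the
  identity, so \<open>c M' = P M\<close>. Comparing lengths gives
  \<open>P\<^sup>2 = c\<^sup>2\<close>, and positivity of the Pfaffian leaves \<open>P = c\<close>,
  that is \<open>M' = M\<close>.\<close>

lemma pfaffian_identity:
  fixes A B C D E F c :: real
  assumes n: "A * A + B * B + C * C = c" "A * A + D * D + E * E = c" "B * B + D * D + F * F = c"
      "C * C + E * E + F * F = c"
    and o: "A * E + B * F = 0" "C * F - A * D = 0" "B * D + C * E = 0"
    and P: "\<And>P. P = A * F - B * E + C * D \<Longrightarrow> 0 < P"
  shows "F = A \<and> E = - B \<and> D = C"
proof -
  define P where "P = A * F - B * E + C * D"
  have "c * F - P * A = B * (A * E + B * F) + C * (C * F - A * D)"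
    unfolding P_def n(1)[symmetric] by (simp add: algebra_simps)
  then have 1: "c * F = P * A" using o by simp
  have "c * E + P * B = A * (A * E + B * F) + C * (B * D + C * E)"
    unfolding P_def n(1)[symmetric] by (simp add: algebra_simps)
  then have 2: "c * E = - (P * B)" using o by simp
  have "c * D - P * C = B * (B * D + C * E) - A * (C * F - A * D)"
    unfolding P_def n(1)[symmetric] by (simp add: algebra_simps)
  then have 3: "c * D = P * C" using o by simp
  have "P * P = (P * A) * F - (P * B) * E + (P * C) * D"
    by (simp add: P_def algebra_simps)
  also have "\<dots> = (c * F) * F + (c * E) * E + (c * D) * D" by (simp add: 1 2 3)
  also have "\<dots> = c * (D * D + E * E + F * F)" by (simp add: algebra_simps)
  also have "D * D + E * E + F * F = c" using n by linarith
  finally have "c\<^sup>2 = P\<^sup>2" by (simp add: power2_eq_square)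
  moreover have "c \<ge> 0" unfolding n(1)[symmetric] by simp
  moreover have "P > 0" by (rule P) (rule P_def)
  ultimately have "c = P" "P \<noteq> 0" using power2_eq_iff_nonneg[of c P] by auto
  then have "P * F = P * A" "P * E = P * (- B)" "P * D = P * C" using 1 2 3 by simp_all
  then show ?thesis using \<open>P \<noteq> 0\<close> unfolding mult_left_cancel[OF \<open>P \<noteq> 0\<close>] by blast
qed

text \<open>In any orthonormal frame the matrix of \<open>w\<close> has orthogonal rows of equal
  length, because \<open>p I + q J + r K\<close> is a multiple of an isometry. Such a skew matrix is
  self-dual or anti-self-dual; the sign of its Pfaffian, half of \<open>wedge22 w w e\<close>,
  decides which.\<close>

lemma quaternionic_wedge_positive_self_dual:
  fixes h :: "'e::euclidean_space \<Rightarrow> 'e \<Rightarrow> real" and e :: "4 \<Rightarrow> 'e"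
  assumes Q: "quaternionic h I J K" and e: "orthonormal_frame h e" and dim: "DIM('e) = 4"
    and w: "\<And>u v. w u v = - h u (p *\<^sub>R I v + q *\<^sub>R J v + r *\<^sub>R K v)"
    and pos: "0 < wedge22 w w e"
  shows "w (e 3) (e 4) = w (e 1) (e 2)" "w (e 2) (e 4) = - w (e 1) (e 3)" "w (e 2) (e 3) = w (e 1) (e 4)"
proof -
  note q = quaternionicD[OF Q]
  note bl = bilinear_simps[OF inner_formD(1)[OF q(1)]]
  let ?M = "\<lambda>v. p *\<^sub>R I v + q *\<^sub>R J v + r *\<^sub>R K v"
  define c where "c = p\<^sup>2 + q\<^sup>2 + r\<^sup>2"
  note iso = quaternionic_isometry[OF Q]
  have M: "h (?M u) (?M v) = c * h u v" for u v
    by (simp add: bl iso c_def power2_eq_square algebra_simps)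
  have sk: "w u v = - w v u" "w u u = 0" for u v
    unfolding w using q(5-7)[of u v] q(17-19)[of u] by (simp_all add: bl)
  have hM: "h (?M u) v = w u v" for u v
    using sk(1)[of u v] w[of v u] inner_formD(2)[OF q(1), of v] by simp
  have R: "w (e a) (e 1) * w (e b) (e 1) + w (e a) (e 2) * w (e b) (e 2)
      + w (e a) (e 3) * w (e b) (e 3) + w (e a) (e 4) * w (e b) (e 4) = (if a = b then c else 0)" for a b
    using inner_form_coordinates[OF q(1) e dim, of "?M (e a)" "?M (e b)"] e
    unfolding M unfolding hM by (auto simp: orthonormal_frame_def)
  define A where "A = w (e 1) (e 2)"
  define B where "B = w (e 1) (e 3)"
  define C where "C = w (e 1) (e 4)"
  define D where "D = w (e 2) (e 3)"
  define E where "E = w (e 2) (e 4)"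
  define F where "F = w (e 3) (e 4)"
  have s: "w (e 2) (e 1) = - A" "w (e 3) (e 1) = - B" "w (e 4) (e 1) = - C" "w (e 3) (e 2) = - D"
    "w (e 4) (e 2) = - E" "w (e 4) (e 3) = - F"
    unfolding A_def B_def C_def D_def E_def F_def by (rule sk(1))+
  note s' = s sk(2) A_def[symmetric] B_def[symmetric] C_def[symmetric] D_def[symmetric]
    E_def[symmetric] F_def[symmetric]
  have n: "A * A + B * B + C * C = c" "A * A + D * D + E * E = c" "B * B + D * D + F * F = c"
      "C * C + E * E + F * F = c"
    and o: "A * E + B * F = 0" "C * F - A * D = 0" "B * D + C * E = 0"
    using R[of 1 1] R[of 2 2] R[of 3 3] R[of 4 4] R[of 1 4] R[of 1 3] R[of 1 2]
    unfolding s' by (simp_all add: algebra_simps)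
  have "wedge22 w w e = 2 * (A * F - B * E + C * D)"
    unfolding wedge22_def s' by (simp add: algebra_simps)
  then have P: "P > 0" if "P = A * F - B * E + C * D" for P using pos that by simp
  from pfaffian_identity[OF n o P] show "w (e 3) (e 4) = w (e 1) (e 2)"
    "w (e 2) (e 4) = - w (e 1) (e 3)" "w (e 2) (e 3) = w (e 1) (e 4)"
    unfolding s' by auto
qed

text \<open>The bracket on the right is the determinant of the coefficient vectors, the real part of
  the triple product \<open>M 2 M 1 M 3\<close>.\<close>

lemma quaternionic_canonical_metric:
  assumes Q: "quaternionic h I J K"
    and w: "\<And>k u v. w k u v = - h u (p k *\<^sub>R I v + q k *\<^sub>R J v + r k *\<^sub>R K v)"
    and N: "\<And>u v. w (1::3) u (N v) = w 3 u v"
  shows "((p 1)\<^sup>2 + (q 1)\<^sup>2 + (r 1)\<^sup>2) * (w 2 u (N v) + w 2 v (N u))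
    = 2 * (p 1 * (q 2 * r 3 - q 3 * r 2) - q 1 * (p 2 * r 3 - p 3 * r 2) + r 1 * (p 2 * q 3 - p 3 * q 2)) * h u v"
proof -
  note qq = quaternionicD[OF Q]
  note bl = bilinear_simps[OF inner_formD(1)[OF qq(1)]]
  note lin = linear_add[OF qq(2)] linear_add[OF qq(3)] linear_add[OF qq(4)]
    linear_scale[OF qq(2)] linear_scale[OF qq(3)] linear_scale[OF qq(4)]
    linear_neg[OF qq(2)] linear_neg[OF qq(3)] linear_neg[OF qq(4)]
    linear_diff[OF qq(2)] linear_diff[OF qq(3)] linear_diff[OF qq(4)]
  define M where "M k v = p k *\<^sub>R I v + q k *\<^sub>R J v + r k *\<^sub>R K v" for k v
  define c where "c = (p 1)\<^sup>2 + (q 1)\<^sup>2 + (r 1)\<^sup>2"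
  have M1: "M 1 (N v) = M 3 v" for v
    by (rule inner_form_eqI[OF qq(1)]) (use N[of _ v] in \<open>simp add: w M_def\<close>)
  have "M 1 (M 1 v) = - (c *\<^sub>R v)" for v
    by (simp add: M_def lin qq(8-16) c_def power2_eq_square algebra_simps)
  \<comment> \<open>\<open>N\<close> is the inverse of \<open>M 1\<close> applied to
    \<open>M 3\<close>; keeping \<open>c\<close> as a factor avoids dividing by it.\<close>
  then have cN: "c *\<^sub>R N v = - M 1 (M 3 v)" for v by (metis M1 add.inverse_inverse)
  have "c * w 2 u (N v) = - h u (M 2 (c *\<^sub>R N v))" for u v
    by (simp add: w M_def lin bl algebra_simps)
  then have *: "c * w 2 u (N v) = h u (M 2 (M 1 (M 3 v)))" for u v
  proof -
    have "M 2 (- x) = - M 2 x" for x by (simp add: M_def lin)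
    then show ?thesis
      using \<open>c * w 2 u (N v) = - h u (M 2 (c *\<^sub>R N v))\<close> by (simp add: cN bl)
  qed
  show ?thesis
    unfolding c_def[symmetric] distrib_left *
    by (simp add: M_def lin bl qq(8-16) qq(5-7)[of v u] inner_formD(2)[OF qq(1), of v u] algebra_simps)
qed

lemma quaternionic_scale:
  assumes Q: "quaternionic h I J K" and "c > 0"
  shows "quaternionic (\<lambda>u v. c * h u v) I J K"
proof -
  note q = quaternionicD[OF Q]
  have "inner_form (\<lambda>u v. c * h u v)"
    using q(1) \<open>c > 0\<close> unfolding inner_form_def bilinear_def
    by (auto simp: linear_iff algebra_simps)
  moreover have "c * h u (I v) = - (c * h v (I u))" "c * h u (J v) = - (c * h v (J u))"
    "c * h u (K v) = - (c * h v (K u))" for u v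
    using q(5-7)[of u v] by simp_all
  ultimately show ?thesis using q(2-4,8-12) unfolding quaternionic_def by blast
qed

text \<open>The three equations come from testing the Hodge identity on the coordinate forms
  \<open>wedge11 (g (e 1)) (g (e b))\<close>. Conversely, they make both sides agree for every
  \<open>q\<close> by expanding the sums.\<close>

lemma is_hodge_dual_self_iff:
  fixes w :: "'e::real_vector \<Rightarrow> 'e \<Rightarrow> real"
  assumes g: "inner_form g" and w: "alternating2 w"
  shows "is_hodge_dual g m w w \<longleftrightarrow>
    (\<forall>e. oriented_orthonormal g m e \<longrightarrow> w (e 3) (e 4) = w (e 1) (e 2) \<and>
       w (e 2) (e 4) = - w (e 1) (e 3) \<and> w (e 2) (e 3) = w (e 1) (e 4))"
proof
  assume H: "is_hodge_dual g m w w"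
  show "\<forall>e. oriented_orthonormal g m e \<longrightarrow> w (e 3) (e 4) = w (e 1) (e 2) \<and>
       w (e 2) (e 4) = - w (e 1) (e 3) \<and> w (e 2) (e 3) = w (e 1) (e 4)"
  proof (intro allI impI)
    fix e assume e: "oriented_orthonormal g m e"
    have ge: "g (e a) (e b) = (if a = b then 1 else 0)" for a b
      using e by (simp add: oriented_orthonormal_def)
    have alt: "alternating2 (wedge11 (g (e a)) (g (e b)))" for a b
      using inner_formD(1)[OF g] unfolding alternating2_def bilinear_def wedge11_def
      by (auto simp: linear_iff algebra_simps)
    have eq: "wedge22 (wedge11 (g (e a)) (g (e b))) w e
      = (1/2) * (\<Sum>c\<in>UNIV. \<Sum>d\<in>UNIV. wedge11 (g (e a)) (g (e b)) (e c) (e d) * w (e c) (e d))" for a b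
      using H alt e unfolding is_hodge_dual_def by blast
    note sk = alternating2D(3)[OF w, of "e 2" "e 1"] alternating2D(3)[OF w, of "e 3" "e 1"]
      alternating2D(3)[OF w, of "e 4" "e 1"]
    show "w (e 3) (e 4) = w (e 1) (e 2) \<and>
       w (e 2) (e 4) = - w (e 1) (e 3) \<and> w (e 2) (e 3) = w (e 1) (e 4)"
      using eq[of 1 2] eq[of 1 3] eq[of 1 4] sk
      by (simp add: wedge22_def wedge11_def ge sum_4)
  qed
next
  assume H: "\<forall>e. oriented_orthonormal g m e \<longrightarrow> w (e 3) (e 4) = w (e 1) (e 2) \<and>
       w (e 2) (e 4) = - w (e 1) (e 3) \<and> w (e 2) (e 3) = w (e 1) (e 4)"
  show "is_hodge_dual g m w w"
    unfolding is_hodge_dual_def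
  proof (intro conjI allI impI w)
    fix q :: "'e \<Rightarrow> 'e \<Rightarrow> real" and e :: "4 \<Rightarrow> 'e"
    assume qe: "alternating2 q \<and> oriented_orthonormal g m e"
    then have s: "w (e 3) (e 4) = w (e 1) (e 2)" "w (e 2) (e 4) = - w (e 1) (e 3)" "w (e 2) (e 3) = w (e 1) (e 4)"
      using H by auto
    have sk: "z (e 2) (e 1) = - z (e 1) (e 2)" "z (e 3) (e 1) = - z (e 1) (e 3)" "z (e 4) (e 1) = - z (e 1) (e 4)"
      "z (e 3) (e 2) = - z (e 2) (e 3)" "z (e 4) (e 2) = - z (e 2) (e 4)" "z (e 4) (e 3) = - z (e 3) (e 4)"
      "z (e a) (e a) = 0" if "alternating2 z" for z a
      using alternating2D(2,3)[OF that] by blast+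
    show "wedge22 q w e = (1/2) * (\<Sum>a\<in>UNIV. \<Sum>b\<in>UNIV. q (e a) (e b) * w (e a) (e b))"
      using qe by (simp add: sum_4 sk[OF w] sk[of q] wedge22_def s algebra_simps)
  qed
qed

section \<open>Alternating forms of top degree\<close>

definition alternating4 :: "((4 \<Rightarrow> 'e::real_vector) \<Rightarrow> real) \<Rightarrow> bool" where
  "alternating4 m \<longleftrightarrow> (\<forall>e a. linear (\<lambda>v. m (e(a := v)))) \<and> (\<forall>e a b. a \<noteq> b \<and> e a = e b \<longrightarrow> m e = 0)"

text \<open>Polarisation: \<open>m\<close> vanishes with \<open>e a + e b\<close> in both slots, and
  expanding leaves the two mixed terms.\<close>

lemma alternating4_transpose:
  assumes m: "alternating4 m" and "a \<noteq> b"
  shows "m (e \<circ> Transposition.transpose a b) = - m e"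
proof -
  have add: "m (f(c := x + y)) = m (f(c := x)) + m (f(c := y))" for f c x y
    using m linear_add unfolding alternating4_def by blast
  have z: "m f = 0" if "f a = f b" for f using m \<open>a \<noteq> b\<close> that unfolding alternating4_def by blast
  let ?x = "e a" and ?y = "e b"
  have "0 = m (e(a := ?x + ?y, b := ?x + ?y))" by (rule z[symmetric]) simp
  also have "\<dots> = m (e(a := ?x + ?y, b := ?x)) + m (e(a := ?x + ?y, b := ?y))" by (rule add)
  also have "m (e(a := ?x + ?y, b := ?x)) = m (e(b := ?x, a := ?x + ?y))"
    using \<open>a \<noteq> b\<close> by (simp add: fun_upd_twist)
  also have "\<dots> = m (e(b := ?x, a := ?x)) + m (e(b := ?x, a := ?y))" by (rule add)
  also have "m (e(b := ?x, a := ?x)) = 0" by (rule z) (use \<open>a \<noteq> b\<close> in simp)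
  also have "m (e(a := ?x + ?y, b := ?y)) = m (e(b := ?y, a := ?x + ?y))"
    using \<open>a \<noteq> b\<close> by (simp add: fun_upd_twist)
  also have "\<dots> = m (e(b := ?y, a := ?x)) + m (e(b := ?y, a := ?y))" by (rule add)
  also have "m (e(b := ?y, a := ?y)) = 0" by (rule z) (use \<open>a \<noteq> b\<close> in simp)
  also have "e(b := ?y, a := ?x) = e" by simp
  also have "e(b := ?x, a := ?y) = e \<circ> Transposition.transpose a b"
    using \<open>a \<noteq> b\<close> by (auto simp: Transposition.transpose_def fun_eq_iff)
  finally show ?thesis by linarith
qed

lemma alternating4_eq_0:
  assumes m: "alternating4 m" and e: "m e = 0" and span: "\<And>x. \<exists>c. x = (\<Sum>a\<in>UNIV. c a *\<^sub>R e a)"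
  shows "m v = 0"
proof -
  have lin: "linear (\<lambda>x. m (f(a := x)))" for f a using m by (simp add: alternating4_def)
  have perm: "m (e \<circ> \<pi>) = 0" if "\<pi> permutes UNIV" for \<pi>
    using finite that
  proof (induction rule: permutes_rev_induct)
    case id then show ?case using e by simp
  next
    case (swap a b p)
    then show ?case unfolding comp_assoc[symmetric] alternating4_transpose[OF m \<open>a \<noteq> b\<close>] by linarith
  qed
  have basis: "m (e \<circ> \<pi>) = 0" for \<pi>
  proof (cases "inj \<pi>")
    case True
    then have "bij \<pi>" using finite_UNIV_inj_surj[of \<pi>] by (simp add: bij_def)
    then show ?thesis using perm bij_imp_permutes[of \<pi> UNIV] by simp
  next
    case False
    then obtain a b where "a \<noteq> b" "\<pi> a = \<pi> b" by (auto simp: inj_def)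
    then show ?thesis using m unfolding alternating4_def by (metis comp_apply)
  qed
  \<comment> \<open>Induction on the set \<open>A\<close> of slots holding arbitrary vectors, the
    other slots holding vectors of \<open>e\<close>. For empty \<open>A\<close> the form is
    evaluated on \<open>e\<close> with rearranged or repeated indices; an additional slot is
    expanded by linearity.\<close>
  have "\<forall>f. (\<forall>a. a \<notin> A \<longrightarrow> f a \<in> range e) \<longrightarrow> m f = 0" for A :: "4 set"
    using finite[of A]
  proof (induction A rule: finite_induct)
    case empty
    show ?case
    proof (intro allI impI)
      fix f :: "4 \<Rightarrow> 'a" assume "\<forall>a. a \<notin> {} \<longrightarrow> f a \<in> range e"
      then have "\<forall>a. \<exists>b. f a = e b" by auto
      then obtain \<pi> where "\<And>a. f a = e (\<pi> a)" by metis
      then have "f = e \<circ> \<pi>" by auto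
      then show "m f = 0" using basis by simp
    qed
  next
    case (insert c A)
    show ?case
    proof (intro allI impI)
      fix f :: "4 \<Rightarrow> 'a" assume f: "\<forall>a. a \<notin> insert c A \<longrightarrow> f a \<in> range e"
      obtain k where k: "f c = (\<Sum>a\<in>UNIV. k a *\<^sub>R e a)" using span by blast
      have "m f = m (f(c := \<Sum>a\<in>UNIV. k a *\<^sub>R e a))" by (simp add: k[symmetric])
      also have "\<dots> = (\<Sum>a\<in>UNIV. k a * m (f(c := e a)))"
        by (simp add: linear_sum[OF lin] linear_scale[OF lin])
      also have "\<dots> = 0" using insert.IH f by (intro sum.neutral) auto
      finally show "m f = 0" by simp
    qed
  qed
  from this[of UNIV] show ?thesis by simp
qed

lemma alternating4_linear_combination:
  assumes "alternating4 m" "alternating4 n"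
  shows "alternating4 (\<lambda>v. c * m v - d * n v)"
  unfolding alternating4_def
proof (intro conjI allI impI)
  fix f :: "4 \<Rightarrow> 'a" and a
  have l: "linear (\<lambda>v. m (f(a := v)))" "linear (\<lambda>v. n (f(a := v)))"
    using assms by (auto simp: alternating4_def)
  show "linear (\<lambda>v. c * m (f(a := v)) - d * n (f(a := v)))"
    by (rule linearI) (simp_all add: linear_add[OF l(1)] linear_add[OF l(2)]
      linear_scale[OF l(1)] linear_scale[OF l(2)] algebra_simps)
next
  fix f :: "4 \<Rightarrow> 'a" and a b assume ab: "a \<noteq> b \<and> f a = f b"
  have "m f = 0" using assms(1) ab unfolding alternating4_def by blast
  moreover have "n f = 0" using assms(2) ab unfolding alternating4_def by blast
  ultimately show "c * m f - d * n f = 0" by simp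
qed

lemma alternating4_proportional:
  assumes m: "alternating4 m" and n: "alternating4 n" and e: "m e \<noteq> 0"
    and span: "\<And>x. \<exists>c. x = (\<Sum>a\<in>UNIV. c a *\<^sub>R e a)"
  shows "n v = n e / m e * m v"
proof -
  from alternating4_eq_0[OF alternating4_linear_combination[OF n m, of 1 "n e / m e"], of e v] have "n v - n e / m e * m v = 0"
    using e span by fastforce
  then show ?thesis by linarith
qed

lemma alternating4_wedge22:
  assumes "alternating2 w" "alternating2 w'" shows "alternating4 (wedge22 w w')"
  unfolding alternating4_def
proof (intro conjI allI impI)
  note bl = bilinear_simps[OF alternating2D(1)[OF assms(1)]] bilinear_simps[OF alternating2D(1)[OF assms(2)]]
  show "linear (\<lambda>v. wedge22 w w' (e(a := v)))" for e a
    using exhaust_4[of a] by (auto intro!: linearI simp: wedge22_def bl algebra_simps)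
next
  fix e :: "4 \<Rightarrow> 'a" and a b :: 4 assume ab: "a \<noteq> b \<and> e a = e b"
  note s = alternating2D(2)[OF assms(1)] alternating2D(2)[OF assms(2)]
  have sk: "z (e 2) (e 1) = - z (e 1) (e 2)" "z (e 3) (e 1) = - z (e 1) (e 3)" "z (e 4) (e 1) = - z (e 1) (e 4)"
      "z (e 3) (e 2) = - z (e 2) (e 3)" "z (e 4) (e 2) = - z (e 2) (e 4)" "z (e 4) (e 3) = - z (e 3) (e 4)"
      if "alternating2 z" for z
      using alternating2D(3)[OF that] by blast+
  show "wedge22 w w' e = 0"
    using ab exhaust_4[of a] exhaust_4[of b] sk[OF assms(1)] sk[OF assms(2)]
    by (elim conjE disjE) (simp_all add: wedge22_def s)
qed

section \<open>Closed quaternionic triples are parallel\<close>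

text \<open>\<open>N u\<close> models the covariant derivative of \<open>J\<close> along
  \<open>u\<close>, \<open>anti\<close> the derivative of \<open>J J = -1\<close>, and
  \<open>closed\<close> the closedness of \<open>- g(., J .)\<close>. The conclusion is the identity
  of almost Kaehler geometry that moves \<open>J\<close> out of the direction of
  differentiation.\<close>

lemma closed_skew_endo_anticommute:
  assumes g: "inner_form g" and "linear J" and J: "\<And>u. J (J u) = - u" "\<And>u v. g u (J v) = - g v (J u)"
    and N: "\<And>u. linear (N u)" "\<And>v. linear (\<lambda>u. N u v)"
    and closed: "\<And>u v w. g v (N u w) + g w (N v u) + g u (N w v) = 0"
    and anti: "\<And>u v. N u (J v) = - J (N u v)"
  shows "N (J u) v = - J (N u v)"
proof (rule inner_form_eqI[OF g])
  fix w
  note bl = bilinear_simps[OF inner_formD(1)[OF g]]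
  note lin = linear_neg[OF N(1)] linear_neg[OF N(2)] linear_neg[OF \<open>linear J\<close>]
  have P: "g (J a) (N b c) = g a (N b (J c))" for a b c
    using J(2)[of "N b c" a] inner_formD(2)[OF g] by (simp add: anti bl)
  \<comment> \<open>In \<open>p\<close>, \<open>q\<close>, \<open>r\<close> the direction carries
    \<open>J\<close>, in \<open>x\<close>, \<open>y\<close>, \<open>z\<close> the argument does.
    Inserting \<open>J\<close> into all three slots of the cyclic identity, and into each one
    separately, gives four linear relations that imply \<open>p = x\<close>.\<close>
  define p q r where pqr: "p = g w (N (J u) v)" "q = g u (N (J v) w)" "r = g v (N (J w) u)"
  define x y z where xyz: "x = g w (N u (J v))" "y = g u (N v (J w))" "z = g v (N w (J u))"
  have 1: "p + q + r = 0"
    using closed[where u = "J u" and v = "J w" and w = "J v"] unfolding P by (simp add: pqr lin anti J(1) bl)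
  have 2: "p = - y - z"
    using closed[where v = w and u = "J u" and w = v] P[of u v w] unfolding pqr xyz by linarith
  have 3: "q = - z - x" "r = - x - y"
    using closed[where v = u and u = "J v" and w = w] P[of v w u]
      closed[where v = v and u = "J w" and w = u] P[of w u v] unfolding pqr xyz by linarith+
  have "p = x" using 1 2 3 by linarith
  then show "g w (N (J u) v) = g w (- J (N u v))" by (simp add: pqr xyz anti)
qed

text \<open>Anticommuting with \<open>I\<close> and \<open>J\<close> means commuting with
  \<open>K = I J\<close>; anticommuting with \<open>K\<close> as well leaves
  \<open>2 K N = 0\<close>.\<close>

lemma anticommute_quaternions_eq_0:
  assumes "quaternionic g I J K"
    and "\<And>v. N (I v) = - I (N v)" "\<And>v. N (J v) = - J (N v)" "\<And>v. N (K v) = - K (N v)"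
  shows "N v = (0 :: 'e :: real_vector)"
proof -
  note q = quaternionicD[OF assms(1)]
  have "N (K v) = K (N v)"
    using assms(2)[of "J v"] assms(3)[of v] by (simp add: linear_neg[OF q(2)] q(11))
  then have "K (N v) = - K (N v)" using assms(4)[of v] by simp
  then have "K (N v) = 0"
    by (metis eq_neg_iff_add_eq_0 scaleR_2 scaleR_eq_0_iff zero_neq_numeral)
  then show ?thesis using q(10)[of "N v"] linear_0[OF q(4)] by simp
qed

text \<open>\<open>N1\<close>, \<open>N2\<close>, \<open>N3\<close> model the covariant derivatives
  of \<open>I\<close>, \<open>J\<close>, \<open>K\<close>, and \<open>mixed\<close> the derivatives
  of \<open>I J + J I = 0\<close> and its cyclic analogues. Once the components \<open>A1\<close>,
  \<open>A2\<close>, \<open>A3\<close> vanish, each \<open>N\<close> anticommutes with all three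
  units and must be zero.\<close>

lemma closed_quaternionic_derivation_eq_0:
  assumes Q: "quaternionic g I J K"
    and lin: "\<And>u. linear (N1 u)" "\<And>v. linear (\<lambda>u. N1 u v)" "\<And>u. linear (N2 u)" "\<And>v. linear (\<lambda>u. N2 u v)"
      "\<And>u. linear (N3 u)" "\<And>v. linear (\<lambda>u. N3 u v)"
    and closed: "\<And>u v w. g v (N1 u w) + g w (N1 v u) + g u (N1 w v) = 0"
      "\<And>u v w. g v (N2 u w) + g w (N2 v u) + g u (N2 w v) = 0"
      "\<And>u v w. g v (N3 u w) + g w (N3 v u) + g u (N3 w v) = 0"
    and anti: "\<And>u v. N1 u (I v) = - I (N1 u v)" "\<And>u v. N2 u (J v) = - J (N2 u v)"
      "\<And>u v. N3 u (K v) = - K (N3 u v)"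
    and mixed: "\<And>u v. N1 u (J v) + I (N2 u v) + N2 u (I v) + J (N1 u v) = 0"
      "\<And>u v. N2 u (K v) + J (N3 u v) + N3 u (J v) + K (N2 u v) = 0"
      "\<And>u v. N3 u (I v) + K (N1 u v) + N1 u (K v) + I (N3 u v) = 0"
  shows "N1 u v = 0" "N2 u v = 0" "N3 u v = 0"
proof -
  note q = quaternionicD[OF Q]
  note c1 = closed_skew_endo_anticommute[where g = g and J = I and N = N1, OF q(1,2,8,5) lin(1,2) closed(1) anti(1)]
  note c2 = closed_skew_endo_anticommute[where g = g and J = J and N = N2, OF q(1,3,9,6) lin(3,4) closed(2) anti(2)]
  note c3 = closed_skew_endo_anticommute[where g = g and J = K and N = N3, OF q(1,4,10,7) lin(5,6) closed(3) anti(3)]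
  note neg = linear_neg[OF q(2)] linear_neg[OF q(3)] linear_neg[OF q(4)]
    linear_neg[OF lin(1)] linear_neg[OF lin(3)] linear_neg[OF lin(5)]
    linear_neg[OF lin(2)] linear_neg[OF lin(4)] linear_neg[OF lin(6)]
  text \<open>The components of a derivation of the quaternions along the commutators with \<open>I\<close>, \<open>J\<close>, \<open>K\<close>.\<close>
  define A1 A2 A3 where A: "A1 = (\<lambda>u v. N2 u (K v) + K (N2 u v))" "A2 = (\<lambda>u v. N3 u (I v) + I (N3 u v))"
    "A3 = (\<lambda>u v. N1 u (J v) + J (N1 u v))"
  have A': "A1 u v = - (N3 u (J v) + J (N3 u v))" "A2 u v = - (N1 u (K v) + K (N1 u v))"
    "A3 u v = - (N2 u (I v) + I (N2 u v))" for u v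
    unfolding eq_neg_iff_add_eq_0 using mixed[of u v] by (simp_all only: A add_ac)
  have m: "I (N1 u (J v)) = - N1 u (K v)" "J (N2 u (K v)) = - N2 u (I v)" "K (N3 u (I v)) = - N3 u (J v)" for u v
    using anti(1)[of u "J v"] anti(2)[of u "K v"] anti(3)[of u "I v"] by (simp_all add: q(8-16))
  \<comment> \<open>Each component has two expressions, through two of the three derivatives.
    Choosing the right one allows the unit in the direction slot to be moved out by
    \<open>c1\<close>, \<open>c2\<close> or \<open>c3\<close>.\<close>
  have r: "A3 (I u) v = - A2 u v" "A1 (J u) v = - A3 u v" "A2 (K u) v = - A1 u v" for u v
    unfolding A'(2)[of u v] A'(3)[of u v] A'(1)[of u v]
    by (simp_all add: A c1 c2 c3 neg q(8-16) m)
  have n: "A1 (- u) v = - A1 u v" "A2 (- u) v = - A2 u v" "A3 (- u) v = - A3 u v" for u v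
    by (simp_all add: A neg)
  have half: "a = 0" if "a = - a" for a :: 'a
    using that by (metis eq_neg_iff_add_eq_0 scaleR_2 scaleR_eq_0_iff zero_neq_numeral)
  \<comment> \<open>The relations \<open>r\<close> give \<open>A2 (I u)\<close> twice: as
    \<open>A3 u\<close> by the first one, and as \<open>- A3 u\<close> by the other two together
    with \<open>K J = - I\<close>.\<close>
  have A3: "A3 u v = 0" for u v
  proof (rule half)
    have "A3 u v = A2 (K (J u)) v" using r(2,3) by simp
    also have "\<dots> = - A2 (I u) v" by (simp add: q(14) n)
    finally have "A3 u v = - A2 (I u) v" .
    moreover have "A2 (I u) v = A3 u v" using r(1)[of "I u" v] by (simp add: q(8) n)
    ultimately show "A3 u v = - A3 u v" by simp
  qed
  have A2: "A2 u v = 0" for u v using r(1)[of u v] A3 by simp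
  have A1: "A1 u v = 0" for u v using r(3)[of u v] A2 by simp
  have s: "a = - b" if "a + b = 0" for a b :: 'a using that by (simp add: eq_neg_iff_add_eq_0)
  have e: "N1 u (J v) = - J (N1 u v)" "N1 u (K v) = - K (N1 u v)" "N2 u (K v) = - K (N2 u v)"
    "N2 u (I v) = - I (N2 u v)" "N3 u (I v) = - I (N3 u v)" "N3 u (J v) = - J (N3 u v)" for v
  proof -
    have "N1 u (J v) + J (N1 u v) = 0" "N3 u (I v) + I (N3 u v) = 0" "N2 u (K v) + K (N2 u v) = 0"
      using A1[of u v] A2[of u v] A3[of u v] by (simp_all only: A)
    moreover have "N1 u (K v) + K (N1 u v) = 0" "N2 u (I v) + I (N2 u v) = 0" "N3 u (J v) + J (N3 u v) = 0"
      using A'[of u v] A1[of u v] A2[of u v] A3[of u v] by (metis neg_equal_0_iff_equal)+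
    ultimately show "N1 u (J v) = - J (N1 u v)" "N1 u (K v) = - K (N1 u v)" "N2 u (K v) = - K (N2 u v)"
      "N2 u (I v) = - I (N2 u v)" "N3 u (I v) = - I (N3 u v)" "N3 u (J v) = - J (N3 u v)"
      by (blast intro: s)+
  qed
  show "N1 u v = 0" "N2 u v = 0" "N3 u v = 0"
    by (rule anticommute_quaternions_eq_0[OF Q]; rule anti e)+
qed

lemma christoffel_eq:
  fixes g :: "('i, 'e::euclidean_space) tensor2"
  assumes "open S" "x \<in> S" and g: "\<And>y. y \<in> S \<Longrightarrow> inner_form (g i y)"
    and sm: "\<And>u v. smooth_on S (\<lambda>y. g i y u v)" and dim: "DIM('e) = 4"
  shows "g i x (christoffel g i x u v) w =
        (1/2) * (frechet_derivative (\<lambda>y. g i y v w) (at x) u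
               + frechet_derivative (\<lambda>y. g i y u w) (at x) v
               - frechet_derivative (\<lambda>y. g i y u v) (at x) w)" (is "_ = ?k w")
proof -
  have lin: "linear (g i y v)" if "y \<in> S" for v y
    using inner_formD(1)[OF g[OF that]] by (auto simp: bilinear_def)
  have der: "((\<lambda>y. g i y u v) has_derivative frechet_derivative (\<lambda>y. g i y u v) (at x)) (at x)" for u v
    by (rule smooth_on_has_derivative[OF sm \<open>x \<in> S\<close>])
  have l: "linear (\<lambda>w. frechet_derivative (\<lambda>y. g i y v w) (at x) u)" for v u
    by (rule has_derivative_linear_family(2)[OF assms(1,2) lin der has_derivative_ident])
  have "linear ?k"
    using l[of v u] l[of u v] has_derivative_linear[OF der[of u v]]
    by (auto simp: linear_iff algebra_simps add_divide_distrib diff_divide_distrib)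
  from theI'[OF inner_form_Riesz[OF g[OF \<open>x \<in> S\<close>] dim this]]
  show ?thesis unfolding christoffel_def by blast
qed

text \<open>The covariant derivatives \<open>N k\<close> satisfy, at the point \<open>x\<close>, the
  hypotheses of \<open>closed_quaternionic_derivation_eq_0\<close>: the quaternion relations are
  differentiated, and closedness becomes a cyclic identity because the connection is torsion
  free.\<close>

lemma closed_hermitian_triple_parallel:
  fixes g :: "('i, 'e::euclidean_space) tensor2" and J :: "3 \<Rightarrow> ('i, 'e) endo" and w :: "3 \<Rightarrow> ('i, 'e) tensor2"
  assumes S: "open S" "x \<in> S" and dim: "DIM('e) = 4"
    and Q: "\<And>y. y \<in> S \<Longrightarrow> quaternionic (g i y) (J 1 i y) (J 2 i y) (J 3 i y)"
    and smg: "\<And>u v. smooth_on S (\<lambda>y. g i y u v)" and smJ: "\<And>k v. smooth_on S (\<lambda>y. J k i y v)"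
    and w: "\<And>k y u v. y \<in> S \<Longrightarrow> w k i y u v = - g i y u (J k i y v)"
    and closed: "\<And>k u v z. frechet_derivative (\<lambda>y. w k i y v z) (at x) u
      + frechet_derivative (\<lambda>y. w k i y z u) (at x) v + frechet_derivative (\<lambda>y. w k i y u v) (at x) z = 0"
  shows "frechet_derivative (\<lambda>y. J k i y v) (at x) u + christoffel g i x u (J k i x v)
          - J k i x (christoffel g i x u v) = 0"
    and "nijenhuis (J k) i x u v = 0"
proof -
  define Dg where "Dg u v w = frechet_derivative (\<lambda>y. g i y v w) (at x) u" for u v w
  define DJ where "DJ k u v = frechet_derivative (\<lambda>y. J k i y v) (at x) u" for k u v
  define Dw where "Dw k u v z = frechet_derivative (\<lambda>y. w k i y v z) (at x) u" for k u v z
  define G where "G u v = christoffel g i x u v" for u v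
  have g: "inner_form (g i y)" if "y \<in> S" for y using quaternionicD(1)[OF Q[OF that]] .
  note gx = g[OF S(2)]
  note bl = bilinear_simps[OF inner_formD(1)[OF gx]]
  note sym = inner_formD(2)[OF gx]
  note q = quaternionicD[OF Q[OF S(2)]]
  have linJ: "linear (J k i y)" if "y \<in> S" for k y
    using quaternionicD(2-4)[OF Q[OF that]] exhaust_3[of k] by auto
  have ling: "linear (g i y v)" if "y \<in> S" for y v
    using inner_formD(1)[OF g[OF that]] by (auto simp: bilinear_def)
  have derg: "((\<lambda>y. g i y v w) has_derivative (\<lambda>u. Dg u v w)) (at x)" for v w
    unfolding Dg_def using smooth_on_has_derivative[OF smg S(2)] .
  have derJ: "((\<lambda>y. J k i y v) has_derivative (\<lambda>u. DJ k u v)) (at x)" for k v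
    unfolding DJ_def using smooth_on_has_derivative[OF smJ S(2)] .
  have symS: "g i y v w = g i y w v" if "y \<in> S" for y v w by (rule inner_formD(2)[OF g[OF that]])
  have Dg_sym: "Dg u v w = Dg u w v" for u v w
  proof -
    have "((\<lambda>y. g i y v w) has_derivative (\<lambda>u. Dg u w v)) (at x)"
      by (rule has_derivative_transform_within_open[OF derg[of w v] S]) (rule symS)
    then show ?thesis using derg[of v w] has_derivative_unique by metis
  qed
  have koszul: "g i x (G u v) w = (1/2) * (Dg u v w + Dg v u w - Dg w u v)" for u v w
    unfolding G_def Dg_def by (rule christoffel_eq[where g = g and i = i and S = S, OF S g smg dim])
  have koszul': "g i x w (G u v) = (1/2) * (Dg u v w + Dg v u w - Dg w u v)" for u v w
    using koszul sym by metis
  have Dg_lin: "linear (\<lambda>u. Dg u v w)" "linear (\<lambda>w. Dg u v w)" "linear (\<lambda>v. Dg u v w)" for u v w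
  proof -
    show "linear (\<lambda>u. Dg u v w)" using has_derivative_linear[OF derg] .
    show l: "linear (\<lambda>w. Dg u v w)" for v
      by (rule has_derivative_linear_family(2)[OF S ling derg has_derivative_ident])
    show "linear (\<lambda>v. Dg u v w)" using l[of w] Dg_sym by simp
  qed
  have DJ_lin: "linear (\<lambda>u. DJ k u v)" "linear (\<lambda>v. DJ k u v)" for k u v
  proof -
    show "linear (\<lambda>u. DJ k u v)" using has_derivative_linear[OF derJ] .
    show "linear (\<lambda>v. DJ k u v)"
      by (rule has_derivative_linear_family(2)[OF S linJ derJ has_derivative_ident])
  qed
  note Dg_add = linear_add[OF Dg_lin(1)] linear_add[OF Dg_lin(2)] linear_add[OF Dg_lin(3)]
    linear_scale[OF Dg_lin(1)] linear_scale[OF Dg_lin(2)] linear_scale[OF Dg_lin(3)]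
  have G_lin: "linear (\<lambda>u. G u v)" "linear (\<lambda>v. G u v)" for u v
    by (intro linearI inner_form_eqI[OF gx]; simp add: koszul' bl Dg_add field_simps)+
  have G_sym: "G u v = G v u" for u v
    by (rule inner_form_eqI[OF gx]) (use Dg_sym in \<open>simp add: koszul'\<close>)
  have metric: "g i x (G u v) w + g i x v (G u w) = Dg u v w" for u v w
    using Dg_sym[of u w v] Dg_sym[of v w u] Dg_sym[of w v u] by (simp add: koszul koszul' add_divide_distrib diff_divide_distrib)
  have Dw: "Dw k u v z = - (Dg u v (J k i x z) + g i x v (DJ k u z))" for k u v z
  proof -
    have "((\<lambda>y. g i y v (J k i y z)) has_derivative (\<lambda>u. Dg u v (J k i x z) + g i x v (DJ k u z))) (at x)"
      by (rule has_derivative_linear_family(1)[where A = "\<lambda>y. g i y v" and f = "\<lambda>y. J k i y z", OF S ling derg derJ])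
    then have "((\<lambda>y. w k i y v z) has_derivative (\<lambda>u. - (Dg u v (J k i x z) + g i x v (DJ k u z)))) (at x)"
      by (rule has_derivative_transform_within_open[OF has_derivative_minus S]) (simp add: w)
    from fun_cong[OF frechet_derivative_at[OF this], of u] show ?thesis by (simp add: Dw_def)
  qed
  have DJJ: "((\<lambda>y. J k i y (J l i y v)) has_derivative (\<lambda>u. DJ k u (J l i x v) + J k i x (DJ l u v))) (at x)"
    for k l v
    by (rule has_derivative_linear_family(1)[where A = "\<lambda>y. J k i y" and f = "\<lambda>y. J l i y v",
      OF S linJ derJ derJ])
  have sq: "DJ k u (J k i x v) + J k i x (DJ k u v) = 0" for k u v
  proof -
    have "J k i y (J k i y v) = - v" if "y \<in> S" for y
      using quaternionicD(8-10)[OF Q[OF that]] exhaust_3[of k] by auto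
    then have "((\<lambda>y. - v) has_derivative (\<lambda>u. DJ k u (J k i x v) + J k i x (DJ k u v))) (at x)"
      by (intro has_derivative_transform_within_open[OF DJJ S]) simp
    then have "(\<lambda>u. DJ k u (J k i x v) + J k i x (DJ k u v)) = (\<lambda>u. 0)"
      by (rule has_derivative_unique) (rule has_derivative_const)
    then show ?thesis by metis
  qed
  have mix: "DJ k u (J l i x v) + J k i x (DJ l u v) + DJ l u (J k i x v) + J l i x (DJ k u v) = 0"
    if kl: "(k, l) \<in> {(1,2), (2,3), (3,1)}" for k l u v
  proof -
    have "J k i y (J l i y v) + J l i y (J k i y v) = 0" if "y \<in> S" for y
      using quaternionicD(11-16)[OF Q[OF that]] kl by auto
    then have "((\<lambda>y. 0) has_derivative (\<lambda>u. (DJ k u (J l i x v) + J k i x (DJ l u v))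
        + (DJ l u (J k i x v) + J l i x (DJ k u v)))) (at x)"
      by (intro has_derivative_transform_within_open[OF has_derivative_add[OF DJJ DJJ] S]) simp
    then have "(\<lambda>u. (DJ k u (J l i x v) + J k i x (DJ l u v))
        + (DJ l u (J k i x v) + J l i x (DJ k u v))) = (\<lambda>u. 0)"
      by (rule has_derivative_unique) (rule has_derivative_const)
    then show ?thesis by (metis add.assoc)
  qed
  define N where "N k u v = DJ k u v + G u (J k i x v) - J k i x (G u v)" for k u v
  note lin_simps = linear_add[OF linJ[OF S(2)]] linear_diff[OF linJ[OF S(2)]] linear_scale[OF linJ[OF S(2)]]
    linear_neg[OF linJ[OF S(2)]] linear_neg[OF G_lin(2)]
    linear_add[OF G_lin(1)] linear_add[OF G_lin(2)] linear_scale[OF G_lin(1)] linear_scale[OF G_lin(2)]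
    linear_add[OF DJ_lin(1)] linear_add[OF DJ_lin(2)] linear_scale[OF DJ_lin(1)] linear_scale[OF DJ_lin(2)]
  have N_lin: "linear (N k u)" "linear (\<lambda>u. N k u v)" for k u v
    by (auto intro!: linearI simp: N_def lin_simps algebra_simps)
  have skJ: "g i x u (J k i x v) = - g i x v (J k i x u)" for k u v
    using q(5-7) exhaust_3[of k] by metis
  have JJ: "J k i x (J k i x v) = - v" for k v using q(8-10) exhaust_3[of k] by metis
  \<comment> \<open>The right side is the covariant derivative of \<open>w k\<close> along
    \<open>u\<close>. In its cyclic sum the Christoffel terms cancel by the symmetry of
    \<open>G\<close>, leaving the exterior derivative.\<close>
  have P: "- g i x v (N k u z) = Dw k u v z - w k i x (G u v) z - w k i x v (G u z)" for k u v z
    using metric[of u v "J k i x z"] by (simp add: N_def Dw bl w[OF S(2)])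
  have sk2: "w k i x u v = - w k i x v u" for k u v
    unfolding w[OF S(2)] using skJ[of u k v] by linarith
  have cyc: "g i x v (N k u z) + g i x z (N k v u) + g i x u (N k z v) = 0" for k u v z
    using P[of v k u z] P[of z k v u] P[of u k z v] closed[of k v z u, folded Dw_def]
      sk2[of k "G u v" z] sk2[of k "G v z" u] sk2[of k "G z u" v]
    unfolding G_sym[of v u] G_sym[of z v] G_sym[of u z] by linarith
  have anti: "N k u (J k i x v) = - J k i x (N k u v)" for k u v
  proof -
    have "DJ k u (J k i x v) = - J k i x (DJ k u v)"
      using sq[of k u v] unfolding eq_neg_iff_add_eq_0 .
    then show ?thesis by (simp add: N_def JJ lin_simps)
  qed
  have mixN: "N k u (J l i x v) + J k i x (N l u v) + N l u (J k i x v) + J l i x (N k u v) = 0"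
    if kl: "(k, l) \<in> {(1,2), (2,3), (3,1)}" for k l u v
  proof -
    \<comment> \<open>Anticommutation makes all Christoffel terms cancel, so \<open>mixN\<close>
      reduces to the flat identity \<open>mix\<close>.\<close>
    have a: "J k i x (J l i x v) = - J l i x (J k i x v)" for v using q(11-16) kl by auto
    have "N k u (J l i x v) + J k i x (N l u v) + N l u (J k i x v) + J l i x (N k u v)
      = (DJ k u (J l i x v) + J k i x (DJ l u v) + DJ l u (J k i x v) + J l i x (DJ k u v))"
      by (simp add: N_def lin_simps a)
    then show ?thesis using mix[OF kl] by simp
  qed
  have N0: "N k u v = 0" for k u v
    using closed_quaternionic_derivation_eq_0[OF Q[OF S(2)], of "N 1" "N 2" "N 3" u v, OF N_lin N_lin N_lin
      cyc cyc cyc anti anti anti mixN mixN mixN] exhaust_3[of k] by auto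
  show "frechet_derivative (\<lambda>y. J k i y v) (at x) u + christoffel g i x u (J k i x v)
          - J k i x (christoffel g i x u v) = 0"
    using N0[of k u v] by (simp add: N_def DJ_def G_def)
  \<comment> \<open>Parallelism expresses the derivatives of \<open>J k\<close> through
    \<open>G\<close>; in the Nijenhuis tensor the resulting terms cancel in pairs because
    \<open>G\<close> is symmetric.\<close>
  have D: "DJ k u v = J k i x (G u v) - G u (J k i x v)" for u v
  proof -
    have "DJ k u v + G u (J k i x v) = J k i x (G u v)" using N0[of k u v] by (simp add: N_def)
    then show ?thesis unfolding eq_diff_eq .
  qed
  show "nijenhuis (J k) i x u v = 0"
    unfolding nijenhuis_def Let_def DJ_def[symmetric]
    using G_sym[of "J k i x v" "J k i x u"] G_sym[of v u] G_sym[of "J k i x v" u] G_sym[of "J k i x u" v]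
    by (simp add: D lin_simps JJ)
qed

lemma ext_deriv_closed:
  assumes S: "open (chart_image M i)" "i \<in> charts M" and T: "one_form M T" and x: "x \<in> chart_image M i"
  shows "frechet_derivative (\<lambda>y. ext_deriv M T i y v w) (at x) u
    + frechet_derivative (\<lambda>y. ext_deriv M T i y w u) (at x) v
    + frechet_derivative (\<lambda>y. ext_deriv M T i y u v) (at x) w = 0"
proof -
  let ?D = "\<lambda>v w y. frechet_derivative (\<lambda>y. T i y v) (at y) w"
  have sm: "smooth_on (chart_image M i) (\<lambda>y. T i y v)" for v using T S(2) by (auto simp: one_form_def)
  have der: "(?D v w has_derivative frechet_derivative (?D v w) (at x)) (at x)" for v w
    using smooth_on_has_derivative[OF smooth_on_frechet_derivative[OF sm] x] .
  have h: "((\<lambda>y. ext_deriv M T i y v w) has_derivative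
      (\<lambda>u. frechet_derivative (?D w v) (at x) u - frechet_derivative (?D v w) (at x) u)) (at x)" for v w
    by (rule has_derivative_transform_within_open[OF has_derivative_diff[OF der der] S(1) x])
      (simp add: ext_deriv_def in_chart_def S(2))
  have *: "frechet_derivative (\<lambda>y. ext_deriv M T i y v w) (at x) u
      = frechet_derivative (?D w v) (at x) u - frechet_derivative (?D v w) (at x) u" for u v w
    using fun_cong[OF frechet_derivative_at[OF h[of v w]], of u] by simp
  show ?thesis unfolding *
    using frechet_derivative_commute[OF S(1) x sm, of w v u] frechet_derivative_commute[OF S(1) x sm, of u v w]
      frechet_derivative_commute[OF S(1) x sm, of v u w] by simp
qed

section \<open>The normal form of the forms \<open>\<Omega>\<^sub>k\<close> at a point\<close>

text \<open>The scalar product is obtained by declaring \<open>f\<close> orthonormal. That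
  \<open>f\<close> is a basis is read off from the single form \<open>w l\<close>, which pairs
  \<open>f 1\<close> with \<open>f 2\<close> and \<open>f 3\<close> with \<open>f 4\<close> and is
  zero on all other pairs.\<close>

lemma standard_triple_quaternionic:
  fixes w :: "3 \<Rightarrow> 'e::euclidean_space \<Rightarrow> 'e \<Rightarrow> real" and f :: "4 \<Rightarrow> 'e"
  assumes dim: "DIM('e) = 4" and w: "\<And>k. alternating2 (w k)"
    and f: "\<And>k. w k (f 1) (f 2) = p k" "\<And>k. w k (f 3) (f 4) = p k"
      "\<And>k. w k (f 1) (f 3) = q k" "\<And>k. w k (f 2) (f 4) = - q k"
      "\<And>k. w k (f 1) (f 4) = r k" "\<And>k. w k (f 2) (f 3) = r k"
    and p: "p l \<noteq> 0" "q l = 0" "r l = 0"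
  shows "\<exists>h I J K. quaternionic h I J K \<and>
    (\<forall>k u v. w k u v = - h u (p k *\<^sub>R I v + q k *\<^sub>R J v + r k *\<^sub>R K v))"
proof -
  note bl = bilinear_simps[OF alternating2D(1)[OF w]]
  have sk: "w l (f 2) (f 1) = - p l" "w l (f 4) (f 3) = - p l" "w l (f 3) (f 1) = 0"
    "w l (f 4) (f 2) = 0" "w l (f 4) (f 1) = 0" "w l (f 3) (f 2) = 0"
    using f[of l] p alternating2D(3)[OF w, of l "f 2" "f 1"] alternating2D(3)[OF w, of l "f 4" "f 3"]
      alternating2D(3)[OF w, of l "f 3" "f 1"] alternating2D(3)[OF w, of l "f 4" "f 2"]
      alternating2D(3)[OF w, of l "f 4" "f 1"] alternating2D(3)[OF w, of l "f 3" "f 2"] by linarith+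
  have "c = (\<lambda>_. 0)" if c: "(\<Sum>a\<in>UNIV. c a *\<^sub>R f a) = 0" for c
  proof -
    have z: "w l (f b) (\<Sum>a\<in>UNIV. c a *\<^sub>R f a) = 0" for b unfolding c by (simp add: bl)
    have "c 1 = 0" "c 2 = 0" "c 3 = 0" "c 4 = 0"
      using z[of 1] z[of 2] z[of 3] z[of 4] p
      by (simp_all add: sum_4 bl f sk alternating2D(2)[OF w])
    then have "c a = 0" for a using exhaust_4[of a] by auto
    then show ?thesis by blast
  qed
  then obtain h where h: "inner_form h" "orthonormal_frame h f"
    using ex_inner_form_orthonormal_frame[OF dim] by blast
  from ex_quaternionic[OF h dim] obtain I J K where Q: "quaternionic h I J K"
    and rep: "\<And>w p q r u v. alternating2 w \<Longrightarrow> w (f 1) (f 2) = p \<Longrightarrow> w (f 3) (f 4) = p \<Longrightarrow>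
       w (f 1) (f 3) = q \<Longrightarrow> w (f 2) (f 4) = - q \<Longrightarrow> w (f 1) (f 4) = r \<Longrightarrow> w (f 2) (f 3) = r \<Longrightarrow>
       w u v = - h u (p *\<^sub>R I v + q *\<^sub>R J v + r *\<^sub>R K v)"
    by metis
  have "w k u v = - h u (p k *\<^sub>R I v + q k *\<^sub>R J v + r k *\<^sub>R K v)" for k u v
    by (rule rep[OF w f])
  then show ?thesis using Q by blast
qed

lemma dual_basis_3:
  fixes a :: "3 \<Rightarrow> real^3 \<Rightarrow> real"
  assumes a: "\<And>k. linear (a k)" and ne: "wedge12 (a 1) (wedge11 (a 2) (a 3)) u v w \<noteq> 0"
  shows "\<exists>X. (\<forall>j k. a j (X k) = (if j = k then 1 else 0)) \<and>
    (\<forall>u. u = a 1 u *\<^sub>R X 1 + a 2 u *\<^sub>R X 2 + a 3 u *\<^sub>R X (3::3))"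
proof -
  note lin = linear_add[OF a] linear_scale[OF a] linear_diff[OF a]
  define D where "D = wedge12 (a 1) (wedge11 (a 2) (a 3)) u v w"
  have D: "D \<noteq> 0" using ne by (simp add: D_def)
  \<comment> \<open>Cramer's rule: the \<open>c\<close> are the 2x2 minors of the matrix of
    \<open>a\<close> on \<open>u\<close>, \<open>v\<close>, \<open>w\<close>, divided by its
    determinant \<open>D\<close>, so that the \<open>Y\<close> are the columns of the
    inverse.\<close>
  define c where "c j k p q = (a j p * a k q - a j q * a k p) / D" for j k p q
  define Y where "Y j k = c j k v w *\<^sub>R u + c j k w u *\<^sub>R v + c j k u v *\<^sub>R w" for j k
  define X where "X = (\<lambda>k::3. if k = 1 then Y 2 3 else if k = 2 then Y 3 1 else Y 1 (2::3))"
  have aY: "a l (Y j k) = ((a j v * a k w - a j w * a k v) * a l u + (a j w * a k u - a j u * a k w) * a l v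
    + (a j u * a k v - a j v * a k u) * a l w) / D" for l j k
    by (simp add: Y_def lin c_def add_divide_distrib)
  have one: "a 1 (Y 2 3) = 1" "a 2 (Y 3 1) = 1" "a 3 (Y 1 2) = 1"
    unfolding aY using D by (simp_all add: D_def wedge12_def wedge11_def algebra_simps)
  have zero: "a j (Y j k) = 0" "a k (Y j k) = 0" for j k
    unfolding aY by (simp_all add: algebra_simps)
  have aX: "a j (X k) = (if j = k then 1 else 0)" for j k
    using exhaust_3[of j] exhaust_3[of k] one zero by (auto simp: X_def)
  \<comment> \<open>\<open>T\<close> collects the three forms into one map. It is onto by the dual
    vectors, hence injective, so a vector is determined by its three values.\<close>
  define T where "T v = (\<Sum>k\<in>UNIV. (a k v) *\<^sub>R axis k (1::real))" for v
  have T: "T v $ k = a k v" for v k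
    using exhaust_3[of k] by (auto simp: T_def sum_3 axis_def)
  have linT: "linear T" by (rule linearI) (simp_all add: vec_eq_iff T lin)
  have "surj T"
  proof (rule surjI)
    show "T (y $ 1 *\<^sub>R X 1 + y $ 2 *\<^sub>R X 2 + y $ 3 *\<^sub>R X 3) = y" for y
      using exhaust_3 by (simp add: vec_eq_iff T lin aX forall_3)
  qed
  then have "inj T" using linear_surjective_imp_injective[OF linT] by simp
  moreover have "T (a 1 u *\<^sub>R X 1 + a 2 u *\<^sub>R X 2 + a 3 u *\<^sub>R X 3) = T u" for u
    by (simp add: vec_eq_iff T lin aX forall_3)
  ultimately have "u = a 1 u *\<^sub>R X 1 + a 2 u *\<^sub>R X 2 + a 3 u *\<^sub>R X 3" for u
    by (metis injD)
  then show ?thesis using aX by blast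
qed

lemma wedge12_dual_basis:
  fixes a :: "3 \<Rightarrow> real^3 \<Rightarrow> real"
  assumes X: "\<And>j k. a j (X k) = (if j = k then 1 else 0)"
      "\<And>u. u = a 1 u *\<^sub>R X 1 + a 2 u *\<^sub>R X 2 + a 3 u *\<^sub>R X (3::3)"
    and d: "alternating2 d"
  shows "wedge12 (a j) d u v w =
    wedge12 (a j) d (X 1) (X 2) (X 3) * wedge12 (a 1) (wedge11 (a 2) (a 3)) u v w"
proof -
  note bl = bilinear_simps[OF alternating2D(1)[OF d]]
  define P Q R where PQR: "P = d (X 2) (X 3)" "Q = d (X 3) (X 1)" "R = d (X 1) (X 2)"
  have s: "d (X 3) (X 2) = - P" "d (X 1) (X 3) = - Q" "d (X 2) (X 1) = - R"
    unfolding PQR by (rule alternating2D(3)[OF d])+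
  have du: "d u v = P * (a 2 u * a 3 v - a 3 u * a 2 v) + Q * (a 3 u * a 1 v - a 1 u * a 3 v)
    + R * (a 1 u * a 2 v - a 2 u * a 1 v)" for u v
    by (subst X(2)[of u], subst X(2)[of v])
      (simp add: bl alternating2D(2)[OF d] s PQR[symmetric] algebra_simps)
  show ?thesis
    using exhaust_3[of j]
    by (elim disjE) (simp_all add: wedge12_def wedge11_def du X algebra_simps)
qed

lemma cholesky_3:
  fixes s11 s22 s33 s12 s13 s23 :: real
  assumes pos: "\<And>x y z. (x, y, z) \<noteq> (0, 0, 0) \<Longrightarrow>
    0 < s11 * x\<^sup>2 + s22 * y\<^sup>2 + s33 * z\<^sup>2 + 2 * s12 * x * y + 2 * s13 * x * z + 2 * s23 * y * z"
  obtains l11 l21 l31 l22 l32 l33 where "0 < l11" "0 < l22" "0 < l33"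
    "s11 = l11\<^sup>2" "s12 = l11 * l21" "s13 = l11 * l31" "s22 = l21\<^sup>2 + l22\<^sup>2"
    "s23 = l21 * l31 + l22 * l32" "s33 = l31\<^sup>2 + l32\<^sup>2 + l33\<^sup>2"
proof -
  have "s11 > 0" using pos[of 1 0 0] by simp
  define l11 where "l11 = sqrt s11"
  have l11: "0 < l11" "s11 = l11\<^sup>2" using \<open>s11 > 0\<close> by (auto simp: l11_def)
  define l21 where "l21 = s12 / l11"
  define l31 where "l31 = s13 / l11"
  have l1: "s12 = l11 * l21" "s13 = l11 * l31" using l11 by (auto simp: l21_def l31_def)
  \<comment> \<open>The test vector annihilates \<open>l11 x + l21 y\<close>, so the quadratic form
    there is the next pivot.\<close>
  have "0 < s22 - l21\<^sup>2"
    using pos[of "- l21 / l11" 1 0] l11(1) unfolding l1 l11(2) by (simp add: power2_eq_square field_simps)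
  define l22 where "l22 = sqrt (s22 - l21\<^sup>2)"
  have l22: "0 < l22" "s22 = l21\<^sup>2 + l22\<^sup>2" using \<open>0 < s22 - l21\<^sup>2\<close> by (auto simp: l22_def)
  define l32 where "l32 = (s23 - l21 * l31) / l22"
  have l32: "s23 = l21 * l31 + l22 * l32" using l22(1) by (auto simp: l32_def)
  \<comment> \<open>Back substitution: with \<open>z = 1\<close>, these \<open>x\<close> and
    \<open>y\<close> annihilate the first two squares, leaving the last pivot.\<close>
  define y where "y = - l32 / l22"
  define x where "x = - (l31 + l21 * y) / l11"
  have xy: "l22 * y + l32 = 0" "l11 * x + l21 * y + l31 = 0"
    using l11(1) l22(1) by (auto simp: x_def y_def)
  have "s11 * x\<^sup>2 + s22 * y\<^sup>2 + s33 * 1\<^sup>2 + 2 * s12 * x * y + 2 * s13 * x * 1 + 2 * s23 * y * 1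
    = (l11 * x + l21 * y + l31)\<^sup>2 + (l22 * y + l32)\<^sup>2 + (s33 - l31\<^sup>2 - l32\<^sup>2)"
    unfolding l11(2) l1 l22(2) l32 by (simp add: power2_eq_square algebra_simps)
  then have "0 < s33 - l31\<^sup>2 - l32\<^sup>2" using pos[of x y 1] by (simp add: xy)
  then show ?thesis
    using that[of l11 l22 "sqrt (s33 - l31\<^sup>2 - l32\<^sup>2)" l21 l31 l32] l11 l1 l22 l32 by simp
qed

text \<open>The frame \<open>f\<close> consists of a multiple of \<open>\<partial>\<^sub>t\<close> and of lifts of the basis \<open>\<Sum>\<^sub>j L\<^sub>j\<^sub>k X\<^sub>j\<close>, where
  \<open>L L\<^sup>T\<close> is the symmetric part of the matrix \<open>A\<close> of the \<open>\<alpha>\<^sub>j \<and> d\<alpha>\<^sub>k\<close>; the antisymmetric part of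
  \<open>A\<close> is absorbed by the \<open>\<partial>\<^sub>t\<close>-components \<open>y\<close> of the lifts.\<close>

lemma contact_triple_normal_form:
  fixes a :: "3 \<Rightarrow> real^3 \<Rightarrow> real" and w :: "3 \<Rightarrow> (real^3) \<times> real \<Rightarrow> (real^3) \<times> real \<Rightarrow> real"
  assumes a: "\<And>k. linear (a k)" and d: "\<And>k. alternating2 (d k)"
    and X: "\<And>j k. a j (X k) = (if j = k then 1 else 0)"
    and w: "\<And>k u s v t. w k (u, s) (v, t) = E * (s * a k v - t * a k u + d k u v)"
    and A: "\<And>j k. A j k = wedge12 (a k) (d j) (X 1) (X 2) (X 3)"
    and l: "0 < l11" "0 < l22" "0 < l33" "A 1 1 = l11\<^sup>2" "A 1 2 + A 2 1 = 2 * (l11 * l21)"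
      "A 1 3 + A 3 1 = 2 * (l11 * l31)" "A 2 2 = l21\<^sup>2 + l22\<^sup>2"
      "A 2 3 + A 3 2 = 2 * (l21 * l31 + l22 * l32)" "A 3 3 = l31\<^sup>2 + l32\<^sup>2 + l33\<^sup>2"
    and E: "0 < E"
    and p: "p 1 = l11" "p 2 = l21" "p 3 = l31" and q: "q 1 = 0" "q 2 = l22" "q 3 = l32"
    and r: "r 1 = 0" "r 2 = 0" "r (3::3) = l33"
  shows "\<exists>h I J K. quaternionic h I J K \<and>
    (\<forall>k u v. w k u v = - h u (p k *\<^sub>R I v + q k *\<^sub>R J v + r k *\<^sub>R K v))"
proof -
  have A': "A j 1 = d j (X 2) (X 3)" "A j 2 = - d j (X 1) (X 3)" "A j 3 = d j (X 1) (X 2)" for j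
    unfolding A wedge12_def X by simp_all
  have dX: "d j (X 2) (X 3) = A j 1" "d j (X 1) (X 3) = - A j 2" "d j (X 1) (X 2) = A j 3"
    "d j (X 3) (X 2) = - A j 1" "d j (X 3) (X 1) = A j 2" "d j (X 2) (X 1) = - A j 3" "d j x x = 0" for j x
    using A'[of j] alternating2D(3)[OF d, of j "X 3" "X 2"] alternating2D(3)[OF d, of j "X 3" "X 1"]
      alternating2D(3)[OF d, of j "X 2" "X 1"] alternating2D(2)[OF d, of j x]
    by linarith+
  \<comment> \<open>\<open>y1\<close>, \<open>y2\<close>, \<open>y3\<close> form the axial vector of
    the antisymmetric part of \<open>A\<close>. Lifting \<open>X j\<close> by \<open>y j\<close> in
    the direction of \<open>t\<close> adds multiples of \<open>a k\<close> to \<open>w k\<close>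
    that cancel this part.\<close>
  define y1 where "y1 = (A 3 2 - A 2 3) / 2"
  define y2 where "y2 = (A 1 3 - A 3 1) / 2"
  define y3 where "y3 = (A 2 1 - A 1 2) / 2"
  define Y1 where "Y1 = (l11 *\<^sub>R X 1 + l21 *\<^sub>R X 2 + l31 *\<^sub>R X 3, l11 * y1 + l21 * y2 + l31 * y3)"
  define Y2 where "Y2 = (l22 *\<^sub>R X 2 + l32 *\<^sub>R X 3, l22 * y2 + l32 * y3)"
  define Y3 where "Y3 = (l33 *\<^sub>R X 3, l33 * y3)"
  \<comment> \<open>\<open>m\<close> is the determinant of the triangular factor \<open>L\<close>.
    On two lifts, \<open>w k\<close> pairs a row of cofactors of \<open>L\<close> with the symmetric
    part \<open>L L\<^sup>T\<close>, which gives \<open>m\<close> times an entry of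
    \<open>L\<close>; the length \<open>m\<close> of \<open>f 1\<close> matches this in the pairs
    containing \<open>f 1\<close>.\<close>
  define m where "m = l11 * l22 * l33"
  define f :: "4 \<Rightarrow> (real^3) \<times> real"
    where "f = (\<lambda>a. if a = 1 then (0, m) else if a = 2 then Y1 else if a = 3 then Y2 else Y3)"
  have f: "f 1 = (0, m)" "f 2 = Y1" "f 3 = Y2" "f 4 = Y3" by (simp_all add: f_def)
  have m: "m > 0" using l by (simp add: m_def)
  note lin = linear_add[OF a] linear_scale[OF a] linear_0[OF a]
  note bl = bilinear_simps[OF alternating2D(1)[OF d]]
  have alt: "alternating2 (w k)" for k
    unfolding alternating2_def bilinear_def
    by (auto intro!: linearI simp: w lin bl dX algebra_simps)
  have A2: "A 2 1 = 2 * (l11 * l21) - A 1 2" "A 3 1 = 2 * (l11 * l31) - A 1 3"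
     "A 3 2 = 2 * (l21 * l31 + l22 * l32) - A 2 3" using l by auto
  have k: "k = 1 \<or> k = 2 \<or> k = 3" for k :: 3 using exhaust_3 by blast
  define P where "P k = E * m * p k" for k
  define Q where "Q k = E * m * q k" for k
  define R where "R k = E * m * r k" for k
  have 1: "w k (f 1) (f 2) = P k" "w k (f 1) (f 3) = Q k" "w k (f 1) (f 4) = R k" for k
    using k[of k] by (auto simp: f w Y1_def Y2_def Y3_def lin bl X P_def Q_def R_def p q r)
  have 2: "w k (f 3) (f 4) = P k" for k
    using k[of k] by (elim disjE) (simp_all add: f w Y1_def Y2_def Y3_def lin bl X P_def p dX l(4,7,9)
      y1_def y2_def y3_def A2 m_def power2_eq_square algebra_simps add_divide_distrib diff_divide_distrib)
  have 3: "w k (f 2) (f 4) = - Q k" for k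
    using k[of k] by (elim disjE) (simp_all add: f w Y1_def Y2_def Y3_def lin bl X Q_def q dX l(4,7,9)
      y1_def y2_def y3_def A2 m_def power2_eq_square algebra_simps add_divide_distrib diff_divide_distrib)
  have 4: "w k (f 2) (f 3) = R k" for k
    using k[of k] by (elim disjE) (simp_all add: f w Y1_def Y2_def Y3_def lin bl X R_def r dX l(4,7,9)
      y1_def y2_def y3_def A2 m_def power2_eq_square algebra_simps add_divide_distrib diff_divide_distrib)
  have "P 1 \<noteq> 0" "Q 1 = 0" "R 1 = 0" using E m l by (simp_all add: P_def Q_def R_def p q r)
  then obtain h I J K where hIJK: "quaternionic h I J K"
    "\<And>k u v. w k u v = - h u (P k *\<^sub>R I v + Q k *\<^sub>R J v + R k *\<^sub>R K v)"
    using standard_triple_quaternionic[of w f P Q R 1] alt 1 2 3 4 by auto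
  have "w k u v = - (E * m * h u (p k *\<^sub>R I v + q k *\<^sub>R J v + r k *\<^sub>R K v))" for k u v
    unfolding hIJK(2) P_def Q_def R_def
    by (simp add: bilinear_simps[OF inner_formD(1)[OF quaternionicD(1)[OF hIJK(1)]]] algebra_simps)
  moreover have "quaternionic (\<lambda>u v. E * m * h u v) I J K"
    using quaternionic_scale[OF hIJK(1)] E m by simp
  ultimately show ?thesis by blast
qed

text \<open>The contact condition says only that \<open>Q\<close> has no zero away from the origin.
  Since that complement is connected, the sign at one vector, supplied by the natural order, holds
  everywhere.\<close>

lemma nonvanishing_quadratic_form_pos:
  fixes Q :: "real^3 \<Rightarrow> real"
  assumes "continuous_on UNIV Q" "\<And>c. c \<noteq> 0 \<Longrightarrow> Q c \<noteq> 0" "b \<noteq> 0" "0 < Q b" "c \<noteq> 0"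
  shows "0 < Q c"
proof (rule ccontr)
  assume "\<not> 0 < Q c"
  have "connected (Q ` (- {0}))"
    by (intro connected_continuous_image continuous_on_subset[OF assms(1)] connected_punctured_universe) auto
  then have "0 \<in> Q ` (- {0})"
    using assms(3-5) \<open>\<not> 0 < Q c\<close> connectedD_interval[of "Q ` (- {0})" "Q c" "Q b" 0] by force
  then show False using assms(2) by force
qed

section \<open>Charts and smooth maps\<close>

lemma smooth_manifold_chart:
  assumes "smooth_manifold M" "i \<in> charts M"
  shows "open (chart_dom M i)" "open (chart_image M i)" "inj_on (chart_map M i) (chart_dom M i)"
    "continuous_on (chart_dom M i) (chart_map M i)" "continuous_on (chart_image M i) (chart_inv M i)"
    "x \<in> chart_image M i \<Longrightarrow> chart_inv M i x \<in> chart_dom M i"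
    "x \<in> chart_image M i \<Longrightarrow> chart_map M i (chart_inv M i x) = x"
    "p \<in> chart_dom M i \<Longrightarrow> chart_inv M i (chart_map M i p) = p"
    "p \<in> chart_dom M i \<Longrightarrow> chart_map M i p \<in> chart_image M i"
proof -
  have h: "homeomorphism (chart_dom M i) (chart_image M i) (chart_map M i) (chart_inv M i)"
    and o: "open (chart_dom M i)" "open (chart_image M i)"
    using assms by (auto simp: smooth_manifold_def)
  show "open (chart_dom M i)" "open (chart_image M i)" by (fact o)+
  show "continuous_on (chart_dom M i) (chart_map M i)" "continuous_on (chart_image M i) (chart_inv M i)"
    "x \<in> chart_image M i \<Longrightarrow> chart_inv M i x \<in> chart_dom M i"
    "x \<in> chart_image M i \<Longrightarrow> chart_map M i (chart_inv M i x) = x"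
    "p \<in> chart_dom M i \<Longrightarrow> chart_inv M i (chart_map M i p) = p"
    "p \<in> chart_dom M i \<Longrightarrow> chart_map M i p \<in> chart_image M i"
    using h by (auto simp: homeomorphism_def)
  show "inj_on (chart_map M i) (chart_dom M i)"
    using h by (auto simp: homeomorphism_def intro: inj_on_inverseI)
qed

lemma carrier_ofE:
  assumes "smooth_manifold M" "p \<in> carrier_of M"
  obtains i x where "in_chart M i x" "chart_inv M i x = p"
proof -
  obtain i where i: "i \<in> charts M" "p \<in> chart_dom M i" using assms(2) by (auto simp: carrier_of_def)
  then have "in_chart M i (chart_map M i p)"
    using smooth_manifold_chart[OF assms(1) i(1)] by (auto simp: in_chart_def)
  then show ?thesis using that smooth_manifold_chart(8)[OF assms(1) i] by blast
qed

lemma in_chart_carrier: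
  "smooth_manifold M \<Longrightarrow> in_chart M i x \<Longrightarrow> chart_inv M i x \<in> carrier_of M"
  using smooth_manifold_chart(6) by (fastforce simp: in_chart_def carrier_of_def)

abbreviation transition where "transition M i j \<equiv> local_rep M M id i j"

abbreviation overlap where "overlap M i j \<equiv> local_dom M M id i j"

abbreviation differential where
  "differential M N F i j x \<equiv> frechet_derivative (local_rep M N F i j) (at x)"

lemma local_rep_chart:
  assumes "smooth_manifold M" "smooth_manifold N" "i \<in> charts M" "j \<in> charts N" "x \<in> local_dom M N F i j"
  shows "in_chart M i x" "in_chart N j (local_rep M N F i j x)"
    "chart_inv N j (local_rep M N F i j x) = F (chart_inv M i x)"
  using assms smooth_manifold_chart[OF assms(2,4)]
  by (auto simp: in_chart_def local_rep_def local_dom_def)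

lemma open_local_dom:
  assumes "smooth_manifold M" "smooth_manifold N" "i \<in> charts M" "j \<in> charts N"
    "continuous_on (carrier_of M) F"
  shows "open (local_dom M N F i j)"
proof -
  have "continuous_on (chart_image M i) (\<lambda>x. F (chart_inv M i x))"
    by (rule continuous_on_compose2[OF assms(5) smooth_manifold_chart(5)[OF assms(1,3)]])
      (use smooth_manifold_chart(6)[OF assms(1,3)] assms(3) in \<open>auto simp: carrier_of_def\<close>)
  from continuous_open_preimage[OF this smooth_manifold_chart(2)[OF assms(1,3)] smooth_manifold_chart(1)[OF assms(2,4)]]
  show ?thesis by (simp add: local_dom_def vimage_def Int_def)
qed

lemma smooth_map_id: "smooth_manifold M \<Longrightarrow> smooth_map M M id"
  by (auto simp: smooth_map_def smooth_manifold_def)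

lemma smooth_map_local:
  assumes "smooth_manifold M" "smooth_manifold N" "smooth_map M N F" "i \<in> charts M" "j \<in> charts N"
  shows "open (local_dom M N F i j)" "smooth_on (local_dom M N F i j) (local_rep M N F i j)"
    "x \<in> local_dom M N F i j \<Longrightarrow> linear (differential M N F i j x)"
proof -
  show "open (local_dom M N F i j)" using open_local_dom assms by (auto simp: smooth_map_def)
  show s: "smooth_on (local_dom M N F i j) (local_rep M N F i j)" using assms by (auto simp: smooth_map_def)
  show "x \<in> local_dom M N F i j \<Longrightarrow> linear (differential M N F i j x)"
    using linear_frechet_derivative[OF smooth_on_differentiable[OF s]] .
qed

section \<open>The product with the real line and its fibrewise translations\<close>

lemma times_real_chart:
  assumes "smooth_manifold M"
  shows "charts (times_real M) = charts M" "chart_dom (times_real M) i = chart_dom M i \<times> UNIV"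
    "chart_map (times_real M) i (p, t) = (chart_map M i p, t)"
    "chart_image (times_real M) i = chart_image M i \<times> UNIV"
    "in_chart (times_real M) i (x, t) \<longleftrightarrow> in_chart M i x"
    "in_chart M i x \<Longrightarrow> chart_inv (times_real M) i (x, t) = (chart_inv M i x, t)"
    "carrier_of (times_real M) = carrier_of M \<times> UNIV"
proof -
  show c: "charts (times_real M) = charts M" "chart_dom (times_real M) i = chart_dom M i \<times> UNIV"
    "chart_map (times_real M) i (p, t) = (chart_map M i p, t)" for i p t
    by (simp_all add: times_real_def)
  show "chart_image (times_real M) i = chart_image M i \<times> UNIV"
    by (force simp: chart_image_def times_real_def)
  then show "in_chart (times_real M) i (x, t) \<longleftrightarrow> in_chart M i x"
    by (simp add: in_chart_def c)
  show "carrier_of (times_real M) = carrier_of M \<times> UNIV" by (auto simp: carrier_of_def c)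
  assume x: "in_chart M i x"
  note m = smooth_manifold_chart[OF assms, of i]
  have "inj_on (chart_map (times_real M) i) (chart_dom M i \<times> UNIV)"
    using m(3) x by (auto simp: inj_on_def c in_chart_def)
  then show "chart_inv (times_real M) i (x, t) = (chart_inv M i x, t)"
    unfolding chart_inv_def[of "times_real M"] c
    by (rule inv_into_f_eq) (use m(6,7) x in \<open>auto simp: c in_chart_def\<close>)
qed

text \<open>\<open>\<phi> = 0\<close> gives the transition maps of the product; a general
  \<open>\<phi>\<close> gives the translations relating conformally equivalent spheres.\<close>

lemma local_times_real:
  assumes M: "smooth_manifold M" and F: "\<And>p t. F (p, t) = (p, t + \<phi> p)" and i: "i \<in> charts M"
  shows "local_dom (times_real M) (times_real M) F i j = overlap M i j \<times> UNIV"
    "x \<in> overlap M i j \<Longrightarrow> local_rep (times_real M) (times_real M) F i j (x, t)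
      = (transition M i j x, t + \<phi> (chart_inv M i x))"
proof -
  have ic: "in_chart M i x \<longleftrightarrow> x \<in> chart_image M i" for x using i by (simp add: in_chart_def)
  note t = times_real_chart[OF M]
  have inv: "chart_inv (times_real M) i (x, t) = (chart_inv M i x, t)" if "x \<in> chart_image M i" for x t
    using t(6) that ic by blast
  show "local_dom (times_real M) (times_real M) F i j = overlap M i j \<times> UNIV"
    using inv by (auto simp: local_dom_def t F)
  show "local_rep (times_real M) (times_real M) F i j (x, t)
      = (transition M i j x, t + \<phi> (chart_inv M i x))" if "x \<in> overlap M i j"
    using that inv by (auto simp: local_rep_def local_dom_def t F)
qed

lemma smooth_on_Times_real:
  fixes S :: "'e::euclidean_space set"
  assumes "open S"
  shows "smooth_on (S \<times> (UNIV::real set)) fst" "smooth_on (S \<times> (UNIV::real set)) snd"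
    "smooth_on S f \<Longrightarrow> smooth_on (S \<times> (UNIV::real set)) (\<lambda>y. f (fst y))"
proof -
  have o: "open (S \<times> (UNIV::real set))" using assms by (simp add: open_Times)
  show f: "smooth_on (S \<times> (UNIV::real set)) fst" "smooth_on (S \<times> (UNIV::real set)) snd"
    using smooth_on_bounded_linear[OF o bounded_linear_fst smooth_on_id[OF o]]
      smooth_on_bounded_linear[OF o bounded_linear_snd smooth_on_id[OF o]] by simp_all
  show "smooth_on (S \<times> (UNIV::real set)) (\<lambda>y. f (fst y))" if "smooth_on S f"
    by (rule smooth_on_compose[OF o _ f(1) that]) auto
qed

lemma smooth_local_times_real:
  assumes M: "smooth_manifold M" and F: "\<And>p t. F (p, t) = (p, t + \<phi> p)" and \<phi>: "smooth_function M \<phi>"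
    and ij: "i \<in> charts M" "j \<in> charts M"
  shows "smooth_on (local_dom (times_real M) (times_real M) F i j) (local_rep (times_real M) (times_real M) F i j)"
    "x \<in> overlap M i j \<Longrightarrow> differential (times_real M) (times_real M) F i j (x, t) (u, s)
      = (differential M M id i j x u, s + frechet_derivative (\<lambda>x. \<phi> (chart_inv M i x)) (at x) u)"
proof -
  note lt = local_times_real[where F = F and \<phi> = \<phi>, OF M F ij(1)]
  let ?D = "overlap M i j"
  note L = smooth_map_local[OF M M smooth_map_id[OF M] ij]
  have o: "open (?D \<times> (UNIV :: real set))" using L(1) by (simp add: open_Times)
  have s\<phi>: "smooth_on ?D (\<lambda>x. \<phi> (chart_inv M i x))"
    by (rule smooth_on_subset[where S = "chart_image M i"]) (use \<phi> ij in \<open>auto simp: smooth_function_def local_dom_def\<close>)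
  define R where "R = (\<lambda>y. (transition M i j (fst y), snd y + \<phi> (chart_inv M i (fst y))))"
  have R: "local_rep (times_real M) (times_real M) F i j y = R y" if "y \<in> ?D \<times> UNIV" for y
    using that lt(2) by (auto simp: R_def)
  have "smooth_on (?D \<times> (UNIV :: real set)) R"
    unfolding R_def
    by (intro smooth_on_Pair o smooth_on_add smooth_on_Times_real L s\<phi>)
  then show "smooth_on (local_dom (times_real M) (times_real M) F i j) (local_rep (times_real M) (times_real M) F i j)"
    unfolding lt(1) by (rule smooth_on_cong[OF o, rotated]) (simp add: R)
  assume x: "x \<in> ?D"
  have 1: "((\<lambda>y. transition M i j (fst y)) has_derivative (\<lambda>v. differential M M id i j x (fst v))) (at (x, t))"
    by (rule has_derivative_compose[where f = fst, OF has_derivative_fst[OF has_derivative_ident]])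
      (simp only: fst_conv, rule smooth_on_has_derivative[OF L(2) x])
  have 2: "((\<lambda>y. \<phi> (chart_inv M i (fst y))) has_derivative (\<lambda>v. frechet_derivative (\<lambda>x. \<phi> (chart_inv M i x)) (at x) (fst v))) (at (x, t))"
    by (rule has_derivative_compose[where f = fst and g = "\<lambda>x. \<phi> (chart_inv M i x)", OF has_derivative_fst[OF has_derivative_ident]])
      (simp only: fst_conv, rule smooth_on_has_derivative[OF s\<phi> x])
  have "(R has_derivative (\<lambda>v. (differential M M id i j x (fst v),
      snd v + frechet_derivative (\<lambda>x. \<phi> (chart_inv M i x)) (at x) (fst v)))) (at (x, t))"
    unfolding R_def
    by (rule has_derivative_Pair[OF 1 has_derivative_add[OF has_derivative_snd[OF has_derivative_ident] 2]])
  then have "(local_rep (times_real M) (times_real M) F i j has_derivative (\<lambda>v. (differential M M id i j x (fst v),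
      snd v + frechet_derivative (\<lambda>x. \<phi> (chart_inv M i x)) (at x) (fst v)))) (at (x, t))"
    by (rule has_derivative_transform_within_open[OF _ o]) (use x in \<open>auto simp: R\<close>)
  from fun_cong[OF frechet_derivative_at[OF this], of "(u, s)"]
  show "differential (times_real M) (times_real M) F i j (x, t) (u, s)
      = (differential M M id i j x u, s + frechet_derivative (\<lambda>x. \<phi> (chart_inv M i x)) (at x) u)"
    by simp
qed

lemma smooth_function_continuous:
  assumes M: "smooth_manifold M" and "smooth_function M \<phi>"
  shows "continuous_on (carrier_of M) \<phi>"
  unfolding carrier_of_def
proof (rule continuous_on_open_UN)
  fix i assume i: "i \<in> charts M"
  note m = smooth_manifold_chart[OF M i]
  show "open (chart_dom M i)" by (rule m(1))
  have "continuous_on (chart_image M i) (\<lambda>x. \<phi> (chart_inv M i x))"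
    using assms(2) i smooth_on_continuous_on by (auto simp: smooth_function_def)
  from continuous_on_compose2[OF this m(4)]
  have "continuous_on (chart_dom M i) (\<lambda>p. \<phi> (chart_inv M i (chart_map M i p)))" using m(9) by auto
  then show "continuous_on (chart_dom M i) \<phi>"
    by (rule continuous_on_cong[THEN iffD1, rotated 2]) (simp_all add: m(8))
qed

lemma smooth_manifold_times_real:
  assumes M: "smooth_manifold M" shows "smooth_manifold (times_real M)"
  unfolding smooth_manifold_def
proof (intro conjI ballI)
  note t = times_real_chart[OF M]
  fix i assume i: "i \<in> charts (times_real M)"
  then have i': "i \<in> charts M" by (simp add: t)
  note m = smooth_manifold_chart[OF M i']
  show "open (chart_dom (times_real M) i)" "open (chart_image (times_real M) i)"
    unfolding t using m(1,2) by (auto intro: open_Times)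
  have inv: "chart_inv (times_real M) i y = (chart_inv M i (fst y), snd y)" if "y \<in> chart_image M i \<times> UNIV" for y
    using that t(6)[of i] i' by (auto simp: in_chart_def)
  have mp: "chart_map (times_real M) i y = (chart_map M i (fst y), snd y)" for y
    using t(3)[of i "fst y" "snd y"] by simp
  show "homeomorphism (chart_dom (times_real M) i) (chart_image (times_real M) i)
        (chart_map (times_real M) i) (chart_inv (times_real M) i)"
    unfolding t
  proof (rule homeomorphismI)
    show "continuous_on (chart_dom M i \<times> UNIV) (chart_map (times_real M) i)"
      unfolding mp by (intro continuous_on_Pair continuous_on_compose2[OF m(4)] continuous_on_fst continuous_on_snd continuous_on_id) auto
    have "continuous_on (chart_image M i \<times> UNIV) (\<lambda>y. (chart_inv M i (fst y), snd y))"
      by (intro continuous_on_Pair continuous_on_compose2[OF m(5)] continuous_on_fst continuous_on_snd continuous_on_id) auto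
    then show "continuous_on (chart_image M i \<times> UNIV) (chart_inv (times_real M) i)"
      by (rule continuous_on_cong[THEN iffD1, rotated 2]) (simp_all add: inv)
  qed (use m inv in \<open>auto simp: mp\<close>)
next
  note t = times_real_chart[OF M]
  fix i j assume ij: "i \<in> charts (times_real M)" "j \<in> charts (times_real M)"
  show "smooth_on (local_dom (times_real M) (times_real M) id i j) (local_rep (times_real M) (times_real M) id i j)"
    by (rule smooth_local_times_real(1)[where \<phi> = "\<lambda>_. 0", OF M])
      (use ij in \<open>auto simp: t smooth_function_def smooth_on_const\<close>)
next
  show "connected (carrier_of (times_real M))"
    unfolding times_real_chart(7)[OF M] using M by (auto simp: smooth_manifold_def intro: connected_Times)
qed

lemma smooth_map_translation:
  assumes M: "smooth_manifold M" and F: "\<And>p t. F (p, t) = (p, t + \<phi> p)" and \<phi>: "smooth_function M \<phi>"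
  shows "smooth_map (times_real M) (times_real M) F"
  unfolding smooth_map_def
proof (intro conjI ballI)
  note t = times_real_chart[OF M]
  have F': "F y = (fst y, snd y + \<phi> (fst y))" for y using F[of "fst y" "snd y"] by simp
  show "F ` carrier_of (times_real M) \<subseteq> carrier_of (times_real M)" by (auto simp: t F)
  show "continuous_on (carrier_of (times_real M)) F"
    unfolding F' t
    by (intro continuous_on_Pair continuous_on_add continuous_on_compose2[OF smooth_function_continuous[OF M \<phi>]]
      continuous_on_fst continuous_on_snd continuous_on_id) auto
  fix i j assume "i \<in> charts (times_real M)" "j \<in> charts (times_real M)"
  then show "smooth_on (local_dom (times_real M) (times_real M) F i j) (local_rep (times_real M) (times_real M) F i j)"
    using smooth_local_times_real(1)[where F = F and \<phi> = \<phi>, OF M F \<phi>] by (simp add: t)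
qed

lemma smooth_function_minus:
  assumes "smooth_manifold M" "smooth_function M \<phi>" shows "smooth_function M (\<lambda>p. - \<phi> p)"
  unfolding smooth_function_def
proof
  fix i assume i: "i \<in> charts M"
  show "smooth_on (chart_image M i) (\<lambda>x. - \<phi> (chart_inv M i x))"
    by (rule smooth_on_minus[OF smooth_manifold_chart(2)[OF assms(1) i]])
      (use assms(2) i in \<open>simp add: smooth_function_def\<close>)
qed

lemma diffeomorphism_translation:
  assumes M: "smooth_manifold M" and F: "\<And>p t. F (p, t) = (p, t + \<phi> p)" and \<phi>: "smooth_function M \<phi>"
  shows "diffeomorphism (times_real M) (times_real M) F"
  unfolding diffeomorphism_def
proof (intro conjI)
  note t = times_real_chart[OF M]
  show "smooth_map (times_real M) (times_real M) F" by (rule smooth_map_translation[OF M F \<phi>])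
  let ?C = "carrier_of (times_real M)"
  define G where "G = (\<lambda>(p, t). (p, t + - \<phi> p))"
  have G: "smooth_map (times_real M) (times_real M) G"
    by (rule smooth_map_translation[OF M _ smooth_function_minus[OF M \<phi>]]) (simp add: G_def)
  show b: "bij_betw F ?C ?C"
    by (rule bij_betwI[of _ _ _ G]) (auto simp: t F G_def)
  \<comment> \<open>\<open>inv_into\<close> is tied to the explicit inverse \<open>G\<close> only on
    the carrier, so smoothness is carried over chart by chart.\<close>
  have e: "inv_into ?C F y = G y" if "y \<in> ?C" for y
    using that b by (intro inv_into_f_eq) (auto simp: t F G_def bij_betw_def)
  note M' = smooth_manifold_times_real[OF M]
  note c = in_chart_carrier[OF M']
  show "smooth_map (times_real M) (times_real M) (inv_into ?C F)"
    unfolding smooth_map_def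
  proof (intro conjI ballI)
    show "inv_into ?C F ` ?C \<subseteq> ?C" using e by (auto simp: t G_def)
    show "continuous_on ?C (inv_into ?C F)"
      using G e by (auto simp: smooth_map_def cong: continuous_on_cong)
    fix i j assume ij: "i \<in> charts (times_real M)" "j \<in> charts (times_real M)"
    have e': "inv_into ?C F (chart_inv (times_real M) i y) = G (chart_inv (times_real M) i y)"
      if "y \<in> chart_image (times_real M) i" for y
      by (rule e, rule c) (use that ij in \<open>simp add: in_chart_def\<close>)
    have d: "local_dom (times_real M) (times_real M) (inv_into ?C F) i j = local_dom (times_real M) (times_real M) G i j"
      unfolding local_dom_def by (intro Collect_cong conj_cong refl) (simp only: e')
    have "smooth_on (local_dom (times_real M) (times_real M) G i j) (local_rep (times_real M) (times_real M) G i j)"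
      using G ij by (auto simp: smooth_map_def)
    then show "smooth_on (local_dom (times_real M) (times_real M) (inv_into ?C F) i j) (local_rep (times_real M) (times_real M) (inv_into ?C F) i j)"
      unfolding d
    proof (rule smooth_on_cong[OF smooth_map_local(1)[OF M' M' G ij], rotated])
      show "local_rep (times_real M) (times_real M) G i j y = local_rep (times_real M) (times_real M) (inv_into ?C F) i j y"
        if "y \<in> local_dom (times_real M) (times_real M) G i j" for y
        using that unfolding local_rep_def by (subst e') (auto simp only: local_dom_def mem_Collect_eq)
    qed
  qed
qed

section \<open>Naturality of the exterior derivative\<close>

lemma one_form_derivative:
  assumes M: "smooth_manifold M" and T: "one_form M T" and i: "in_chart M i x"
  shows "((\<lambda>y. T i y v) has_derivative frechet_derivative (\<lambda>y. T i y v) (at x)) (at x)"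
    and "linear (\<lambda>v. frechet_derivative (\<lambda>y. T i y v) (at x) u)"
proof -
  have i': "i \<in> charts M" "x \<in> chart_image M i" using i by (auto simp: in_chart_def)
  have sm: "smooth_on (chart_image M i) (\<lambda>y. T i y v)" for v using T i' by (auto simp: one_form_def)
  show h: "((\<lambda>y. T i y v) has_derivative frechet_derivative (\<lambda>y. T i y v) (at x)) (at x)" for v
    by (rule smooth_on_has_derivative[OF sm i'(2)])
  have lin: "linear (T i y)" if "y \<in> chart_image M i" for y
    using T i' that by (auto simp: one_form_def in_chart_def)
  show "linear (\<lambda>v. frechet_derivative (\<lambda>y. T i y v) (at x) u)"
    by (rule has_derivative_linear_family(2)[OF smooth_manifold_chart(2)[OF M i'(1)] i'(2) lin h has_derivative_ident])
qed

lemma ext_deriv_pullback: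
  assumes M: "smooth_manifold M" and N: "smooth_manifold N" and F: "smooth_map M N F"
    and T: "one_form N T" and pb: "pullback1 M N F T S"
  shows "pullback2 M N F (ext_deriv N T) (ext_deriv M S)"
  unfolding pullback2_def Let_def
proof (intro ballI allI)
  fix i j x u v assume ij: "i \<in> charts M" "j \<in> charts N" and x: "x \<in> local_dom M N F i j"
  let ?W = "local_dom M N F i j" and ?f = "local_rep M N F i j"
  let ?D = "\<lambda>y. frechet_derivative ?f (at y)"
  note L = smooth_map_local[OF M N F ij]
  note c = local_rep_chart[OF M N ij]
  let ?DT = "\<lambda>z. frechet_derivative (\<lambda>y. T j y z) (at (?f x))"
  have fx: "(?f has_derivative ?D x) (at x)" by (rule smooth_on_has_derivative[OF L(2) x])
  \<comment> \<open>Besides the derivative of \<open>T\<close>, the product rule yields a term with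
    the second derivative of the coordinate map. It is symmetric in the two directions and drops out
    of \<open>ext_deriv\<close>.\<close>
  have der: "((\<lambda>y. S i y v) has_derivative (\<lambda>u. ?DT (?D x v) (?D x u)
      + T j (?f x) (frechet_derivative (\<lambda>y. ?D y v) (at x) u))) (at x)" for v
  proof -
    have A: "((\<lambda>y. T j (?f y) z) has_derivative (\<lambda>u. ?DT z (?D x u))) (at x)" for z
      by (rule has_derivative_compose[OF fx one_form_derivative(1)[OF N T c(2)[OF x]]])
    have lin: "linear (T j (?f y))" if "y \<in> ?W" for y
      using T c(2)[OF that] by (auto simp: one_form_def)
    have d: "((\<lambda>y. ?D y v) has_derivative frechet_derivative (\<lambda>y. ?D y v) (at x)) (at x)"
      by (rule smooth_on_has_derivative[OF smooth_on_frechet_derivative[OF L(2)] x])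
    have "((\<lambda>y. T j (?f y) (?D y v)) has_derivative (\<lambda>u. ?DT (?D x v) (?D x u)
      + T j (?f x) (frechet_derivative (\<lambda>y. ?D y v) (at x) u))) (at x)"
      by (rule has_derivative_linear_family(1)[where A = "\<lambda>y. T j (?f y)" and f = "\<lambda>y. ?D y v", OF L(1) x lin A d])
    then show ?thesis
      by (rule has_derivative_transform_within_open[OF _ L(1) x])
        (use pb ij in \<open>auto simp: pullback1_def Let_def\<close>)
  qed
  show "ext_deriv M S i x u v = ext_deriv N T j (?f x) (?D x u) (?D x v)"
    using c(1,2)[OF x] frechet_derivative_commute[OF L(1) x L(2), of u v]
    by (simp add: ext_deriv_def frechet_derivative_at[OF der, symmetric])
qed

lemma tensor_field2_ext_deriv:
  assumes M: "smooth_manifold M" and T: "one_form M T"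
  shows "tensor_field2 M (ext_deriv M T)" and "in_chart M i x \<Longrightarrow> alternating2 (ext_deriv M T i x)"
proof -
  have l: "linear (\<lambda>u. frechet_derivative (\<lambda>y. T i y v) (at x) u)" "linear (\<lambda>v. frechet_derivative (\<lambda>y. T i y v) (at x) u)"
    if "in_chart M i x" for i x u v
    using has_derivative_linear[OF one_form_derivative(1)[OF M T that]] one_form_derivative(2)[OF M T that]
    by blast+
  have bil: "bilinear (ext_deriv M T i x)" if "in_chart M i x" for i x
    using that unfolding bilinear_def
    by (auto intro!: linearI simp: ext_deriv_def linear_add[OF l(1)[OF that]] linear_add[OF l(2)[OF that]]
      linear_scale[OF l(1)[OF that]] linear_scale[OF l(2)[OF that]] algebra_simps)
  then show "alternating2 (ext_deriv M T i x)" if "in_chart M i x"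
    using that by (auto simp: alternating2_def ext_deriv_def)
  show "tensor_field2 M (ext_deriv M T)"
    unfolding tensor_field2_def
  proof (intro conjI allI impI ballI bil)
    show "ext_deriv M T i x = (\<lambda>_ _. 0)" if "\<not> in_chart M i x" for i x
      using that by (simp add: ext_deriv_def fun_eq_iff)
    show "pullback2 M M id (ext_deriv M T) (ext_deriv M T)"
      by (rule ext_deriv_pullback[OF M M smooth_map_id[OF M] T]) (use T in \<open>simp add: one_form_def\<close>)
    fix i u v assume i: "i \<in> charts M"
    have sm: "smooth_on (chart_image M i) (\<lambda>y. T i y v)" for v using T i by (auto simp: one_form_def)
    note o = smooth_manifold_chart(2)[OF M i]
    have "smooth_on (chart_image M i) (\<lambda>x. frechet_derivative (\<lambda>y. T i y v) (at x) u - frechet_derivative (\<lambda>y. T i y u) (at x) v)"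
      by (intro smooth_on_diff o smooth_on_frechet_derivative sm)
    then show "smooth_on (chart_image M i) (\<lambda>x. ext_deriv M T i x u v)"
      by (rule smooth_on_cong[OF o, rotated]) (use i in \<open>auto simp: ext_deriv_def in_chart_def\<close>)
  qed
qed

text \<open>Shifting \<open>t\<close> by \<open>\<phi>\<close> multiplies the exponential by
  \<open>exp \<phi>\<close>, a factor that can be moved to the form on \<open>M\<close>. The case
  \<open>\<phi> = 0\<close> is the transformation law under changes of charts.\<close>

lemma exp_form_pullback:
  fixes M :: "('i, 'a::{t2_space, second_countable_topology}, 'e::euclidean_space) atlas"
  assumes M: "smooth_manifold M" and F: "\<And>p t. F (p, t) = (p, t + \<phi> p)" and \<phi>: "smooth_function M \<phi>"
    and T: "one_form M T"
    and S: "\<And>i x v. in_chart M i x \<Longrightarrow> S i x v = exp (\<phi> (chart_inv M i x)) * T i x v"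
  shows "pullback1 (times_real M) (times_real M) F (exp_form T) (exp_form S)"
  unfolding pullback1_def Let_def
proof (intro ballI allI)
  note t = times_real_chart[OF M]
  fix i j and y v :: "'e \<times> real" assume ij: "i \<in> charts (times_real M)" "j \<in> charts (times_real M)"
    and y: "y \<in> local_dom (times_real M) (times_real M) F i j"
  have ij': "i \<in> charts M" "j \<in> charts M" using ij by (auto simp: t)
  note lt = local_times_real[where F = F and \<phi> = \<phi>, OF M F ij'(1)]
  obtain x s u r where xy: "y = (x, s)" "v = (u, r)" by (metis surj_pair)
  then have x: "x \<in> overlap M i j" using y by (simp add: lt)
  then have ic: "in_chart M i x" using ij' by (auto simp: local_dom_def in_chart_def)
  have "T i x u = T j (transition M i j x) (differential M M id i j x u)"
    using T x ij' by (auto simp: one_form_def pullback1_def Let_def)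
  then show "exp_form S i y v = exp_form T j (local_rep (times_real M) (times_real M) F i j y)
     (differential (times_real M) (times_real M) F i j y v)"
    unfolding xy smooth_local_times_real(2)[where F = F and \<phi> = \<phi>, OF M F \<phi> ij' x] lt(2)[OF x]
    by (simp add: exp_form_def S[OF ic] exp_add)
qed

lemma one_form_exp_form:
  assumes M: "smooth_manifold M" and T: "one_form M T"
  shows "one_form (times_real M) (exp_form T)"
  unfolding one_form_def
proof (intro conjI allI impI ballI)
  note t = times_real_chart[OF M]
  show "exp_form T i x = (\<lambda>_. 0)" if "\<not> in_chart (times_real M) i x" for i x
    using that T by (cases x) (auto simp: t exp_form_def one_form_def fun_eq_iff)
  show "linear (exp_form T i x)" if "in_chart (times_real M) i x" for i x
  proof -
    have "linear (T i (fst x))" using that T t(5)[of i "fst x" "snd x"] by (auto simp: one_form_def)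
    then show ?thesis by (cases x) (auto intro!: linearI simp: exp_form_def linear_add linear_scale algebra_simps)
  qed
  show "smooth_on (chart_image (times_real M) i) (\<lambda>x. exp_form T i x v)" if "i \<in> charts (times_real M)" for i v
  proof -
    have i: "i \<in> charts M" using that by (simp add: t)
    note o = smooth_manifold_chart(2)[OF M i]
    have o': "open (chart_image M i \<times> (UNIV::real set))" using o by (simp add: open_Times)
    have "smooth_on (chart_image M i) (\<lambda>x. T i x (fst v))" using T i by (auto simp: one_form_def)
    then have "smooth_on (chart_image M i \<times> UNIV) (\<lambda>y. exp (snd y) * T i (fst y) (fst v))"
      by (intro smooth_on_mult o' smooth_on_Times_real(3)[OF o]
        smooth_on_compose[OF o' _ smooth_on_Times_real(2)[OF o] smooth_on_exp]) auto
    then show ?thesis by (simp add: t exp_form_def case_prod_unfold)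
  qed
  show "pullback1 (times_real M) (times_real M) id (exp_form T) (exp_form T)"
    by (rule exp_form_pullback[where \<phi> = "\<lambda>_. 0", OF M _ _ T]) (auto simp: smooth_function_def smooth_on_const)
qed

lemma Omega_eq:
  assumes M: "smooth_manifold M" and T: "one_form M (\<alpha> k)" and i: "in_chart M i x"
  shows "Omega M \<alpha> k i (x, t) (u, s) (v, r)
    = exp t * (s * \<alpha> k i x v - r * \<alpha> k i x u + ext_deriv M (\<alpha> k) i x u v)"
proof -
  note t = times_real_chart[OF M]
  let ?D = "\<lambda>v. frechet_derivative (\<lambda>y. \<alpha> k i y v) (at x)"
  have der: "((\<lambda>y. exp_form (\<alpha> k) i y (v, r)) has_derivative
      (\<lambda>w. exp t * (snd w * \<alpha> k i x v + ?D v (fst w)))) (at (x, t))" for v r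
  proof -
    have 1: "((\<lambda>y. \<alpha> k i (fst y) v) has_derivative (\<lambda>w. ?D v (fst w))) (at (x, t))"
      by (rule has_derivative_compose[where f = fst and g = "\<lambda>x. \<alpha> k i x v", OF has_derivative_fst[OF has_derivative_ident]])
        (simp only: fst_conv, rule one_form_derivative(1)[OF M T i])
    have 2: "((\<lambda>y. exp (snd y)) has_derivative (\<lambda>w. snd w * exp t)) (at (x, t))"
      by (auto intro!: derivative_eq_intros simp: mult.commute)
    show ?thesis
      by (rule has_derivative_eq_rhs[OF has_derivative_transform_within_open[OF has_derivative_mult[OF 2 1] open_UNIV]])
        (auto simp: exp_form_def fun_eq_iff algebra_simps)
  qed
  show ?thesis
    using i by (simp add: Omega_def ext_deriv_def t frechet_derivative_at[OF der, symmetric] algebra_simps)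
qed

section \<open>Contact spheres at a point\<close>

lemma contact_volume_lin_comb:
  assumes M: "smooth_manifold U" and \<alpha>: "\<And>k. one_form U (\<alpha> k)" and i: "in_chart U i x"
  shows "contact_volume U (lin_comb c \<alpha>) i x u v w =
    (\<Sum>j\<in>UNIV. \<Sum>k\<in>UNIV. c $ j * c $ k * wedge12 (\<alpha> j i x) (ext_deriv U (\<alpha> k) i x) u v w)"
proof -
  have h: "((\<lambda>y. \<Sum>k\<in>UNIV. c $ k * \<alpha> k i y v) has_derivative
      (\<lambda>u. \<Sum>k\<in>UNIV. c $ k * frechet_derivative (\<lambda>y. \<alpha> k i y v) (at x) u)) (at x)" for v
    by (intro has_derivative_sum has_derivative_mult_right one_form_derivative(1)[OF M \<alpha> i])
  have "frechet_derivative (\<lambda>y. \<Sum>k\<in>UNIV. c $ k * \<alpha> k i y v) (at x) u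
      = (\<Sum>k\<in>UNIV. c $ k * frechet_derivative (\<lambda>y. \<alpha> k i y v) (at x) u)" for u v
    using fun_cong[OF frechet_derivative_at[OF h[of v]], of u] by simp
  then have "ext_deriv U (lin_comb c \<alpha>) i x u v = (\<Sum>k\<in>UNIV. c $ k * ext_deriv U (\<alpha> k) i x u v)" for u v
    using i by (simp add: ext_deriv_def lin_comb_def sum_subtractf right_diff_distrib)
  then show ?thesis
    unfolding contact_volume_def wedge12_def by (simp add: lin_comb_def sum_3 algebra_simps)
qed

lemma contact_sphere_normal_form:
  assumes M: "smooth_manifold U" and cs: "contact_sphere U \<alpha>" and no: "naturally_ordered U \<alpha>"
    and i: "in_chart U i x"
  shows "\<exists>h I J K p q r. quaternionic h I J K \<and>
      (\<forall>k u v. Omega U \<alpha> k i (x, t) u v = - h u (p k *\<^sub>R I v + q k *\<^sub>R J v + r k *\<^sub>R K v)) \<and>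
      0 < p 1 \<and> q 1 = 0 \<and> r 1 = 0 \<and> 0 < q 2 \<and> r 2 = 0 \<and> 0 < r 3" (is ?general)
    and "taut U \<alpha> \<Longrightarrow> \<exists>h I J K. quaternionic h I J K \<and> (\<forall>u v. Omega U \<alpha> 1 i (x, t) u v = - h u (I v) \<and>
      Omega U \<alpha> 2 i (x, t) u v = - h u (J v) \<and> Omega U \<alpha> 3 i (x, t) u v = - h u (K v))"
proof -
  define a where "a k = \<alpha> k i x" for k
  define d where "d k = ext_deriv U (\<alpha> k) i x" for k
  define vol where "vol = wedge12 (a 1) (wedge11 (a 2) (a 3))"
  have \<alpha>: "one_form U (\<alpha> k)" for k using cs by (simp add: contact_sphere_def)
  have a: "linear (a k)" for k using \<alpha> i by (auto simp: one_form_def a_def)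
  have d: "alternating2 (d k)" for k using tensor_field2_ext_deriv(2)[OF M \<alpha> i] by (simp add: d_def)
  note cv = contact_volume_lin_comb[where \<alpha> = \<alpha>, OF M \<alpha> i, folded a_def d_def]
  have nat: "\<exists>r>0. \<forall>u v w. wedge12 (a k) (d k) u v w = r * vol u v w" for k
    using no i unfolding naturally_ordered_def vol_def a_def d_def contact_volume_def by blast
  have ne: "\<exists>u v w. contact_volume U (lin_comb c \<alpha>) i x u v w \<noteq> 0" if "c \<noteq> 0" for c
    using cs that i unfolding contact_sphere_def contact_form_def by blast
  obtain u v w where "contact_volume U (lin_comb (axis 1 1) \<alpha>) i x u v w \<noteq> 0"
    using ne[of "axis 1 1"] by (auto simp: axis_eq_0_iff)
  then have "wedge12 (a 1) (d 1) u v w \<noteq> 0" by (simp add: cv sum_3 axis_def)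
  then have "vol u v w \<noteq> 0" using nat[of 1] by auto
  from dual_basis_3[OF a this[unfolded vol_def]] obtain X
    where X': "(\<forall>j k. a j (X k) = (if j = k then 1 else 0)) \<and>
      (\<forall>u. u = a 1 u *\<^sub>R X 1 + a 2 u *\<^sub>R X 2 + a 3 u *\<^sub>R X 3)" ..
  note X = X'[THEN conjunct1, rule_format] X'[THEN conjunct2, rule_format]
  define A where "A j k = wedge12 (a k) (d j) (X 1) (X 2) (X 3)" for j k
  have wedge: "wedge12 (a j) (d k) u v w = A k j * vol u v w" for j k u v w
    unfolding A_def vol_def by (rule wedge12_dual_basis[OF X d])
  have volX: "vol (X 1) (X 2) (X 3) = 1" by (simp add: vol_def wedge12_def wedge11_def X)
  have A_pos: "0 < A k k" for k
  proof -
    obtain r where "r > 0" "wedge12 (a k) (d k) (X 1) (X 2) (X 3) = r * vol (X 1) (X 2) (X 3)"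
      using nat[of k] by blast
    then show ?thesis using volX by (simp add: A_def)
  qed
  \<comment> \<open>The antisymmetric part of \<open>A\<close> cancels in \<open>Q\<close>, so
    contact and tautness conditions constrain the symmetric part only.\<close>
  define Q where "Q c = (\<Sum>j\<in>UNIV. \<Sum>k\<in>UNIV. c $ j * c $ k * A k j)" for c :: "real^3"
  have Q: "contact_volume U (lin_comb c \<alpha>) i x u v w = Q c * vol u v w" for c u v w
    by (simp add: cv wedge Q_def sum_3 algebra_simps)
  have Q_ne: "Q c \<noteq> 0" if "c \<noteq> 0" for c using ne[OF that] by (auto simp: Q)
  have Q_axis: "Q (axis 1 1) = A 1 1" "Q (axis 2 1) = A 2 2" "Q (axis 3 1) = A 3 3"
    by (simp_all add: Q_def sum_3 axis_def)
  have Q_cont: "continuous_on UNIV Q"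
    unfolding Q_def by (intro continuous_intros)
  have Q_pos: "0 < Q c" if "c \<noteq> 0" for c
    using nonvanishing_quadratic_form_pos[OF Q_cont Q_ne, of "axis 1 1" c] that Q_axis A_pos
    by (simp add: axis_eq_0_iff)
  define V where "V x y z = (\<chi> k::3. if k = 1 then x else if k = 2 then y else z)" for x y z :: real
  have V: "V x y z $ 1 = x" "V x y z $ 2 = y" "V x y z $ 3 = z" for x y z by (simp_all add: V_def)
  have QV: "Q (V x y z) = A 1 1 * x\<^sup>2 + A 2 2 * y\<^sup>2 + A 3 3 * z\<^sup>2 + 2 * ((A 1 2 + A 2 1) / 2) * x * y
    + 2 * ((A 1 3 + A 3 1) / 2) * x * z + 2 * ((A 2 3 + A 3 2) / 2) * y * z" for x y z
    by (simp add: Q_def sum_3 V power2_eq_square field_simps)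
  have Om: "Omega U \<alpha> k i (x, t) (u, s) (v, r) = exp t * (s * a k v - r * a k u + d k u v)" for k u s v r
    unfolding a_def d_def by (rule Omega_eq[OF M \<alpha> i])
  note nf = contact_triple_normal_form[where a = a and d = d and A = A and w = "\<lambda>k. Omega U \<alpha> k i (x, t)",
      OF a d X(1) Om A_def]
  have "0 < A 1 1 * x\<^sup>2 + A 2 2 * y\<^sup>2 + A 3 3 * z\<^sup>2 + 2 * ((A 1 2 + A 2 1) / 2) * x * y
    + 2 * ((A 1 3 + A 3 1) / 2) * x * z + 2 * ((A 2 3 + A 3 2) / 2) * y * z"
    if "(x, y, z) \<noteq> (0, 0, 0)" for x y z
    using Q_pos[of "V x y z"] that unfolding QV by (auto simp: vec_eq_iff forall_3 V)
  then obtain l11 l21 l31 l22 l32 l33 where l: "0 < l11" "0 < l22" "0 < l33"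
    "A 1 1 = l11\<^sup>2" "(A 1 2 + A 2 1) / 2 = l11 * l21" "(A 1 3 + A 3 1) / 2 = l11 * l31" "A 2 2 = l21\<^sup>2 + l22\<^sup>2"
    "(A 2 3 + A 3 2) / 2 = l21 * l31 + l22 * l32" "A 3 3 = l31\<^sup>2 + l32\<^sup>2 + l33\<^sup>2"
    by (rule cholesky_3)
  define p where "p = (\<lambda>k::3. if k = 1 then l11 else if k = 2 then l21 else l31)"
  define q where "q = (\<lambda>k::3. if k = 1 then 0 else if k = 2 then l22 else l32)"
  define r where "r = (\<lambda>k::3. if k = 3 then l33 else 0)"
  have "\<exists>h I J K. quaternionic h I J K \<and>
      (\<forall>k u v. Omega U \<alpha> k i (x, t) u v = - h u (p k *\<^sub>R I v + q k *\<^sub>R J v + r k *\<^sub>R K v))"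
    by (rule nf[of l11 l22 l33 l21 l31 l32])
      (use l in \<open>simp_all add: p_def q_def r_def field_simps\<close>)
  moreover have "0 < p 1 \<and> q 1 = 0 \<and> r 1 = 0 \<and> 0 < q 2 \<and> r 2 = 0 \<and> 0 < r 3"
    using l by (simp add: p_def q_def r_def)
  ultimately show ?general by blast
  assume taut: "taut U \<alpha>"
  have Q_eq: "Q b = Q c" if "norm b = 1" "norm c = 1" for b c
  proof -
    have "contact_volume U (lin_comb b \<alpha>) i x = contact_volume U (lin_comb c \<alpha>) i x"
    proof -
      have "b \<in> sphere 0 1" "c \<in> sphere 0 1" using that by simp_all
      then show ?thesis using taut i unfolding taut_def by blast
    qed
    then show ?thesis using Q[of b] Q[of c] volX by (metis mult.right_neutral)
  qed
  have nV: "norm (V x y z) = sqrt (x\<^sup>2 + y\<^sup>2 + z\<^sup>2)" for x y z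
    by (simp add: norm_vec_def L2_set_def sum_3 V)
  define s where "s = A 1 1"
  have "s > 0" using A_pos by (simp add: s_def)
  have Q1: "Q (V x y z) = s" if "x\<^sup>2 + y\<^sup>2 + z\<^sup>2 = 1" for x y z
    using Q_eq[of "V x y z" "axis 1 1"] that by (simp add: nV Q_axis s_def)
  have diag: "A 2 2 = s" "A 3 3 = s" using Q1[of 0 1 0] Q1[of 0 0 1] by (simp_all add: QV)
  \<comment> \<open>\<open>(3/5, 4/5)\<close> is a rational unit vector off the axes; comparing
    \<open>Q\<close> there with its value \<open>s\<close> on the axes isolates the mixed
    coefficient.\<close>
  have off: "A 1 2 + A 2 1 = 0" "A 1 3 + A 3 1 = 0" "A 2 3 + A 3 2 = 0"
    using Q1[of "3/5" "4/5" 0] Q1[of "3/5" 0 "4/5"] Q1[of 0 "3/5" "4/5"] diag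
    by (simp_all add: QV s_def[symmetric] power2_eq_square field_simps)
  have sq: "(sqrt s)\<^sup>2 = s" "0 < sqrt s" using \<open>s > 0\<close> by simp_all
  \<comment> \<open>The symmetric part of \<open>A\<close> is now \<open>s\<close> times the
    identity, so its Cholesky factor is diagonal. The common factor \<open>sqrt s\<close> is
    absorbed into \<open>h\<close> at the end.\<close>
  have "\<exists>h I J K. quaternionic h I J K \<and> (\<forall>k u v. Omega U \<alpha> k i (x, t) u v
      = - h u ((if k = 1 then sqrt s else 0) *\<^sub>R I v + (if k = 2 then sqrt s else 0) *\<^sub>R J v
         + (if k = 3 then sqrt s else 0) *\<^sub>R K v))"
    by (rule nf[of "sqrt s" "sqrt s" "sqrt s" 0 0 0]) (use sq diag off in \<open>simp_all add: s_def[symmetric]\<close>)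
  then obtain h I J K where Q': "quaternionic h I J K"
    and rep: "\<forall>k u v. Omega U \<alpha> k i (x, t) u v
      = - h u ((if k = 1 then sqrt s else 0) *\<^sub>R I v + (if k = 2 then sqrt s else 0) *\<^sub>R J v
         + (if k = 3 then sqrt s else 0) *\<^sub>R K v)" by blast
  note hIJK = Q' rep[rule_format]
  note bl = bilinear_simps[OF inner_formD(1)[OF quaternionicD(1)[OF hIJK(1)]]]
  show "\<exists>h I J K. quaternionic h I J K \<and> (\<forall>u v. Omega U \<alpha> 1 i (x, t) u v = - h u (I v) \<and>
      Omega U \<alpha> 2 i (x, t) u v = - h u (J v) \<and> Omega U \<alpha> 3 i (x, t) u v = - h u (K v))"
    by (rule exI[of _ "\<lambda>u v. sqrt s * h u v"], rule exI[of _ I], rule exI[of _ J], rule exI[of _ K])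
      (use quaternionic_scale[OF hIJK(1) sq(2)] in \<open>simp add: hIJK(2) bl\<close>)
qed

section \<open>The metric and the endomorphisms determined by three nondegenerate 2-forms\<close>

text \<open>A reference frame of the model space that is the same at all points, so that quantities
  computed in it depend smoothly on the coefficients of the forms.\<close>

definition frame4 :: "4 \<Rightarrow> 'e::euclidean_space" where
  "frame4 = (SOME b. orthonormal_frame inner b)"

lemma orthonormal_frame4:
  assumes "DIM('e::euclidean_space) = 4" shows "orthonormal_frame inner (frame4 :: 4 \<Rightarrow> 'e)"
proof -
  from ex_orthonormal_frame[OF inner_form_inner[where 'e = 'e], where 'n = 4] assms have "\<exists>b::4 \<Rightarrow> 'e. orthonormal_frame inner b" by simp
  then show ?thesis unfolding frame4_def by (rule someI_ex)
qed

lemma frame4_expand: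
  assumes "DIM('e::euclidean_space) = 4" shows "(\<Sum>a\<in>UNIV. (v \<bullet> frame4 a) *\<^sub>R frame4 a) = (v :: 'e)"
  by (rule orthonormal_frame_expand[OF inner_form_inner orthonormal_frame4[OF assms]]) (simp add: assms)

lemma alternating4_frame4:
  assumes "DIM('e::euclidean_space) = 4" "alternating4 (m :: (4 \<Rightarrow> 'e) \<Rightarrow> real)"
  shows "m frame4 = 0 \<longleftrightarrow> (\<forall>e. m e = 0)"
  using alternating4_eq_0[OF assms(2), of frame4] frame4_expand[OF assms(1)] by metis

lemma orthonormal_frame_alternating4:
  fixes m :: "(4 \<Rightarrow> 'e::euclidean_space) \<Rightarrow> real"
  assumes "DIM('e) = 4" "inner_form h" "orthonormal_frame h e" "alternating4 m" "m e = 0"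
  shows "m v = 0"
proof (rule alternating4_eq_0[where m = m and e = e, OF assms(4,5)])
  have "CARD(4) = DIM('e)" using assms(1) by simp
  from orthonormal_frame_expand[OF assms(2,3) this]
  show "\<exists>c. x = (\<Sum>a\<in>UNIV. c a *\<^sub>R e a)" for x by metis
qed

text \<open>In dimension four, \<open>wedge22 w w\<close> on a basis is twice the Pfaffian.\<close>

definition nondegenerate2 :: "('e::euclidean_space \<Rightarrow> 'e \<Rightarrow> real) \<Rightarrow> bool" where
  "nondegenerate2 w \<longleftrightarrow> alternating2 w \<and> wedge22 w w frame4 \<noteq> 0"

text \<open>The vector representing the linear form \<open>\<rho>\<close> with respect to \<open>w\<close>: the inverse of an
  antisymmetric \<open>4 \<times> 4\<close> matrix is its dual divided by minus the Pfaffian.\<close>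

definition sharp :: "('e::euclidean_space \<Rightarrow> 'e \<Rightarrow> real) \<Rightarrow> ('e \<Rightarrow> real) \<Rightarrow> 'e" where
  "sharp w \<rho> = (let b = frame4; W = (\<lambda>c d. w (b c) (b d)); r = (\<lambda>c. \<rho> (b c)) in
    (- 2 / wedge22 w w b) *\<^sub>R
      ((W 3 4 * r 2 - W 2 4 * r 3 + W 2 3 * r 4) *\<^sub>R b 1
     + (- W 3 4 * r 1 + W 1 4 * r 3 - W 1 3 * r 4) *\<^sub>R b 2
     + (W 2 4 * r 1 - W 1 4 * r 2 + W 1 2 * r 4) *\<^sub>R b 3
     + (- W 2 3 * r 1 + W 1 3 * r 2 - W 1 2 * r 3) *\<^sub>R b 4))"

lemma sharp:
  assumes dim: "DIM('e::euclidean_space) = 4" and w: "nondegenerate2 (w :: 'e \<Rightarrow> 'e \<Rightarrow> real)" and \<rho>: "linear \<rho>"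
  shows "w u (sharp w \<rho>) = \<rho> u"
proof -
  let ?b = "frame4 :: 4 \<Rightarrow> 'e"
  have alt: "alternating2 w" and ne: "wedge22 w w ?b \<noteq> 0" using w by (auto simp: nondegenerate2_def)
  note bl = bilinear_simps[OF alternating2D(1)[OF alt]]
  have sk: "w (?b 2) (?b 1) = - w (?b 1) (?b 2)" "w (?b 3) (?b 1) = - w (?b 1) (?b 3)"
    "w (?b 4) (?b 1) = - w (?b 1) (?b 4)" "w (?b 3) (?b 2) = - w (?b 2) (?b 3)"
    "w (?b 4) (?b 2) = - w (?b 2) (?b 4)" "w (?b 4) (?b 3) = - w (?b 3) (?b 4)"
    by (rule alternating2D(3)[OF alt])+
  define P where "P = w (?b 1) (?b 2) * w (?b 3) (?b 4) - w (?b 1) (?b 3) * w (?b 2) (?b 4) + w (?b 1) (?b 4) * w (?b 2) (?b 3)"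
  have wP: "wedge22 w w ?b = 2 * P" by (simp add: wedge22_def P_def)
  then have P: "P \<noteq> 0" using ne by simp
  define W where "W c d = w (?b c) (?b d)" for c d
  define Z where "Z = (W 3 4 * \<rho> (?b 2) - W 2 4 * \<rho> (?b 3) + W 2 3 * \<rho> (?b 4)) *\<^sub>R ?b 1
     + (- W 3 4 * \<rho> (?b 1) + W 1 4 * \<rho> (?b 3) - W 1 3 * \<rho> (?b 4)) *\<^sub>R ?b 2
     + (W 2 4 * \<rho> (?b 1) - W 1 4 * \<rho> (?b 2) + W 1 2 * \<rho> (?b 4)) *\<^sub>R ?b 3
     + (- W 2 3 * \<rho> (?b 1) + W 1 3 * \<rho> (?b 2) - W 1 2 * \<rho> (?b 3)) *\<^sub>R ?b 4"
  have sh: "sharp w \<rho> = (- 2 / (2 * P)) *\<^sub>R Z"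
    unfolding sharp_def Let_def wP Z_def W_def ..
  have "w (?b c) Z = - P * \<rho> (?b c)" for c
    unfolding Z_def using exhaust_4[of c]
    by (elim disjE) (simp_all add: bl W_def sk alternating2D(2)[OF alt] P_def algebra_simps)
  then have "P * w (?b c) (sharp w \<rho>) = P * \<rho> (?b c)" for c
    unfolding sh bl using P by simp
  then have b: "w (?b c) (sharp w \<rho>) = \<rho> (?b c)" for c using P by simp
  note ex = frame4_expand[OF dim, of u]
  have "w u (sharp w \<rho>) = w (\<Sum>a\<in>UNIV. (u \<bullet> ?b a) *\<^sub>R ?b a) (sharp w \<rho>)" unfolding ex ..
  also have "\<dots> = \<rho> (\<Sum>a\<in>UNIV. (u \<bullet> ?b a) *\<^sub>R ?b a)"
    by (simp add: sum_4 bl b linear_add[OF \<rho>] linear_scale[OF \<rho>])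
  finally show ?thesis unfolding ex .
qed

lemma nondegenerate2_eqI:
  assumes dim: "DIM('e::euclidean_space) = 4" and w: "nondegenerate2 (w :: 'e \<Rightarrow> 'e \<Rightarrow> real)"
    and "\<And>u. w u x = w u y"
  shows "x = y"
proof -
  have alt: "alternating2 w" using w by (simp add: nondegenerate2_def)
  have "linear (\<lambda>u. u \<bullet> (x - y))" by (simp add: linear_iff inner_add_left)
  from sharp[OF dim w this, of "x - y"]
  have "(x - y) \<bullet> (x - y) = w (x - y) (sharp w (\<lambda>u. u \<bullet> (x - y)))" by simp
  also have "\<dots> = - w (sharp w (\<lambda>u. u \<bullet> (x - y))) (x - y)" by (rule alternating2D(3)[OF alt])
  also have "\<dots> = 0" using assms(3) by (simp add: bilinear_rsub[OF alternating2D(1)[OF alt]])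
  finally show ?thesis by simp
qed

lemma sharp_eqI:
  assumes dim: "DIM('e::euclidean_space) = 4" and w: "nondegenerate2 (w :: 'e \<Rightarrow> 'e \<Rightarrow> real)" and \<rho>: "linear \<rho>"
    and "\<And>u. w u z = \<rho> u"
  shows "sharp w \<rho> = z"
  by (rule nondegenerate2_eqI[OF dim w]) (simp add: sharp[OF dim w \<rho>] assms(4))

lemma linear_alternating2: "alternating2 w \<Longrightarrow> linear (\<lambda>u. w u v)"
  by (simp add: alternating2_def bilinear_def)

text \<open>\<open>L\<close> is injective because it pulls \<open>w'\<close> back to the
  nondegenerate \<open>w\<close>. It is therefore onto, and the equation characterising the right
  side can be tested on vectors \<open>L u\<close>.\<close>

lemma sharp_pullback:
  assumes dim: "DIM('e::euclidean_space) = 4" and "linear (L :: 'e \<Rightarrow> 'e)"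
    and w: "nondegenerate2 w" "nondegenerate2 w'" and r: "alternating2 r" "alternating2 r'"
    and pb: "\<And>u v. w u v = w' (L u) (L v)" "\<And>u v. r u v = r' (L u) (L v)"
  shows "L (sharp w (\<lambda>u. r u v)) = sharp w' (\<lambda>u. r' u (L v))"
proof -
  have "u = 0" if "L u = 0" for u
  proof (rule nondegenerate2_eqI[OF dim w(1)])
    have "bilinear w'" "bilinear w" using w by (auto simp: nondegenerate2_def alternating2_def)
    then show "w x u = w x 0" for x by (simp add: pb that bilinear_rzero linear_0[OF \<open>linear L\<close>])
  qed
  then have "inj L" using linear_injective_0[OF \<open>linear L\<close>] by blast
  then have surj: "surj L" using linear_injective_imp_surjective[OF \<open>linear L\<close>] by simp
  show ?thesis
  proof (rule sharp_eqI[symmetric, OF dim w(2) linear_alternating2[OF r(2)]])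
    fix z obtain u where z: "z = L u" using surj by blast
    have "w u (sharp w (\<lambda>u. r u v)) = r u v" by (rule sharp[OF dim w(1) linear_alternating2[OF r(1)]])
    then show "w' z (L (sharp w (\<lambda>u. r u v))) = r' z (L v)" by (simp add: z pb)
  qed
qed

text \<open>Computed in the adapted frame \<open>u\<close>, \<open>I u\<close>, \<open>J u\<close>,
  \<open>K u\<close>. The proportionality of the squares shows that all nonzero \<open>w k\<close>
  induce the same orientation.\<close>

lemma quaternionic_wedge22:
  fixes h :: "'e::euclidean_space \<Rightarrow> 'e \<Rightarrow> real"
  assumes Q: "quaternionic h I J K" and dim: "DIM('e) = 4"
    and w: "\<And>k u v. w k u v = - h u (p k *\<^sub>R I v + q k *\<^sub>R J v + r k *\<^sub>R K v)"
  shows "alternating2 (w k)" "\<exists>e. \<forall>k. wedge22 (w k) (w k) e = 2 * ((p k)\<^sup>2 + (q k)\<^sup>2 + (r k)\<^sup>2)"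
    "((p k)\<^sup>2 + (q k)\<^sup>2 + (r k)\<^sup>2) * wedge22 (w l) (w l) v = ((p l)\<^sup>2 + (q l)\<^sup>2 + (r l)\<^sup>2) * wedge22 (w k) (w k) v"
    "(p k, q k, r k) \<noteq> (0, 0, 0) \<Longrightarrow> nondegenerate2 (w k)"
proof -
  note qq = quaternionicD[OF Q]
  note bl = bilinear_simps[OF inner_formD(1)[OF qq(1)]]
  note lin = linear_add[OF qq(2)] linear_add[OF qq(3)] linear_add[OF qq(4)]
    linear_scale[OF qq(2)] linear_scale[OF qq(3)] linear_scale[OF qq(4)]
    linear_neg[OF qq(2)] linear_neg[OF qq(3)] linear_neg[OF qq(4)]
  show alt: "alternating2 (w k)" for k
    unfolding alternating2_def bilinear_def
    by (auto intro!: linearI simp: w bl lin qq(17-19) algebra_simps)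
  obtain e1 where "e1 \<in> (Basis :: 'e set)" using nonempty_Basis by blast
  then have "e1 \<noteq> 0" by (auto simp: nonzero_Basis)
  define u where "u = (1 / sqrt (h e1 e1)) *\<^sub>R e1"
  have u: "h u u = 1" using inner_formD(3)[OF qq(1) \<open>e1 \<noteq> 0\<close>] by (simp add: u_def bl)
  define e :: "4 \<Rightarrow> 'e" where "e = (\<lambda>a. if a = 1 then u else if a = 2 then I u else if a = 3 then J u else K u)"
  have e: "e 1 = u" "e 2 = I u" "e 3 = J u" "e 4 = K u" by (simp_all add: e_def)
  note iso = quaternionic_isometry[OF Q]
  have hu: "h (e a) (e b) = (if a = b then 1 else 0)" for a b
    using exhaust_4[of a] exhaust_4[of b] by (elim disjE) (simp_all add: e iso u qq(17-19))
  then have on: "orthonormal_frame h e" by (simp add: orthonormal_frame_def)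
  have we: "wedge22 (w k) (w k) e = 2 * ((p k)\<^sup>2 + (q k)\<^sup>2 + (r k)\<^sup>2)" for k
    by (simp add: wedge22_def w e bl iso u qq(8-19) power2_eq_square algebra_simps)
  then show "\<exists>e. \<forall>k. wedge22 (w k) (w k) e = 2 * ((p k)\<^sup>2 + (q k)\<^sup>2 + (r k)\<^sup>2)" by blast
  let ?n = "\<lambda>k. (p k)\<^sup>2 + (q k)\<^sup>2 + (r k)\<^sup>2"
  let ?m = "\<lambda>v. ?n k * wedge22 (w l) (w l) v - ?n l * wedge22 (w k) (w k) v"
  have "alternating4 ?m"
    by (rule alternating4_linear_combination[OF alternating4_wedge22[OF alt alt] alternating4_wedge22[OF alt alt]])
  then have "?m v = 0" by (rule orthonormal_frame_alternating4[OF dim qq(1) on]) (simp_all add: we algebra_simps)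
  then show "?n k * wedge22 (w l) (w l) v = ?n l * wedge22 (w k) (w k) v" by simp
  assume ne: "(p k, q k, r k) \<noteq> (0, 0, 0)"
  have "wedge22 (w k) (w k) e \<noteq> 0" using ne unfolding we by (auto simp: add_nonneg_eq_0_iff)
  then show "nondegenerate2 (w k)"
    unfolding nondegenerate2_def using alt alternating4_frame4[OF dim alternating4_wedge22[OF alt alt]] by blast
qed

text \<open>For \<open>\<Omega>\<^sub>k = - g(\<cdot>, J\<^sub>k \<cdot>)\<close> with quaternionic \<open>J\<^sub>k\<close> one has \<open>\<Omega>\<^sub>k\<^sub>-\<^sub>1(\<cdot>, J\<^sub>k \<cdot>) = \<Omega>\<^sub>k\<^sub>+\<^sub>1\<close>
  (indices modulo 3) and \<open>g = \<Omega>\<^sub>2(\<cdot>, J\<^sub>2 \<cdot>)\<close>, so the structure can be recovered from the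
  \<open>\<Omega>\<^sub>k\<close>. The symmetrised metric makes sense, up to a conformal factor, for all contact spheres.\<close>

definition canonical_endo :: "('i, 'a, 'e::euclidean_space) atlas \<Rightarrow> (3 \<Rightarrow> ('i, 'e) tensor2) \<Rightarrow> 3 \<Rightarrow> ('i, 'e) endo" where
  "canonical_endo M w k i x v =
     (if in_chart M i x then sharp (w (k - 1) i x) (\<lambda>u. w (k + 1) i x u v) else 0)"

definition canonical_metric :: "('i, 'a, 'e::euclidean_space) atlas \<Rightarrow> (3 \<Rightarrow> ('i, 'e) tensor2) \<Rightarrow> ('i, 'e) tensor2" where
  "canonical_metric M w i x u v = (if in_chart M i x then
     (w 2 i x u (canonical_endo M w 2 i x v) + w 2 i x v (canonical_endo M w 2 i x u)) / 2 else 0)"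

text \<open>Represents the orientation. For a contact sphere the squares of the three forms are
  positive multiples of each other, so the index 1 is a mere choice.\<close>

definition canonical_volume :: "(3 \<Rightarrow> ('i, 'e) tensor2) \<Rightarrow> ('i, 'e) tensor4" where
  "canonical_volume w i x = wedge22 (w 1 i x) (w 1 i x)"

lemma arith_mod_3: "(1::3) - 1 = 3" "(2::3) - 1 = 1" "(3::3) - 1 = 2" "(1::3) + 1 = 2" "(2::3) + 1 = 3" "(3::3) + 1 = 1"
  by simp_all

definition nondegenerate_triple :: "('i, 'a, 'e::euclidean_space) atlas \<Rightarrow> (3 \<Rightarrow> ('i, 'e) tensor2) \<Rightarrow> bool" where
  "nondegenerate_triple M w \<longleftrightarrow> (\<forall>k. tensor_field2 M (w k)) \<and> (\<forall>k i x. in_chart M i x \<longrightarrow> nondegenerate2 (w k i x))"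

text \<open>With \<open>F = id\<close> this is the transformation law under changes of charts; with
  a translation it relates the structures of conformally equivalent spheres.\<close>

lemma canonical_pullback:
  fixes M :: "('i, 'a::{t2_space, second_countable_topology}, 'e::euclidean_space) atlas"
  assumes dim: "DIM('e) = 4" and M: "smooth_manifold M" and F: "smooth_map M M F"
    and w: "nondegenerate_triple M w" "nondegenerate_triple M w'"
    and pb: "\<And>k. pullback2 M M F (w' k) (w k)"
  shows "pullback_endo M M F (canonical_endo M w' k) (canonical_endo M w k)"
    "pullback2 M M F (canonical_metric M w') (canonical_metric M w)"
    "pullback4 M M F (canonical_volume w') (canonical_volume w)"
proof -
  have rel: "w k i x u v = w' k j (local_rep M M F i j x) (differential M M F i j x u)
     (differential M M F i j x v)"
    if "i \<in> charts M" "j \<in> charts M" "x \<in> local_dom M M F i j" for i j x k u v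
    using pb that by (auto simp: pullback2_def Let_def)
  have endo: "differential M M F i j x (canonical_endo M w k i x u)
    = canonical_endo M w' k j (local_rep M M F i j x) (differential M M F i j x u)"
    if ij: "i \<in> charts M" "j \<in> charts M" "x \<in> local_dom M M F i j" for i j x k u
  proof -
    note c = local_rep_chart[OF M M ij]
    have nd: "nondegenerate2 (w l i x)" "nondegenerate2 (w' l j (local_rep M M F i j x))" for l
      using w c(1,2) by (auto simp: nondegenerate_triple_def)
    then have alt: "alternating2 (w l i x)" "alternating2 (w' l j (local_rep M M F i j x))" for l
      by (auto simp: nondegenerate2_def)
    show ?thesis unfolding canonical_endo_def using c(1,2)
      by (simp add: sharp_pullback[OF dim smooth_map_local(3)[OF M M F ij] nd alt rel[OF ij] rel[OF ij]])
  qed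
  then show "pullback_endo M M F (canonical_endo M w' k) (canonical_endo M w k)"
    by (simp add: pullback_endo_def Let_def)
  show "pullback2 M M F (canonical_metric M w') (canonical_metric M w)"
    using local_rep_chart(1,2)[OF M M]
    by (simp add: pullback2_def Let_def canonical_metric_def endo rel)
  show "pullback4 M M F (canonical_volume w') (canonical_volume w)"
    by (simp add: pullback4_def Let_def canonical_volume_def wedge22_def rel)
qed

lemma smooth_sharp:
  fixes w :: "'x::euclidean_space \<Rightarrow> 'e::euclidean_space \<Rightarrow> 'e \<Rightarrow> real"
  assumes S: "open S" and w: "\<And>u v. smooth_on S (\<lambda>x. w x u v)" and \<rho>: "\<And>u. smooth_on S (\<lambda>x. \<rho> x u)"
    and nd: "\<And>x. x \<in> S \<Longrightarrow> nondegenerate2 (w x)"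
  shows "smooth_on S (\<lambda>x. sharp (w x) (\<rho> x))"
proof -
  have "smooth_on S (\<lambda>x. wedge22 (w x) (w x) frame4)"
    unfolding wedge22_def by (intro smooth_on_add smooth_on_diff smooth_on_mult S w)
  then show ?thesis
    unfolding sharp_def Let_def
    by (intro smooth_on_scaleR smooth_on_add smooth_on_diff smooth_on_mult smooth_on_minus smooth_on_divide
       S w \<rho> smooth_on_const) (use nd in \<open>auto simp: nondegenerate2_def\<close>)
qed

lemma canonical_smooth:
  fixes M :: "('i, 'a::{t2_space, second_countable_topology}, 'e::euclidean_space) atlas"
  assumes dim: "DIM('e) = 4" and M: "smooth_manifold M" and w: "nondegenerate_triple M w"
  shows "endo_field M (canonical_endo M w k)" "tensor_field2 M (canonical_metric M w)"
    "volume_form M (canonical_volume w)"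
proof -
  have sm: "smooth_on (chart_image M i) (\<lambda>x. w k i x u v)" if "i \<in> charts M" for i k u v
    using w that by (auto simp: nondegenerate_triple_def tensor_field2_def)
  have nd: "nondegenerate2 (w k i x)" if "in_chart M i x" for k i x
    using w that by (auto simp: nondegenerate_triple_def)
  then have alt: "alternating2 (w k i x)" if "in_chart M i x" for k i x
    using that by (auto simp: nondegenerate2_def)
  have ic: "in_chart M i x" if "i \<in> charts M" "x \<in> chart_image M i" for i x
    using that by (simp add: in_chart_def)
  note o = smooth_manifold_chart(2)[OF M]
  have pb: "pullback2 M M id (w k) (w k)" for k
    using w by (auto simp: nondegenerate_triple_def tensor_field2_def)
  note cp = canonical_pullback[OF dim M smooth_map_id[OF M] w w pb]
  have lin: "linear (canonical_endo M w k i x)" if i: "in_chart M i x" for k i x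
  proof -
    note sh = sharp[OF dim nd[OF i] linear_alternating2[OF alt[OF i]]]
    note bl = bilinear_simps[OF alternating2D(1)[OF alt[OF i]]]
    have "canonical_endo M w k i x = (\<lambda>v. sharp (w (k - 1) i x) (\<lambda>u. w (k + 1) i x u v))"
      using i by (simp add: canonical_endo_def fun_eq_iff)
    moreover have "linear (\<lambda>v. sharp (w (k - 1) i x) (\<lambda>u. w (k + 1) i x u v))"
      by (rule linearI; rule nondegenerate2_eqI[OF dim nd[OF i]]; subst sh; simp add: bl sh)
    ultimately show ?thesis by simp
  qed
  have smE: "smooth_on (chart_image M i) (\<lambda>x. canonical_endo M w k i x v)" if i: "i \<in> charts M" for i k v
    by (rule smooth_on_cong[OF o[OF i] _ smooth_sharp[OF o[OF i] sm[OF i] sm[OF i] nd[OF ic[OF i]]]])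
      (auto simp: canonical_endo_def ic[OF i])
  show "endo_field M (canonical_endo M w k)"
    unfolding endo_field_def
    using cp(1) lin smE by (auto simp: canonical_endo_def fun_eq_iff)
  have bil: "bilinear (canonical_metric M w i x)" if i: "in_chart M i x" for i x
  proof -
    note bl = bilinear_simps[OF alternating2D(1)[OF alt[OF i]]] linear_add[OF lin[OF i]] linear_scale[OF lin[OF i]]
    show ?thesis unfolding bilinear_def using i
      by (auto intro!: linearI simp: canonical_metric_def bl algebra_simps add_divide_distrib)
  qed
  have smM: "smooth_on (chart_image M i) (\<lambda>x. canonical_metric M w i x u v)" if i: "i \<in> charts M" for i u v
  proof -
    have lw: "linear (w 2 i x u)" if "x \<in> chart_image M i" for x u
      using alternating2D(1)[OF alt[OF ic[OF i that]]] by (auto simp: bilinear_def)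
    have "smooth_on (chart_image M i) (\<lambda>x. (w 2 i x u (canonical_endo M w 2 i x v) + w 2 i x v (canonical_endo M w 2 i x u)) * (1/2))"
      by (intro smooth_on_mult smooth_on_add o[OF i] smooth_on_const
        smooth_on_linear_family[OF o[OF i] lw sm[OF i] smE[OF i]])
    then show ?thesis
      by (rule smooth_on_cong[OF o[OF i], rotated]) (simp add: canonical_metric_def ic[OF i])
  qed
  show "tensor_field2 M (canonical_metric M w)"
    unfolding tensor_field2_def using cp(2) bil smM by (auto simp: canonical_metric_def fun_eq_iff)
  have smV: "smooth_on (chart_image M i) (\<lambda>x. canonical_volume w i x e)" if i: "i \<in> charts M" for i e
    unfolding canonical_volume_def wedge22_def by (intro smooth_on_add smooth_on_diff smooth_on_mult o[OF i] sm[OF i])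
  have A: "alternating4 (canonical_volume w i x)" if "in_chart M i x" for i x
    unfolding canonical_volume_def by (rule alternating4_wedge22[OF alt[OF that] alt[OF that]])
  have Z: "canonical_volume w i x = (\<lambda>_. 0)" if "\<not> in_chart M i x" for i x
    using w that by (simp add: nondegenerate_triple_def tensor_field2_def canonical_volume_def wedge22_def fun_eq_iff)
  have N: "canonical_volume w i x frame4 \<noteq> 0" if "in_chart M i x" for i x
    using nd[OF that] by (simp add: nondegenerate2_def canonical_volume_def)
  show "volume_form M (canonical_volume w)"
    unfolding volume_form_def four_form_def
  proof (intro conjI allI impI ballI)
    show "linear (\<lambda>v. canonical_volume w i x (e(a := v)))" if "in_chart M i x" for i x e a
      using A[OF that] by (simp add: alternating4_def)
    show "canonical_volume w i x e = 0" if "in_chart M i x" "a \<noteq> b \<and> e a = e b" for i x e a b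
      using A[OF that(1)] that(2) unfolding alternating4_def by blast
    show "\<exists>e. canonical_volume w i x e \<noteq> 0" if "in_chart M i x" for i x
      using N[OF that] by blast
  qed (use Z smV cp(3) in auto)
qed

section \<open>Conformal classes and orientations\<close>

text \<open>Conformal factors arise as quotients of coefficients in charts. The value at a point is
  read in a chart chosen there, and \<open>compat\<close> makes it independent of the
  choice.\<close>

lemma chartwise_positive_function:
  assumes M: "smooth_manifold M"
    and compat: "\<And>i j x. i \<in> charts M \<Longrightarrow> j \<in> charts M \<Longrightarrow> x \<in> overlap M i j \<Longrightarrow>
      c j (transition M i j x) = c i x"
    and smooth: "\<And>i. i \<in> charts M \<Longrightarrow> smooth_on (chart_image M i) (c i)"
    and pos: "\<And>i x. in_chart M i x \<Longrightarrow> 0 < c i x"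
  shows "\<exists>f. positive_function M f \<and> (\<forall>i x. in_chart M i x \<longrightarrow> f (chart_inv M i x) = c i x)"
proof -
  define ch where "ch p = (SOME i. i \<in> charts M \<and> p \<in> chart_dom M i)" for p
  define f where "f p = c (ch p) (chart_map M (ch p) p)" for p
  have f: "f (chart_inv M i x) = c i x" if i: "in_chart M i x" for i x
  proof -
    let ?p = "chart_inv M i x"
    have i': "i \<in> charts M" "x \<in> chart_image M i" using i by (auto simp: in_chart_def)
    then have "i \<in> charts M \<and> ?p \<in> chart_dom M i" using smooth_manifold_chart(6)[OF M] by blast
    then have j: "ch ?p \<in> charts M \<and> ?p \<in> chart_dom M (ch ?p)" unfolding ch_def by (rule someI)
    then have "x \<in> local_dom M M id i (ch ?p)" using i' by (simp add: local_dom_def)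
    from compat[OF i'(1) conjunct1[OF j] this] show ?thesis by (simp add: f_def local_rep_def)
  qed
  have "positive_function M f"
    unfolding positive_function_def smooth_function_def
  proof (intro conjI ballI)
    show "smooth_on (chart_image M i) (\<lambda>x. f (chart_inv M i x))" if "i \<in> charts M" for i
      by (rule smooth_on_cong[OF smooth_manifold_chart(2)[OF M that] _ smooth[OF that]])
        (use that f in \<open>simp add: in_chart_def\<close>)
    show "0 < f p" if p: "p \<in> carrier_of M" for p
    proof -
      obtain i x where "in_chart M i x" "chart_inv M i x = p" using carrier_ofE[OF M p] by blast
      then show ?thesis using f[of i x] pos[of i x] by simp
    qed
  qed
  then show ?thesis using f by blast
qed

lemma riemannian_metric_inner_form:
  "riemannian_metric M g \<Longrightarrow> in_chart M i x \<Longrightarrow> inner_form (g i x)"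
  by (auto simp: riemannian_metric_def tensor_field2_def inner_form_def)

lemma riemannian_metricI:
  "tensor_field2 M g \<Longrightarrow> (\<And>i x. in_chart M i x \<Longrightarrow> inner_form (g i x)) \<Longrightarrow> riemannian_metric M g"
  unfolding riemannian_metric_def inner_form_def by blast

text \<open>The factor is the quotient of both metrics on one fixed vector \<open>b\<close>, so
  pointwise proportionality already makes it smooth. In another chart both metrics are evaluated on
  the image of \<open>b\<close>, which leaves the ratio unchanged.\<close>

lemma conformal_rel_iff:
  assumes M: "smooth_manifold M"
  shows "(g, h) \<in> conformal_rel M \<longleftrightarrow> riemannian_metric M g \<and> riemannian_metric M h \<and>
    (\<forall>i x. in_chart M i x \<longrightarrow> (\<exists>c>0. \<forall>u v. h i x u v = c * g i x u v))" (is "?l \<longleftrightarrow> ?r")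
proof
  assume ?l
  then show ?r
    using in_chart_carrier[OF M] unfolding conformal_rel_def positive_function_def by blast
next
  assume r: ?r
  obtain b where b: "b \<in> (Basis :: 'c set)" using nonempty_Basis by blast
  then have "b \<noteq> 0" by (auto simp: nonzero_Basis)
  then have pos: "0 < k i x b b" if "in_chart M i x" "k = g \<or> k = h" for k i x
    using r that by (auto simp: riemannian_metric_def)
  have tf: "tensor_field2 M g" "tensor_field2 M h" using r by (auto simp: riemannian_metric_def)
  define c where "c i x = h i x b b / g i x b b" for i x
  have c: "h i x u v = c i x * g i x u v" if i: "in_chart M i x" for i x u v
  proof -
    obtain d where "\<And>u v. h i x u v = d * g i x u v" using r i by blast
    moreover have "g i x b b \<noteq> 0" using pos[OF i, of g] by simp
    ultimately show ?thesis by (simp add: c_def)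
  qed
  have "\<exists>f. positive_function M f \<and> (\<forall>i x. in_chart M i x \<longrightarrow> f (chart_inv M i x) = c i x)"
  proof (rule chartwise_positive_function[OF M])
    fix i j x assume ij: "i \<in> charts M" "j \<in> charts M" "x \<in> overlap M i j"
    note ch = local_rep_chart(1,2)[OF M M ij]
    let ?y = "transition M i j x" and ?D = "differential M M id i j x"
    have "k i x b b = k j ?y (?D b) (?D b)" if "k = g \<or> k = h" for k
      using tf ij that by (auto simp: tensor_field2_def pullback2_def Let_def)
    then have "h i x b b = c j ?y * g i x b b" using c[OF ch(2)] by metis
    then show "c j ?y = c i x" using pos[OF ch(1), of g] by (simp add: c_def[of i])
  next
    fix i assume i: "i \<in> charts M"
    have sm: "smooth_on (chart_image M i) (\<lambda>x. h i x b b)" "smooth_on (chart_image M i) (\<lambda>x. g i x b b)"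
      using tf i unfolding tensor_field2_def by blast+
    show "smooth_on (chart_image M i) (c i)"
      unfolding c_def
    proof (rule smooth_on_divide[OF smooth_manifold_chart(2)[OF M i] sm])
      show "g i x b b \<noteq> 0" if "x \<in> chart_image M i" for x
        using pos[of i x g] i that by (simp add: in_chart_def)
    qed
  qed (use pos in \<open>simp add: c_def\<close>)
  then show ?l using r c unfolding conformal_rel_def by force
qed

lemma equiv_conformal_rel:
  assumes M: "smooth_manifold M" shows "equiv {g. riemannian_metric M g} (conformal_rel M)"
proof (rule equivI)
  show "conformal_rel M \<subseteq> {g. riemannian_metric M g} \<times> {g. riemannian_metric M g}"
    by (auto simp: conformal_rel_def)
  show "refl_on {g. riemannian_metric M g} (conformal_rel M)"
    by (rule refl_onI) (auto simp: conformal_rel_iff[OF M] intro!: exI[of _ 1])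
  show "sym (conformal_rel M)"
  proof (rule symI)
    fix g h assume gh: "(g, h) \<in> conformal_rel M"
    have "\<exists>d>0. \<forall>u v. g i x u v = d * h i x u v" if i: "in_chart M i x" for i x
    proof -
      obtain c where "c > 0" "\<forall>u v. h i x u v = c * g i x u v" using gh i conformal_rel_iff[OF M] by blast
      then show ?thesis by (intro exI[of _ "1 / c"]) simp
    qed
    then show "(h, g) \<in> conformal_rel M" using gh conformal_rel_iff[OF M] by blast
  qed
  show "trans (conformal_rel M)"
  proof (rule transI)
    fix g h k assume gh: "(g, h) \<in> conformal_rel M" and hk: "(h, k) \<in> conformal_rel M"
    have "\<exists>d>0. \<forall>u v. k i x u v = d * g i x u v" if i: "in_chart M i x" for i x
    proof -
      obtain c d where "c > 0" "\<forall>u v. h i x u v = c * g i x u v" "d > 0" "\<forall>u v. k i x u v = d * h i x u v"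
        using gh hk i conformal_rel_iff[OF M] by meson
      then show ?thesis by (intro exI[of _ "d * c"]) simp
    qed
    then show "(g, k) \<in> conformal_rel M" using gh hk conformal_rel_iff[OF M] by blast
  qed
qed

lemma volume_form_alternating4:
  "volume_form M m \<Longrightarrow> in_chart M i x \<Longrightarrow> alternating4 (m i x)"
  by (auto simp: volume_form_def four_form_def alternating4_def)

lemma volume_form_frame4:
  fixes m :: "('i, 'e::euclidean_space) tensor4"
  assumes "DIM('e) = 4" "volume_form M m" "in_chart M i x" shows "m i x frame4 \<noteq> 0"
  using assms(2,3) alternating4_frame4[OF assms(1) volume_form_alternating4[OF assms(2,3)]]
  unfolding volume_form_def by blast

text \<open>As for metrics, with the values on \<open>frame4\<close> providing the quotient.\<close>

lemma orientation_rel_iff: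
  fixes M :: "('i, 'a::{t2_space, second_countable_topology}, 'e::euclidean_space) atlas"
  assumes dim: "DIM('e) = 4" and M: "smooth_manifold M"
  shows "(m, n) \<in> orientation_rel M \<longleftrightarrow> volume_form M m \<and> volume_form M n \<and>
    (\<forall>i x. in_chart M i x \<longrightarrow> (\<exists>c>0. \<forall>e. n i x e = c * m i x e))" (is "?l \<longleftrightarrow> ?r")
proof
  assume ?l
  then show ?r
    using in_chart_carrier[OF M] unfolding orientation_rel_def positive_function_def by blast
next
  assume r: ?r
  then have ne: "m i x frame4 \<noteq> 0" if "in_chart M i x" for i x
    using volume_form_frame4[OF dim _ that] by blast
  have ff: "four_form M m" "four_form M n" using r by (auto simp: volume_form_def)
  define c where "c i x = n i x frame4 / m i x frame4" for i x
  have c: "n i x e = c i x * m i x e \<and> 0 < c i x" if i: "in_chart M i x" for i x e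
  proof -
    obtain d where "d > 0" "\<And>e. n i x e = d * m i x e" using r i by blast
    then show ?thesis using ne[OF i] by (simp add: c_def)
  qed
  have "\<exists>f. positive_function M f \<and> (\<forall>i x. in_chart M i x \<longrightarrow> f (chart_inv M i x) = c i x)"
  proof (rule chartwise_positive_function[OF M])
    fix i j x assume ij: "i \<in> charts M" "j \<in> charts M" "x \<in> overlap M i j"
    note ch = local_rep_chart(1,2)[OF M M ij]
    let ?y = "transition M i j x" and ?D = "differential M M id i j x"
    have "k i x frame4 = k j ?y (\<lambda>a. ?D (frame4 a))" if "k = m \<or> k = n" for k
      using ff ij that by (auto simp: four_form_def pullback4_def Let_def)
    then have "n i x frame4 = c j ?y * m i x frame4" using c[OF ch(2)] by metis
    then show "c j ?y = c i x" using ne[OF ch(1)] by (simp add: c_def[of i])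
  next
    fix i assume i: "i \<in> charts M"
    show "smooth_on (chart_image M i) (c i)"
      unfolding c_def
      by (intro smooth_on_divide smooth_manifold_chart(2)[OF M i])
        (use ff i ne in \<open>auto simp: four_form_def in_chart_def\<close>)
  qed (use c in blast)
  then show ?l using r c unfolding orientation_rel_def by force
qed

lemma equiv_orientation_rel:
  fixes M :: "('i, 'a::{t2_space, second_countable_topology}, 'e::euclidean_space) atlas"
  assumes dim: "DIM('e) = 4" and M: "smooth_manifold M"
  shows "equiv {m. volume_form M m} (orientation_rel M)"
proof (rule equivI)
  note iff = orientation_rel_iff[OF dim M]
  show "orientation_rel M \<subseteq> {m. volume_form M m} \<times> {m. volume_form M m}"
    by (auto simp: orientation_rel_def)
  show "refl_on {m. volume_form M m} (orientation_rel M)"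
    by (rule refl_onI) (auto simp: iff intro!: exI[of _ 1])
  show "sym (orientation_rel M)"
  proof (rule symI)
    fix m n assume mn: "(m, n) \<in> orientation_rel M"
    have "\<exists>d>0. \<forall>e. m i x e = d * n i x e" if i: "in_chart M i x" for i x
    proof -
      obtain c where "c > 0" "\<forall>e. n i x e = c * m i x e" using mn i iff by blast
      then show ?thesis by (intro exI[of _ "1 / c"]) simp
    qed
    then show "(n, m) \<in> orientation_rel M" using mn iff by blast
  qed
  show "trans (orientation_rel M)"
  proof (rule transI)
    fix m n k assume mn: "(m, n) \<in> orientation_rel M" and nk: "(n, k) \<in> orientation_rel M"
    have "\<exists>d>0. \<forall>e. k i x e = d * m i x e" if i: "in_chart M i x" for i x
    proof -
      obtain c d where "c > 0" "\<forall>e. n i x e = c * m i x e" "d > 0" "\<forall>e. k i x e = d * n i x e"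
        using mn nk i iff by meson
      then show ?thesis by (intro exI[of _ "d * c"]) simp
    qed
    then show "(m, k) \<in> orientation_rel M" using mn nk iff by blast
  qed
qed

lemma positive_function_id_compat:
  assumes M: "smooth_manifold M" and "i \<in> charts M" "j \<in> charts M" "x \<in> overlap M i j"
  shows "f (chart_inv M j (transition M i j x)) = f (chart_inv M i x)"
  using local_rep_chart(3)[OF M assms] by simp

section \<open>Rescaling by positive functions and translating the factors\<close>

lemma riemannian_metric_scale:
  assumes M: "smooth_manifold M" and g: "riemannian_metric M g" and f: "positive_function M f"
  shows "riemannian_metric M (\<lambda>i x u v. if in_chart M i x then f (chart_inv M i x) * g i x u v else 0)"
    (is "riemannian_metric M ?h")
proof (rule riemannian_metricI)
  have t: "tensor_field2 M g" using g by (simp add: riemannian_metric_def)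
  have pos: "0 < f (chart_inv M i x)" if "in_chart M i x" for i x
    using f in_chart_carrier[OF M that] by (simp add: positive_function_def)
  show "inner_form (?h i x)" if i: "in_chart M i x" for i x
    using riemannian_metric_inner_form[OF g i] pos[OF i] i
    unfolding inner_form_def bilinear_def by (auto simp: linear_iff algebra_simps)
  then have "bilinear (?h i x)" if "in_chart M i x" for i x using inner_formD(1)[OF _] that by blast
  moreover have "smooth_on (chart_image M i) (\<lambda>x. ?h i x u v)" if i: "i \<in> charts M" for i u v
  proof (rule smooth_on_cong[OF smooth_manifold_chart(2)[OF M i]])
    show "smooth_on (chart_image M i) (\<lambda>x. f (chart_inv M i x) * g i x u v)"
      by (rule smooth_on_mult[OF smooth_manifold_chart(2)[OF M i]])
        (use f t i in \<open>auto simp: positive_function_def smooth_function_def tensor_field2_def\<close>)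
  qed (use i in \<open>simp add: in_chart_def\<close>)
  moreover have "pullback2 M M id ?h ?h"
    unfolding pullback2_def Let_def
  proof (intro ballI allI)
    fix i j x u v assume ij: "i \<in> charts M" "j \<in> charts M" "x \<in> overlap M i j"
    have "g i x u v = g j (transition M i j x) (differential M M id i j x u)
      (differential M M id i j x v)"
      using t ij by (auto simp: tensor_field2_def pullback2_def Let_def)
    then show "?h i x u v = ?h j (transition M i j x) (differential M M id i j x u)
      (differential M M id i j x v)"
      using local_rep_chart(1,2)[OF M M ij] positive_function_id_compat[OF M ij, of f] by simp
  qed
  ultimately show "tensor_field2 M ?h" unfolding tensor_field2_def by simp
qed

lemma volume_form_scale:
  assumes M: "smooth_manifold M" and m: "volume_form M m" and f: "positive_function M f"
  shows "volume_form M (\<lambda>i x e. if in_chart M i x then f (chart_inv M i x) * m i x e else 0)"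
    (is "volume_form M ?n")
proof -
  have t: "four_form M m" using m by (simp add: volume_form_def)
  have pos: "0 < f (chart_inv M i x)" if "in_chart M i x" for i x
    using f in_chart_carrier[OF M that] by (simp add: positive_function_def)
  have sm: "smooth_on (chart_image M i) (\<lambda>x. ?n i x e)" if i: "i \<in> charts M" for i e
  proof (rule smooth_on_cong[OF smooth_manifold_chart(2)[OF M i]])
    show "smooth_on (chart_image M i) (\<lambda>x. f (chart_inv M i x) * m i x e)"
      by (rule smooth_on_mult[OF smooth_manifold_chart(2)[OF M i]])
        (use f t i in \<open>auto simp: positive_function_def smooth_function_def four_form_def\<close>)
  qed (use i in \<open>simp add: in_chart_def\<close>)
  have pb: "pullback4 M M id ?n ?n"
    unfolding pullback4_def Let_def
  proof (intro ballI allI)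
    fix i j x e assume ij: "i \<in> charts M" "j \<in> charts M" "x \<in> overlap M i j"
    have "m i x e = m j (transition M i j x) (\<lambda>a. differential M M id i j x (e a))"
      using t ij by (auto simp: four_form_def pullback4_def Let_def)
    then show "?n i x e = ?n j (transition M i j x) (\<lambda>a. differential M M id i j x (e a))"
      using local_rep_chart(1,2)[OF M M ij] positive_function_id_compat[OF M ij, of f] by simp
  qed
  show ?thesis unfolding volume_form_def four_form_def
  proof (intro conjI allI impI ballI)
    show "linear (\<lambda>v. ?n i x (e(a := v)))" if i: "in_chart M i x" for i x e a
    proof -
      have "linear (\<lambda>v. m i x (e(a := v)))" using t i by (auto simp: four_form_def)
      then show ?thesis using i by (simp add: linear_iff algebra_simps)
    qed
    show "?n i x e = 0" if "in_chart M i x" "a \<noteq> b \<and> e a = e b" for i x e a b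
    proof -
      have "m i x e = 0" using t that unfolding four_form_def by blast
      then show ?thesis by simp
    qed
    show "\<exists>e. ?n i x e \<noteq> 0" if i: "in_chart M i x" for i x
    proof -
      obtain e where "m i x e \<noteq> 0" using m i unfolding volume_form_def by blast
      then show ?thesis using i pos[OF i] by (intro exI[of _ e]) simp
    qed
  qed (use sm pb in auto)
qed

lemma positive_function_translation:
  assumes M: "smooth_manifold M" and F: "\<And>p t. F (p, t) = (p, t + \<phi> p)" and \<phi>: "smooth_function M \<phi>"
    and f: "positive_function (times_real M) f"
  shows "positive_function (times_real M) (\<lambda>y. f (F y))"
  unfolding positive_function_def smooth_function_def
proof (intro conjI ballI)
  note t = times_real_chart[OF M]
  show "0 < f (F p)" if "p \<in> carrier_of (times_real M)" for p
    using f that by (cases p) (auto simp: positive_function_def t F)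
  fix i assume "i \<in> charts (times_real M)"
  then have i: "i \<in> charts M" by (simp add: t)
  let ?S = "chart_image M i \<times> (UNIV :: real set)"
  note o = smooth_manifold_chart(2)[OF M i]
  have o': "open ?S" using o by (simp add: open_Times)
  have "smooth_on ?S (\<lambda>y. (fst y, snd y + \<phi> (chart_inv M i (fst y))))"
    using \<phi> i by (intro smooth_on_Pair smooth_on_add o' smooth_on_Times_real o) (auto simp: smooth_function_def)
  then have "smooth_on ?S (\<lambda>y. f (chart_inv (times_real M) i (fst y, snd y + \<phi> (chart_inv M i (fst y)))))"
    by (rule smooth_on_compose[OF o', where T = ?S, rotated])
      (use f i in \<open>auto simp: positive_function_def smooth_function_def t\<close>)
  then show "smooth_on (chart_image (times_real M) i) (\<lambda>y. f (F (chart_inv (times_real M) i y)))"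
    unfolding t(4) by (rule smooth_on_cong[OF o', rotated]) (use i in \<open>auto simp: t F in_chart_def\<close>)
qed

section \<open>Self-duality\<close>

text \<open>On an oriented frame \<open>w l \<and> w l\<close> is positive, hence so is
  \<open>w k \<and> w k\<close> by proportionality; this rules out anti-self-duality.\<close>

lemma quaternionic_is_hodge_dual:
  fixes h :: "'e::euclidean_space \<Rightarrow> 'e \<Rightarrow> real"
  assumes Q: "quaternionic h I J K" and dim: "DIM('e) = 4"
    and w: "\<And>k u v. w k u v = - h u (p k *\<^sub>R I v + q k *\<^sub>R J v + r k *\<^sub>R K v)"
    and ne: "\<And>k. (p k, q k, r k) \<noteq> (0, 0, 0)"
    and g: "c > 0" "\<And>u v. g u v = c * h u v" and m: "d > 0" "\<And>e. m e = d * wedge22 (w l) (w l) e"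
  shows "is_hodge_dual g m (w k) (w k)"
proof -
  have Qg: "quaternionic g I J K" using quaternionic_scale[OF Q g(1)] by (simp add: g(2)[abs_def, symmetric])
  note bl = bilinear_simps[OF inner_formD(1)[OF quaternionicD(1)[OF Q]]]
  have wg: "w k u v = - g u ((p k / c) *\<^sub>R I v + (q k / c) *\<^sub>R J v + (r k / c) *\<^sub>R K v)" for u v
    using g(1) by (simp add: w g(2) bl field_simps)
  have n: "0 < (p k)\<^sup>2 + (q k)\<^sup>2 + (r k)\<^sup>2" for k
    using ne[of k] by (auto simp: add_pos_nonneg add_nonneg_pos zero_less_power2)
  show ?thesis
    unfolding is_hodge_dual_self_iff[OF quaternionicD(1)[OF Qg] quaternionic_wedge22(1)[where w = w and k = k, OF Q dim w]]
  proof (intro allI impI)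
    fix e assume e: "oriented_orthonormal g m e"
    then have on: "orthonormal_frame g e" by (simp add: oriented_orthonormal_def orthonormal_frame_def)
    have "0 < wedge22 (w l) (w l) e" using e m by (simp add: oriented_orthonormal_def zero_less_mult_iff)
    then have "0 < ((p k)\<^sup>2 + (q k)\<^sup>2 + (r k)\<^sup>2) * wedge22 (w l) (w l) e" using n[of k] by simp
    also have "\<dots> = ((p l)\<^sup>2 + (q l)\<^sup>2 + (r l)\<^sup>2) * wedge22 (w k) (w k) e"
      by (rule quaternionic_wedge22(3)[OF Q dim w])
    finally have "0 < wedge22 (w k) (w k) e" using n[of l] by (simp add: zero_less_mult_iff)
    from quaternionic_wedge_positive_self_dual[OF Qg on dim wg this]
    show "w k (e 3) (e 4) = w k (e 1) (e 2) \<and> w k (e 2) (e 4) = - w k (e 1) (e 3) \<and> w k (e 2) (e 3) = w k (e 1) (e 4)"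
      by simp
  qed
qed

text \<open>Self-duality on one oriented orthonormal frame of \<open>g\<close> writes the
  \<open>w k\<close> through quaternions for \<open>g\<close>. The canonical metric \<open>G\<close>
  is then a multiple of \<open>g\<close>, and since both are positive definite the factor is
  positive.\<close>

lemma self_dual_unique:
  fixes g G :: "'e::euclidean_space \<Rightarrow> 'e \<Rightarrow> real" and w :: "3 \<Rightarrow> 'e \<Rightarrow> 'e \<Rightarrow> real"
  assumes dim: "DIM('e) = 4" and g: "inner_form g" and m: "alternating4 m" "m frame4 \<noteq> 0"
    and w: "\<And>k. nondegenerate2 (w k)" and dual: "\<And>k. is_hodge_dual g m (w k) (w k)"
    and G: "inner_form G" "\<And>u v. G u v = (w 2 u (N v) + w 2 v (N u)) / 2" and N: "\<And>u v. w 1 u (N v) = w 3 u v"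
  shows "\<exists>c>0. \<forall>u v. g u v = c * G u v" "\<exists>c>0. \<forall>e. m e = c * wedge22 (w 1) (w 1) e"
proof -
  have alt: "alternating2 (w k)" for k using w by (simp add: nondegenerate2_def)
  obtain e0 :: "4 \<Rightarrow> 'e" where e0: "orthonormal_frame g e0"
    using ex_orthonormal_frame[OF g, where 'n = 4] dim by auto
  have m0: "m e0 \<noteq> 0" using orthonormal_frame_alternating4[OF dim g e0 m(1)] m(2) by blast
  \<comment> \<open>Exchanging two vectors reverses the sign of \<open>m\<close>, so one of the two
    frames is oriented.\<close>
  define e where "e = (if 0 < m e0 then e0 else e0 \<circ> Transposition.transpose 1 2)"
  have on: "orthonormal_frame g e"
  proof -
    have "Transposition.transpose (1::4) 2 a = Transposition.transpose 1 2 b \<longleftrightarrow> a = b" for a b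
      by (metis transpose_involutory)
    then show ?thesis using e0 by (simp add: e_def orthonormal_frame_def)
  qed
  have me: "0 < m e" using m0 alternating4_transpose[OF m(1), of 1 2 e0] by (auto simp: e_def)
  have oo: "oriented_orthonormal g m e" using on me by (simp add: oriented_orthonormal_def orthonormal_frame_def)
  have c: "w k (e 3) (e 4) = w k (e 1) (e 2)" "w k (e 2) (e 4) = - w k (e 1) (e 3)" "w k (e 2) (e 3) = w k (e 1) (e 4)" for k
    using dual[of k] oo unfolding is_hodge_dual_self_iff[OF g alt] by blast+
  define p where "p k = w k (e 1) (e 2)" for k
  define q where "q k = w k (e 1) (e 3)" for k
  define r where "r k = w k (e 1) (e 4)" for k
  from ex_quaternionic[OF g on dim] obtain I J K where Q: "quaternionic g I J K"
    and rep: "\<And>w p q r u v. alternating2 w \<Longrightarrow> w (e 1) (e 2) = p \<Longrightarrow> w (e 3) (e 4) = p \<Longrightarrow>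
       w (e 1) (e 3) = q \<Longrightarrow> w (e 2) (e 4) = - q \<Longrightarrow> w (e 1) (e 4) = r \<Longrightarrow> w (e 2) (e 3) = r \<Longrightarrow>
       w u v = - g u (p *\<^sub>R I v + q *\<^sub>R J v + r *\<^sub>R K v)"
    by metis
  have wk: "w k u v = - g u (p k *\<^sub>R I v + q k *\<^sub>R J v + r k *\<^sub>R K v)" for k u v
    by (rule rep[OF alt]) (simp_all add: p_def q_def r_def c)
  have we: "wedge22 (w k) (w k) e = 2 * ((p k)\<^sup>2 + (q k)\<^sup>2 + (r k)\<^sup>2)" for k
    by (simp add: wedge22_def c p_def q_def r_def power2_eq_square)
  have "wedge22 (w k) (w k) e \<noteq> 0" for k
    using orthonormal_frame_alternating4[OF dim g on alternating4_wedge22[OF alt alt]] w[of k]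
    unfolding nondegenerate2_def by blast
  then have n: "0 < (p k)\<^sup>2 + (q k)\<^sup>2 + (r k)\<^sup>2" for k
    unfolding we by (metis add_nonneg_nonneg less_eq_real_def mult_zero_right zero_le_power2)
  let ?n = "(p 1)\<^sup>2 + (q 1)\<^sup>2 + (r 1)\<^sup>2"
  define D where "D = p 1 * (q 2 * r 3 - q 3 * r 2) - q 1 * (p 2 * r 3 - p 3 * r 2) + r 1 * (p 2 * q 3 - p 3 * q 2)"
  have GD: "?n * G u v = D * g u v" for u v
    using quaternionic_canonical_metric[OF Q wk N, of u v] by (simp add: G(2) D_def)
  obtain b where "b \<in> (Basis :: 'e set)" using nonempty_Basis by blast
  then have "b \<noteq> 0" by (auto simp: nonzero_Basis)
  then have "0 < ?n * G b b" "0 < g b b" using inner_formD(3)[OF G(1)] inner_formD(3)[OF g] n by simp_all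
  then have "0 < D" unfolding GD by (simp add: zero_less_mult_iff)
  then have "g u v = ?n / D * G u v" for u v using GD[of u v] by (simp add: field_simps)
  moreover have "0 < ?n / D" using n \<open>0 < D\<close> by simp
  ultimately show "\<exists>c>0. \<forall>u v. g u v = c * G u v" by blast
  have pos: "0 < wedge22 (w 1) (w 1) e" using n[of 1] by (simp add: we)
  have "CARD(4) = DIM('e)" using dim by simp
  from orthonormal_frame_expand[OF g on this]
  have sp: "\<exists>c. x = (\<Sum>a\<in>UNIV. c a *\<^sub>R e a)" for x by metis
  have "wedge22 (w 1) (w 1) e \<noteq> 0" using pos by simp
  note mv = alternating4_proportional[OF alternating4_wedge22[OF alt[of 1] alt[of 1]] m(1) this sp]
  have "m v = m e / wedge22 (w 1) (w 1) e * wedge22 (w 1) (w 1) v" for v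
    by (rule mv)
  then show "\<exists>c>0. \<forall>e. m e = c * wedge22 (w 1) (w 1) e" using divide_pos_pos[OF me pos] by blast
qed

section \<open>Structures determined by contact spheres\<close>

lemma DIM_4: "DIM((real^3) \<times> real) = 4" by simp

abbreviation contact_metric where
  "contact_metric U \<alpha> \<equiv> canonical_metric (times_real U) (Omega U \<alpha>)"

abbreviation contact_endo where
  "contact_endo U \<alpha> \<equiv> canonical_endo (times_real U) (Omega U \<alpha>)"

lemma contact_sphere_triple:
  assumes M: "smooth_manifold U" and cs: "contact_sphere U \<alpha>" "naturally_ordered U \<alpha>"
  shows "nondegenerate_triple (times_real U) (Omega U \<alpha>)"
    and "in_chart (times_real U) i y \<Longrightarrow> \<exists>h I J K p q r c. quaternionic h I J K \<and>
      (\<forall>k u v. Omega U \<alpha> k i y u v = - h u (p k *\<^sub>R I v + q k *\<^sub>R J v + r k *\<^sub>R K v)) \<and>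
      (\<forall>k. (p k, q k, r k) \<noteq> (0, 0, 0)) \<and> 0 < c \<and>
      (\<forall>u v. contact_metric U \<alpha> i y u v = c * h u v)"
proof -
  note t = times_real_chart[OF M]
  note M' = smooth_manifold_times_real[OF M]
  have \<alpha>: "one_form U (\<alpha> k)" for k using cs by (simp add: contact_sphere_def)
  have tf: "tensor_field2 (times_real U) (Omega U \<alpha> k)" for k
    unfolding Omega_def by (rule tensor_field2_ext_deriv(1)[OF M' one_form_exp_form[OF M \<alpha>]])
  have nf: "\<exists>h I J K p q r. quaternionic h I J K \<and>
      (\<forall>k u v. Omega U \<alpha> k i y u v = - h u (p k *\<^sub>R I v + q k *\<^sub>R J v + r k *\<^sub>R K v)) \<and>
      0 < p 1 \<and> q 1 = 0 \<and> r 1 = 0 \<and> 0 < q 2 \<and> r 2 = 0 \<and> 0 < r 3"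
    if "in_chart (times_real U) i y" for i y
  proof -
    obtain x s where y: "y = (x, s)" by (metis surj_pair)
    show ?thesis unfolding y by (rule contact_sphere_normal_form(1)[OF M cs]) (use that y t in simp)
  qed
  have nz: "(p k, q k, r k) \<noteq> (0, 0, 0)"
    if "0 < p 1 \<and> q 1 = 0 \<and> r 1 = 0 \<and> 0 < q 2 \<and> r 2 = 0 \<and> 0 < r 3" for p q r :: "3 \<Rightarrow> real" and k
    using that exhaust_3[of k] by auto
  have nd: "nondegenerate2 (Omega U \<alpha> k i y)" if i: "in_chart (times_real U) i y" for k i y
  proof -
    from nf[OF i] obtain h I J K p q r where *: "quaternionic h I J K"
      "\<And>k u v. Omega U \<alpha> k i y u v = - h u (p k *\<^sub>R I v + q k *\<^sub>R J v + r k *\<^sub>R K v)"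
      "0 < p 1 \<and> q 1 = 0 \<and> r 1 = 0 \<and> 0 < q 2 \<and> r 2 = 0 \<and> 0 < r 3" by blast
    show ?thesis
      by (rule quaternionic_wedge22(4)[where w = "\<lambda>k. Omega U \<alpha> k i y", OF *(1) DIM_4 *(2) nz[of p q r, OF *(3)]])
  qed
  show "nondegenerate_triple (times_real U) (Omega U \<alpha>)"
    using tf nd by (simp add: nondegenerate_triple_def)
  assume i: "in_chart (times_real U) i y"
  from nf[OF i] obtain h I J K p q r where *: "quaternionic h I J K"
      "\<And>k u v. Omega U \<alpha> k i y u v = - h u (p k *\<^sub>R I v + q k *\<^sub>R J v + r k *\<^sub>R K v)"
      "0 < p 1 \<and> q 1 = 0 \<and> r 1 = 0 \<and> 0 < q 2 \<and> r 2 = 0 \<and> 0 < r 3" by blast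
  let ?N = "contact_endo U \<alpha> 2 i y"
  have "Omega U \<alpha> 1 i y u (?N v) = Omega U \<alpha> 3 i y u v" for u v
    using sharp[OF DIM_4 nd[OF i] linear_alternating2] nd[OF i] i
    by (simp add: canonical_endo_def nondegenerate2_def)
  note N = quaternionic_canonical_metric[where w = "\<lambda>k. Omega U \<alpha> k i y", OF *(1,2) this]
  have g2: "2 * contact_metric U \<alpha> i y u v
      = Omega U \<alpha> 2 i y u (?N v) + Omega U \<alpha> 2 i y v (?N u)" for u v
    using i by (simp add: canonical_metric_def)
  \<comment> \<open>In the triangular normal form the determinant is \<open>p 1 * q 2 * r 3\<close>
    and the first vector has squared length \<open>(p 1)\<^sup>2\<close>.\<close>
  have "(p 1)\<^sup>2 * (2 * contact_metric U \<alpha> i y u v) = 2 * (p 1 * (q 2 * r 3)) * h u v" for u v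
    unfolding g2 using N[of u v] *(3) by simp
  then have "contact_metric U \<alpha> i y u v = q 2 * r 3 / p 1 * h u v" for u v
    using *(3) by (simp add: field_simps power2_eq_square)
  moreover have "0 < q 2 * r 3 / p 1" using *(3) by simp
  ultimately show "\<exists>h I J K p q r c. quaternionic h I J K \<and>
      (\<forall>k u v. Omega U \<alpha> k i y u v = - h u (p k *\<^sub>R I v + q k *\<^sub>R J v + r k *\<^sub>R K v)) \<and>
      (\<forall>k. (p k, q k, r k) \<noteq> (0, 0, 0)) \<and> 0 < c \<and>
      (\<forall>u v. contact_metric U \<alpha> i y u v = c * h u v)"
    using *(1,2) nz[of p q r, OF *(3)] by blast
qed

lemma contact_sphere_metric:
  assumes M: "smooth_manifold U" and cs: "contact_sphere U \<alpha>" "naturally_ordered U \<alpha>"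
  shows "riemannian_metric (times_real U) (contact_metric U \<alpha>)"
proof (rule riemannian_metricI)
  note tr = contact_sphere_triple[OF M cs]
  show "tensor_field2 (times_real U) (contact_metric U \<alpha>)"
    by (rule canonical_smooth(2)[OF DIM_4 smooth_manifold_times_real[OF M] tr(1)])
  show "inner_form (contact_metric U \<alpha> i y)" if i: "in_chart (times_real U) i y" for i y
  proof -
    obtain h I J K c where *: "quaternionic h I J K" "0 < c"
      "\<And>u v. contact_metric U \<alpha> i y u v = c * h u v" using tr(2)[OF i] by blast
    have "contact_metric U \<alpha> i y = (\<lambda>u v. c * h u v)" using *(3) by blast
    then show ?thesis using quaternionicD(1)[OF quaternionic_scale[OF *(1,2)]] by simp
  qed
qed

definition canonical_conformal ::
  "('i, 'a, real^3) atlas \<Rightarrow> (3 \<Rightarrow> ('i, real^3) tensor1) \<Rightarrow>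
   ('i, (real^3) \<times> real) tensor4 set \<times> ('i, (real^3) \<times> real) tensor2 set" where
  "canonical_conformal U \<alpha> = (orientation_rel (times_real U) `` {canonical_volume (Omega U \<alpha>)},
     conformal_rel (times_real U) `` {contact_metric U \<alpha>})"

text \<open>Arbitrary representatives are compared with the canonical ones point by point;
  \<open>conformal_rel_iff\<close> and \<open>orientation_rel_iff\<close> convert the pointwise
  factors into smooth ones, hence into equality of classes.\<close>

lemma determines_conformal_iff:
  assumes M: "smooth_manifold U" and cs: "contact_sphere U \<alpha>" "naturally_ordered U \<alpha>"
  shows "determines_conformal U \<alpha> C \<longleftrightarrow> C = canonical_conformal U \<alpha>"
proof
  note M' = smooth_manifold_times_real[OF M]
  note tr = contact_sphere_triple[OF M cs]
  note g0 = contact_sphere_metric[OF M cs]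
  note m0 = canonical_smooth(3)[OF DIM_4 M' tr(1)]
  let ?g = "contact_metric U \<alpha>" and ?m = "canonical_volume (Omega U \<alpha>)"
  note eo = equiv_orientation_rel[OF DIM_4 M'] and ec = equiv_conformal_rel[OF M']
  {
    assume C: "C = canonical_conformal U \<alpha>"
    show "determines_conformal U \<alpha> C"
      unfolding determines_conformal_def
    proof (intro conjI ballI allI)
      show "C \<in> oriented_conformal_structures (times_real U)"
        unfolding C canonical_conformal_def oriented_conformal_structures_def orientations_def conformal_classes_def
        using m0 g0 by (auto intro: quotientI)
      fix m g k assume "m \<in> fst C" "g \<in> snd C"
      then have mg: "(?m, m) \<in> orientation_rel (times_real U)" "(?g, g) \<in> conformal_rel (times_real U)"
        by (auto simp: C canonical_conformal_def)
      show "self_dual (times_real U) g m (Omega U \<alpha> k)"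
        unfolding self_dual_def
      proof (intro allI impI)
        fix i y assume i: "in_chart (times_real U) i y"
        obtain h I J K p q r c where *: "quaternionic h I J K"
          "\<And>k u v. Omega U \<alpha> k i y u v = - h u (p k *\<^sub>R I v + q k *\<^sub>R J v + r k *\<^sub>R K v)"
          "\<And>k. (p k, q k, r k) \<noteq> (0, 0, 0)" "0 < c" "\<And>u v. ?g i y u v = c * h u v" using tr(2)[OF i] by blast
        obtain c' where c': "0 < c'" "\<And>u v. g i y u v = c' * ?g i y u v"
          using mg(2) i unfolding conformal_rel_iff[OF M'] by blast
        obtain d where d: "0 < d" "\<And>e. m i y e = d * ?m i y e"
          using mg(1) i unfolding orientation_rel_iff[OF DIM_4 M'] by blast
        show "is_hodge_dual (g i y) (m i y) (Omega U \<alpha> k i y) (Omega U \<alpha> k i y)"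
          by (rule quaternionic_is_hodge_dual[where w = "\<lambda>k. Omega U \<alpha> k i y" and l = 1 and c = "c' * c" and d = d,
             OF *(1) DIM_4 *(2,3)])
            (use *(4,5) c' d in \<open>simp_all add: canonical_volume_def\<close>)
      qed
    qed
  }
  assume d: "determines_conformal U \<alpha> C"
  obtain O' G' where C: "C = (O', G')" by (metis surj_pair)
  have OG: "O' \<in> {m. volume_form (times_real U) m} // orientation_rel (times_real U)"
    "G' \<in> {g. riemannian_metric (times_real U) g} // conformal_rel (times_real U)"
    using d unfolding determines_conformal_def oriented_conformal_structures_def orientations_def
      conformal_classes_def C by auto
  obtain m where m: "O' = orientation_rel (times_real U) `` {m}" "volume_form (times_real U) m"
    using OG(1) by (auto elim: quotientE)
  obtain g where g: "G' = conformal_rel (times_real U) `` {g}" "riemannian_metric (times_real U) g"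
    using OG(2) by (auto elim: quotientE)
  have "m \<in> O'" "g \<in> G'" using m g equiv_class_self[OF eo] equiv_class_self[OF ec] by auto
  then have sd: "self_dual (times_real U) g m (Omega U \<alpha> k)" for k
    using d by (auto simp: determines_conformal_def C)
  have "(\<exists>c>0. \<forall>u v. g i y u v = c * ?g i y u v) \<and> (\<exists>c>0. \<forall>e. m i y e = c * ?m i y e)"
    if i: "in_chart (times_real U) i y" for i y
  proof -
    have nd: "nondegenerate2 (Omega U \<alpha> k i y)" for k
      using tr(1) i unfolding nondegenerate_triple_def by blast
    let ?N = "contact_endo U \<alpha> 2 i y"
    have N: "Omega U \<alpha> 1 i y u (?N v) = Omega U \<alpha> 3 i y u v" for u v
      using sharp[OF DIM_4 nd linear_alternating2] nd i
      by (simp add: canonical_endo_def nondegenerate2_def)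
    have G: "?g i y u v = (Omega U \<alpha> 2 i y u (?N v) + Omega U \<alpha> 2 i y v (?N u)) / 2" for u v
      using i by (simp add: canonical_metric_def)
    have dual: "is_hodge_dual (g i y) (m i y) (Omega U \<alpha> k i y) (Omega U \<alpha> k i y)" for k
      using sd[of k] i unfolding self_dual_def by blast
    note u = self_dual_unique[where w = "\<lambda>k. Omega U \<alpha> k i y" and N = ?N, OF DIM_4 riemannian_metric_inner_form[OF g(2) i]
       volume_form_alternating4[OF m(2) i] volume_form_frame4[OF DIM_4 m(2) i] nd dual
       riemannian_metric_inner_form[OF g0 i] G N]
    show ?thesis using u by (simp add: canonical_volume_def)
  qed
  then have "(?g, g) \<in> conformal_rel (times_real U)" "(?m, m) \<in> orientation_rel (times_real U)"
    unfolding conformal_rel_iff[OF M'] orientation_rel_iff[OF DIM_4 M'] using g0 g(2) m0 m(2) by auto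
  then show "C = canonical_conformal U \<alpha>"
    using equiv_class_eq[OF ec] equiv_class_eq[OF eo] by (simp add: C m g canonical_conformal_def)
qed

section \<open>Conformally equivalent contact spheres\<close>

lemma conformally_equivalent_translation:
  assumes M: "smooth_manifold U" and \<alpha>: "\<And>k. one_form U (\<alpha> k)" "\<And>k. one_form U (\<beta> k)"
    and eq: "conformally_equivalent U \<alpha> \<beta>"
  obtains F \<phi> where "\<And>p t. F (p, t) = (p, t + \<phi> p)" "smooth_function U \<phi>"
    "diffeomorphism (times_real U) (times_real U) F"
    "\<And>k. pullback2 (times_real U) (times_real U) F (Omega U \<beta> k) (Omega U \<alpha> k)"
proof -
  note M' = smooth_manifold_times_real[OF M]
  obtain f where f: "positive_function U f"
    "\<And>k i x v. in_chart U i x \<Longrightarrow> \<beta> k i x v = f (chart_inv U i x) * \<alpha> k i x v"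
    using eq by (auto simp: conformally_equivalent_def)
  have pos: "0 < f (chart_inv U i x)" if "in_chart U i x" for i x
    using f(1) in_chart_carrier[OF M that] by (simp add: positive_function_def)
  define \<phi> where "\<phi> p = - ln (f p)" for p
  have \<phi>: "smooth_function U \<phi>"
    unfolding smooth_function_def \<phi>_def
  proof
    fix i assume i: "i \<in> charts U"
    note o = smooth_manifold_chart(2)[OF M i]
    show "smooth_on (chart_image U i) (\<lambda>x. - ln (f (chart_inv U i x)))"
      by (rule smooth_on_minus[OF o smooth_on_compose[OF o _ _ smooth_on_ln]])
        (use f(1) i pos in \<open>auto simp: positive_function_def smooth_function_def in_chart_def\<close>)
  qed
  define F where "F = (\<lambda>(p, t). (p, t + \<phi> p))"
  have F: "F (p, t) = (p, t + \<phi> p)" for p t by (simp add: F_def)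
  have "\<alpha> k i x v = exp (\<phi> (chart_inv U i x)) * \<beta> k i x v" if "in_chart U i x" for k i x v
    using pos[OF that] by (simp add: \<phi>_def exp_minus f(2)[OF that])
  from exp_form_pullback[where F = F and \<phi> = \<phi>, OF M F \<phi> \<alpha>(2) this]
  have "pullback2 (times_real U) (times_real U) F (Omega U \<beta> k) (Omega U \<alpha> k)" for k
    unfolding Omega_def
    by (intro ext_deriv_pullback[OF M' M' smooth_map_translation[where F = F and \<phi> = \<phi>, OF M F \<phi>]
      one_form_exp_form[OF M \<alpha>(2)]])
  then show ?thesis
    using that[of F \<phi>] F \<phi> diffeomorphism_translation[where F = F and \<phi> = \<phi>, OF M F \<phi>] by blast
qed

lemma isomorphic_canonical_conformal:
  assumes M: "smooth_manifold U" and \<alpha>: "contact_sphere U \<alpha>" "naturally_ordered U \<alpha>"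
    and \<beta>: "contact_sphere U \<beta>" "naturally_ordered U \<beta>" and eq: "conformally_equivalent U \<alpha> \<beta>"
  shows "isomorphic_conformal (times_real U) (canonical_conformal U \<alpha>) (canonical_conformal U \<beta>)"
proof -
  note M' = smooth_manifold_times_real[OF M]
  have one: "one_form U (\<alpha> k)" "one_form U (\<beta> k)" for k using \<alpha> \<beta> by (simp_all add: contact_sphere_def)
  obtain F \<phi> where F: "\<And>p t. F (p, t) = (p, t + \<phi> p)" and \<phi>: "smooth_function U \<phi>"
    and diffeo: "diffeomorphism (times_real U) (times_real U) F"
    and pb: "\<And>k. pullback2 (times_real U) (times_real U) F (Omega U \<beta> k) (Omega U \<alpha> k)"
    by (rule conformally_equivalent_translation[OF M one eq]) (rule that)
  have smF: "smooth_map (times_real U) (times_real U) F" using diffeo by (simp add: diffeomorphism_def)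
  note tr\<alpha> = contact_sphere_triple(1)[OF M \<alpha>] and tr\<beta> = contact_sphere_triple(1)[OF M \<beta>]
  note cp = canonical_pullback[OF DIM_4 M' smF tr\<alpha> tr\<beta> pb]
  note sc = local_rep_chart[OF M' M']
  let ?T = "times_real U"
  show ?thesis
    unfolding isomorphic_conformal_def
  proof (intro exI conjI ballI)
    show "diffeomorphism ?T ?T F" by (rule diffeo)
    fix m' assume "m' \<in> fst (canonical_conformal U \<beta>)"
    then obtain f where f: "positive_function ?T f"
      "\<And>i x e. in_chart ?T i x \<Longrightarrow> m' i x e = f (chart_inv ?T i x) * canonical_volume (Omega U \<beta>) i x e"
      by (auto simp: canonical_conformal_def orientation_rel_def)
    note fF = positive_function_translation[where F = F and \<phi> = \<phi>, OF M F \<phi> f(1)]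
    \<comment> \<open>The factor \<open>f\<close> of the given representative pulls back to
      \<open>f\<close> composed with \<open>F\<close>; the conditional restores the normalisation
      outside the charts.\<close>
    let ?m = "\<lambda>i x e. if in_chart ?T i x then f (F (chart_inv ?T i x)) * canonical_volume (Omega U \<alpha>) i x e else 0"
    have m0: "volume_form ?T (canonical_volume (Omega U \<alpha>))" by (rule canonical_smooth(3)[OF DIM_4 M' tr\<alpha>])
    have "(canonical_volume (Omega U \<alpha>), ?m) \<in> orientation_rel ?T"
      unfolding orientation_rel_def using m0 volume_form_scale[OF M' m0 fF] fF by auto
    then have "?m \<in> fst (canonical_conformal U \<alpha>)" by (simp add: canonical_conformal_def)
    moreover have "pullback4 ?T ?T F m' ?m"
      using cp(3) by (simp add: pullback4_def Let_def f(2) sc)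
    ultimately show "\<exists>m\<in>fst (canonical_conformal U \<alpha>). pullback4 ?T ?T F m' m" by blast
  next
    fix g' assume "g' \<in> snd (canonical_conformal U \<beta>)"
    then obtain f where f: "positive_function ?T f"
      "\<And>i x u v. in_chart ?T i x \<Longrightarrow> g' i x u v = f (chart_inv ?T i x) * canonical_metric ?T (Omega U \<beta>) i x u v"
      by (auto simp: canonical_conformal_def conformal_rel_def)
    note fF = positive_function_translation[where F = F and \<phi> = \<phi>, OF M F \<phi> f(1)]
    let ?g = "\<lambda>i x u v. if in_chart ?T i x then f (F (chart_inv ?T i x)) * canonical_metric ?T (Omega U \<alpha>) i x u v else 0"
    note g0 = contact_sphere_metric[OF M \<alpha>]
    have "(canonical_metric ?T (Omega U \<alpha>), ?g) \<in> conformal_rel ?T"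
      unfolding conformal_rel_def using g0 riemannian_metric_scale[OF M' g0 fF] fF by auto
    then have "?g \<in> snd (canonical_conformal U \<alpha>)" by (simp add: canonical_conformal_def)
    moreover have "pullback2 ?T ?T F g' ?g"
      using cp(2) by (simp add: pullback2_def Let_def f(2) sc)
    ultimately show "\<exists>g\<in>snd (canonical_conformal U \<alpha>). pullback2 ?T ?T F g' g" by blast
  qed
qed

section \<open>The hyperkaehler structure of a taut contact sphere\<close>

text \<open>Applied to the pointwise normal form this gives existence, applied to a given
  hyperkaehler structure it gives uniqueness.\<close>

lemma canonical_quaternionic:
  fixes M :: "('i, 'a, 'e::euclidean_space) atlas"
  assumes dim: "DIM('e) = 4" and i: "in_chart M i x" and Q: "quaternionic h I J K"
    and w: "\<And>u v. w 1 i x u v = - h u (I v)" "\<And>u v. w 2 i x u v = - h u (J v)" "\<And>u v. w 3 i x u v = - h u (K v)"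
  shows "canonical_endo M w 1 i x = I" "canonical_endo M w 2 i x = J" "canonical_endo M w 3 i x = K"
    "canonical_metric M w i x = h"
proof -
  note q = quaternionicD[OF Q]
  note bl = bilinear_simps[OF inner_formD(1)[OF q(1)]]
  have rep: "w k i x u v = - h u ((if k = 1 then 1 else 0) *\<^sub>R I v + (if k = 2 then 1 else 0) *\<^sub>R J v
      + (if k = 3 then 1 else 0) *\<^sub>R K v)" for k u v
    using exhaust_3[of k] w by auto
  have nd: "nondegenerate2 (w k i x)" for k
    by (rule quaternionic_wedge22(4)[where w = "\<lambda>k. w k i x", OF Q dim rep]) (use exhaust_3[of k] in auto)
  have lin: "linear (\<lambda>u. w k i x u v)" for k v
    using nd by (intro linear_alternating2) (simp add: nondegenerate2_def)
  have "canonical_endo M w 1 i x v = I v" for v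
    unfolding canonical_endo_def arith_mod_3 using i
    by (simp, intro sharp_eqI[OF dim nd lin]) (simp add: w q(8-16))
  then show 1: "canonical_endo M w 1 i x = I" by blast
  have "canonical_endo M w 2 i x v = J v" for v
    unfolding canonical_endo_def arith_mod_3 using i
    by (simp, intro sharp_eqI[OF dim nd lin]) (simp add: w q(8-16))
  then show 2: "canonical_endo M w 2 i x = J" by blast
  have "canonical_endo M w 3 i x v = K v" for v
    unfolding canonical_endo_def arith_mod_3 using i
    by (simp, intro sharp_eqI[OF dim nd lin]) (simp add: w q(8-16) bl)
  then show 3: "canonical_endo M w 3 i x = K" by blast
  have "canonical_metric M w i x u v = h u v" for u v
    using i inner_formD(2)[OF q(1), of v u] by (simp add: canonical_metric_def 2 w q(9) bl)
  then show "canonical_metric M w i x = h" by blast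
qed

lemma hyperkaehler_quaternionic:
  assumes H: "hyperkaehler M g J" and i: "in_chart M i x"
  shows "quaternionic (g i x) (J 1 i x) (J 2 i x) (J 3 i x)"
proof -
  have g: "inner_form (g i x)" using H i riemannian_metric_inner_form by (auto simp: hyperkaehler_def)
  have lin: "linear (J k i x)" and sq: "J k i x (J k i x u) = - u"
    and iso: "g i x (J k i x u) (J k i x v) = g i x u v" for k u v
    using H i by (auto simp: hyperkaehler_def complex_structure_def endo_field_def)
  have sk: "g i x u (J k i x v) = - g i x v (J k i x u)" for k u v
    using iso[of k u "J k i x v"] inner_formD(2)[OF g, of v "J k i x u"]
    by (simp add: sq bilinear_rneg[OF inner_formD(1)[OF g]])
  have m: "J 1 i x (J 2 i x u) = J 3 i x u" "J 2 i x (J 1 i x u) = - J 3 i x u" for u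
    using H i by (auto simp: hyperkaehler_def)
  show ?thesis unfolding quaternionic_def by (intro conjI allI g lin sq sk m)
qed

lemma taut_hyperkaehler:
  assumes M: "smooth_manifold U" and cs: "contact_sphere U \<alpha>" "naturally_ordered U \<alpha>" and taut: "taut U \<alpha>"
  shows "determines_hyperkaehler U \<alpha> (contact_metric U \<alpha>, contact_endo U \<alpha>)"
proof -
  let ?T = "times_real U" and ?w = "Omega U \<alpha>"
  let ?g = "canonical_metric ?T ?w" and ?J = "canonical_endo ?T ?w"
  note M' = smooth_manifold_times_real[OF M]
  note t = times_real_chart[OF M]
  note tr = contact_sphere_triple(1)[OF M cs]
  note endo = canonical_smooth(1)[OF DIM_4 M' tr]
  have one: "one_form ?T (exp_form (\<alpha> k))" for k
    using cs one_form_exp_form[OF M] by (simp add: contact_sphere_def)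
  \<comment> \<open>The smooth canonical tensors coincide with the chosen normal form at each point,
    so they satisfy the quaternion relations and can also be differentiated.\<close>
  have pt: "quaternionic (?g i y) (?J 1 i y) (?J 2 i y) (?J 3 i y) \<and> (\<forall>k u v. ?w k i y u v = - ?g i y u (?J k i y v))"
    if i: "in_chart ?T i y" for i y
  proof -
    obtain x s where y: "y = (x, s)" by (metis surj_pair)
    then have "in_chart U i x" using i t by simp
    from contact_sphere_normal_form(2)[OF M cs this taut, of s] obtain h I J K where Q: "quaternionic h I J K"
      and w: "\<And>u v. ?w 1 i y u v = - h u (I v)" "\<And>u v. ?w 2 i y u v = - h u (J v)" "\<And>u v. ?w 3 i y u v = - h u (K v)"
      unfolding y by blast
    note c = canonical_quaternionic[where w = ?w, OF DIM_4 i Q w]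
    have "?w k i y u v = - ?g i y u (?J k i y v)" for k u v
      using exhaust_3[of k] by (elim disjE) (simp_all add: c w)
    then show ?thesis using Q unfolding c by blast
  qed
  have par: "frechet_derivative (\<lambda>y. ?J k i y v) (at y) u + christoffel ?g i y u (?J k i y v)
          - ?J k i y (christoffel ?g i y u v) = 0 \<and> nijenhuis (?J k) i y u v = 0"
    if i: "in_chart ?T i y" for k i y u v
  proof -
    have i': "i \<in> charts ?T" "y \<in> chart_image ?T i" using i by (auto simp: in_chart_def)
    have pt': "quaternionic (?g i y) (?J 1 i y) (?J 2 i y) (?J 3 i y)" "?w k i y u v = - ?g i y u (?J k i y v)"
      if "y \<in> chart_image ?T i" for y k u v
    proof -
      have "in_chart ?T i y" using i'(1) that by (simp add: in_chart_def)
      from pt[OF this] show "quaternionic (?g i y) (?J 1 i y) (?J 2 i y) (?J 3 i y)"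
        "?w k i y u v = - ?g i y u (?J k i y v)" by blast+
    qed
    have smg: "smooth_on (chart_image ?T i) (\<lambda>y. ?g i y u v)" for u v
      using contact_sphere_metric[OF M cs] i'(1) unfolding riemannian_metric_def tensor_field2_def by blast
    have smJ: "smooth_on (chart_image ?T i) (\<lambda>y. ?J k i y v)" for k v
      using endo i'(1) unfolding endo_field_def by blast
    have closed: "frechet_derivative (\<lambda>y. ?w k i y v z) (at y) u
      + frechet_derivative (\<lambda>y. ?w k i y z u) (at y) v + frechet_derivative (\<lambda>y. ?w k i y u v) (at y) z = 0" for k u v z
      unfolding Omega_def by (rule ext_deriv_closed[OF smooth_manifold_chart(2)[OF M' i'(1)] i'(1) one i'(2)])
    show ?thesis
      using closed_hermitian_triple_parallel[where g = ?g and J = ?J and w = ?w and S = "chart_image ?T i",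
        OF smooth_manifold_chart(2)[OF M' i'(1)] i'(2) DIM_4 pt'(1) smg smJ pt'(2) closed] by blast
  qed
  have sq: "?J k i y (?J k i y u) = - u" and sk: "?g i y u (?J k i y v) = - ?g i y v (?J k i y u)"
    if i: "in_chart ?T i y" for k i y u v
    using exhaust_3[of k] quaternionicD(5-10)[OF conjunct1[OF pt[OF i]]] by metis+
  have iso: "?g i y (?J k i y u) (?J k i y v) = ?g i y u v" if i: "in_chart ?T i y" for k i y u v
  proof -
    note g = quaternionicD(1)[OF conjunct1[OF pt[OF i]]]
    show ?thesis using sk[OF i, where k = k and u = "?J k i y u" and v = v] inner_formD(2)[OF g, of v u]
      by (simp add: sq[OF i] bilinear_rneg[OF inner_formD(1)[OF g]])
  qed
  have "hyperkaehler ?T ?g ?J"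
    unfolding hyperkaehler_def complex_structure_def parallel_endo_def
  proof (intro conjI allI impI)
    show "riemannian_metric ?T ?g" by (rule contact_sphere_metric[OF M cs])
    show "endo_field ?T (?J k)" for k by (rule endo)
    show "?J 1 i y (?J 2 i y u) = ?J 3 i y u" "?J 2 i y (?J 1 i y u) = - ?J 3 i y u"
      if i: "in_chart ?T i y" for i y u
      using quaternionicD(11,12)[OF conjunct1[OF pt[OF i]]] by blast+
  qed (use sq par iso in blast)+
  then show ?thesis using pt by (simp add: determines_hyperkaehler_def)
qed

lemma determines_hyperkaehler_unique:
  assumes M: "smooth_manifold U" and H: "determines_hyperkaehler U \<alpha> H"
  shows "H = (contact_metric U \<alpha>, contact_endo U \<alpha>)"
proof -
  let ?T = "times_real U" and ?w = "Omega U \<alpha>"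
  obtain g J where gJ: "H = (g, J)" by (metis surj_pair)
  have hk: "hyperkaehler ?T g J" and w: "\<And>k i y u v. in_chart ?T i y \<Longrightarrow> ?w k i y u v = - g i y u (J k i y v)"
    using H by (auto simp: determines_hyperkaehler_def gJ)
  have "g i y = canonical_metric ?T ?w i y \<and> J k i y = canonical_endo ?T ?w k i y" for k i y
  proof (cases "in_chart ?T i y")
    case True
    note c = canonical_quaternionic[where w = ?w, OF DIM_4 True hyperkaehler_quaternionic[OF hk True] w[OF True] w[OF True] w[OF True]]
    show ?thesis using exhaust_3[of k] by (elim disjE) (simp_all add: c)
  \<comment> \<open>Outside the charts both structures vanish by normalisation, so the equality is
    one of functions.\<close>
  next
    case False
    have "g i y = (\<lambda>_ _. 0)"
      using hk False unfolding hyperkaehler_def riemannian_metric_def tensor_field2_def by blast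
    moreover have "J k i y = (\<lambda>_. 0)"
      using hk False unfolding hyperkaehler_def complex_structure_def endo_field_def by blast
    moreover have "canonical_metric ?T ?w i y = (\<lambda>_ _. 0)" "canonical_endo ?T ?w k i y = (\<lambda>_. 0)"
      using False by (intro ext; simp only: canonical_metric_def canonical_endo_def if_False)+
    ultimately show ?thesis by simp
  qed
  then show ?thesis by (simp add: gJ fun_eq_iff)
qed

lemma isomorphic_canonical_hyperkaehler:
  assumes M: "smooth_manifold U" and \<alpha>: "contact_sphere U \<alpha>" "naturally_ordered U \<alpha>"
    and \<beta>: "contact_sphere U \<beta>" "naturally_ordered U \<beta>" and eq: "conformally_equivalent U \<alpha> \<beta>"
  shows "isomorphic_hyperkaehler (times_real U)
    (contact_metric U \<alpha>, contact_endo U \<alpha>)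
    (contact_metric U \<beta>, contact_endo U \<beta>)"
proof -
  have one: "one_form U (\<alpha> k)" "one_form U (\<beta> k)" for k using \<alpha> \<beta> by (simp_all add: contact_sphere_def)
  obtain F \<phi> where "\<And>p t. F (p, t) = (p, t + \<phi> p)" "smooth_function U \<phi>"
    and diffeo: "diffeomorphism (times_real U) (times_real U) F"
    and pb: "\<And>k. pullback2 (times_real U) (times_real U) F (Omega U \<beta> k) (Omega U \<alpha> k)"
    by (rule conformally_equivalent_translation[OF M one eq]) (rule that)
  have smF: "smooth_map (times_real U) (times_real U) F" using diffeo by (simp add: diffeomorphism_def)
  note cp = canonical_pullback[OF DIM_4 smooth_manifold_times_real[OF M] smF
    contact_sphere_triple(1)[OF M \<alpha>] contact_sphere_triple(1)[OF M \<beta>] pb]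
  show ?thesis unfolding isomorphic_hyperkaehler_def using diffeo cp by auto
qed

theorem proposition8:
  fixes U :: "('i, 'a::{t2_space, second_countable_topology}, real^3) atlas"
  assumes "smooth_manifold U"
  shows
    "(\<forall>\<alpha>. contact_sphere U \<alpha> \<and> naturally_ordered U \<alpha> \<longrightarrow>
        (\<exists>!C. determines_conformal U \<alpha> C)) \<and>
     (\<forall>\<alpha>. contact_sphere U \<alpha> \<and> naturally_ordered U \<alpha> \<and> taut U \<alpha> \<longrightarrow>
        (\<exists>!H. determines_hyperkaehler U \<alpha> H)) \<and>
     (\<forall>\<alpha> \<beta>. contact_sphere U \<alpha> \<and> naturally_ordered U \<alpha> \<and>
        contact_sphere U \<beta> \<and> naturally_ordered U \<beta> \<and> conformally_equivalent U \<alpha> \<beta> \<longrightarrow>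
        (\<forall>C C'. determines_conformal U \<alpha> C \<and> determines_conformal U \<beta> C' \<longrightarrow>
           isomorphic_conformal (times_real U) C C')) \<and>
     (\<forall>\<alpha> \<beta>. contact_sphere U \<alpha> \<and> naturally_ordered U \<alpha> \<and> taut U \<alpha> \<and>
        contact_sphere U \<beta> \<and> naturally_ordered U \<beta> \<and> taut U \<beta> \<and>
        conformally_equivalent U \<alpha> \<beta> \<longrightarrow>
        (\<forall>H H'. determines_hyperkaehler U \<alpha> H \<and> determines_hyperkaehler U \<beta> H' \<longrightarrow>
           isomorphic_hyperkaehler (times_real U) H H'))"
proof (intro conjI allI impI; elim conjE)
  note M = assms
  fix \<alpha> assume \<alpha>: "contact_sphere U \<alpha>" "naturally_ordered U \<alpha>"
  show "\<exists>!C. determines_conformal U \<alpha> C"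
    unfolding determines_conformal_iff[OF M \<alpha>] by simp
  show "\<exists>!H. determines_hyperkaehler U \<alpha> H" if "taut U \<alpha>"
    using taut_hyperkaehler[OF M \<alpha> that] determines_hyperkaehler_unique[OF M] by blast
  fix \<beta> assume \<beta>: "contact_sphere U \<beta>" "naturally_ordered U \<beta>" and eq: "conformally_equivalent U \<alpha> \<beta>"
  show "isomorphic_conformal (times_real U) C C'"
    if "determines_conformal U \<alpha> C" "determines_conformal U \<beta> C'" for C C'
    using isomorphic_canonical_conformal[OF M \<alpha> \<beta> eq] that
    unfolding determines_conformal_iff[OF M \<alpha>] determines_conformal_iff[OF M \<beta>] by simp
  show "isomorphic_hyperkaehler (times_real U) H H'"
    if "determines_hyperkaehler U \<alpha> H" "determines_hyperkaehler U \<beta> H'" for H H'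
    using isomorphic_canonical_hyperkaehler[OF M \<alpha> \<beta> eq]
      determines_hyperkaehler_unique[OF M that(1)] determines_hyperkaehler_unique[OF M that(2)] by simp
qed

end
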